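(* Let $X$ be a weakly non-null stationary ergodic process with finite alphabet $A$ whose continuity rates satisfy $\bar\gamma(k)\le\delta_12^{-\zeta_1k}$ and $\underline\gamma(k)\ge\delta_22^{-\zeta_2k}$ for all $k$, for some $\zeta_1,\zeta_2,\delta_1,\delta_2>0$ with $\zeta_2\ge\zeta_1$. Let IC be either the PML criterion with penalty function $\mathrm{pen}(n)=O(\sqrt n)$, or the NML criterion, or the KT criterion. If $\frac{6\log|A|}{\zeta_1}\le\varepsilon<\frac12$, then \[ \Pr\Bigl(\hat k_{\mathrm{IC}}(X_1^n)\le\frac{1}{2\zeta_2}\Bigl(\frac12-\varepsilon\Bigr)\log n-c_3\Bigr)\le\exp\Bigl(-\frac{c_2\varepsilon^3}{\log n}n^{\varepsilon/2}\Bigr) \] for all $n\ge n_0$, where $c_2,n_0>0$ and $c_3\in\mathbb R$ are constants depending only on the distribution of the process and on $\mathrm{pen}(n)$.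
   Context: $A$ finite alphabet, $|A|\ge2$; $X=\{X_i\}_{i\in\mathbb Z}$ stationary ergodic with values in $A$; $P(a|x_{-k}^{-1})=\Pr(X_0=a\mid X_{-k}^{-1}=x_{-k}^{-1})$, $P(a|x_{-\infty}^{-1})$ the conditional probability given the infinite past; logs base 2. Weakly non-null: $\sum_{a}\inf_{x_{-\infty}^{-1}}P(a|x_{-\infty}^{-1})>0$. Continuity rates: $\bar\gamma(k)=\sup_{x_{-\infty}^{-1}\in A^\infty}\sum_{a\in A}|P(a|x_{-k}^{-1})-P(a|x_{-\infty}^{-1})|$ and $\underline\gamma(k)=\inf_{x_{-\infty}^{-1}\in A^\infty}\sum_{a\in A}|P(a|x_{-k}^{-1})-P(a|x_{-\infty}^{-1})|$. Counts $N_n(a_1^k)=|\{i:0\le i\le n-k,\ X_{i+1}^{i+k}=a_1^k\}|$, $\hat P(a_{k+1}|a_1^k)=N_n(a_1^{k+1})/N_{n-1}(a_1^k)$. $\mathrm{ML}_k(X_1^n)=\prod_{a_1^{k+1}}\hat P(a_{k+1}|a_1^k)^{N_n(a_1^{k+1})}$. $\mathrm{pen}(n)$ is a non-decreasing function. For $0\le k<n$: $\mathrm{PML}_{X_1^n}(k)=-\log\mathrm{ML}_k(X_1^n)+(|A|-1)|A|^k\mathrm{pen}(n)$; $\mathrm{NML}_{X_1^n}(k)=-\log\mathrm{ML}_k(X_1^n)+\log\sum_{x_1^n\in A^n}\mathrm{ML}_k(x_1^n)$; $\mathrm{KT}_{X_1^n}(k)=-\log P_{\mathrm{KT},k}(X_1^n)$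 with $P_{\mathrm{KT},k}(X_1^n)=|A|^{-k}\prod_{a_1^k:N_{n-1}(a_1^k)\ge1}\frac{\prod_{a_{k+1}:N_n(a_1^{k+1})\ge1}(N_n(a_1^{k+1})-\frac12)\cdots\frac12}{(N_{n-1}(a_1^k)-1+\frac{|A|}2)\cdots\frac{|A|}2}$ (for $k=0$, $N_{n-1}(a_1^k)=n$). $\hat k_{\mathrm{IC}}(X_1^n)=\arg\min_{0\le k<n}\mathrm{IC}_{X_1^n}(k)$ (smallest minimizer). *)

theory Defs
  imports "HOL-Probability.Probability" "HOL-Library.Landau_Symbols"
begin

text \<open>A process is X :: int => 'm => 'a on a probability space M; the alphabet A is the
finite type 'a (A = UNIV).\<close>

definition process :: "'m measure \<Rightarrow> (int \<Rightarrow> 'm \<Rightarrow> 'a) \<Rightarrow> bool" where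
  "process M X \<longleftrightarrow> (\<forall>i. X i \<in> measurable M (count_space UNIV))"

definition stationary :: "'m measure \<Rightarrow> (int \<Rightarrow> 'm \<Rightarrow> 'a) \<Rightarrow> bool" where
  "stationary M X \<longleftrightarrow>
     (\<forall>(t::int) (w::'a list).
        measure M {\<omega>\<in>space M. \<forall>j<length w. X (t + int j) \<omega> = w ! j}
      = measure M {\<omega>\<in>space M. \<forall>j<length w. X (int j) \<omega> = w ! j})"

definition ergodic :: "'m measure \<Rightarrow> (int \<Rightarrow> 'm \<Rightarrow> 'a) \<Rightarrow> bool" where
  "ergodic M X \<longleftrightarrow>
     (\<forall>B \<in> sets (Pi\<^sub>M (UNIV::int set) (\<lambda>_. count_space (UNIV::'a set))).
        (\<forall>x. x \<in> B \<longleftrightarrow> (\<lambda>i. x (i + 1)) \<in> B) \<longrightarrow>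
        measure M {\<omega>\<in>space M. (\<lambda>i. X i \<omega>) \<in> B} \<in> {0, 1})"

definition past :: "(int \<Rightarrow> 'm \<Rightarrow> 'a) \<Rightarrow> 'm \<Rightarrow> nat \<Rightarrow> 'a" where
  "past X \<omega> j = X (- (int j + 1)) \<omega>"

definition past_sigma :: "'m measure \<Rightarrow> (int \<Rightarrow> 'm \<Rightarrow> 'a) \<Rightarrow> 'm measure" where
  "past_sigma M X = vimage_algebra (space M) (past X)
      (Pi\<^sub>M (UNIV::nat set) (\<lambda>_. count_space (UNIV::'a set)))"

definition cond_prob_past ::
  "'m measure \<Rightarrow> (int \<Rightarrow> 'm \<Rightarrow> 'a::finite) \<Rightarrow> ((nat \<Rightarrow> 'a) \<Rightarrow> 'a \<Rightarrow> real) \<Rightarrow> bool" where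
  "cond_prob_past M X p \<longleftrightarrow>
     (\<forall>a. (\<lambda>y. p y a) \<in> borel_measurable (Pi\<^sub>M (UNIV::nat set) (\<lambda>_. count_space (UNIV::'a set)))) \<and>
     (\<forall>y. (\<forall>a. 0 \<le> p y a) \<and> (\<Sum>a\<in>UNIV. p y a) = 1) \<and>
     (\<forall>a. AE \<omega> in M. p (past X \<omega>) a =
            real_cond_exp M (past_sigma M X) (indicator {\<omega>\<in>space M. X 0 \<omega> = a}) \<omega>)"

definition blockP :: "'m measure \<Rightarrow> (int \<Rightarrow> 'm \<Rightarrow> 'a) \<Rightarrow> nat \<Rightarrow> (nat \<Rightarrow> 'a) \<Rightarrow> real" where
  "blockP M X k y = measure M {\<omega>\<in>space M. \<forall>j<k. X (- (int j + 1)) \<omega> = y j}"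

definition condk :: "'m measure \<Rightarrow> (int \<Rightarrow> 'm \<Rightarrow> 'a) \<Rightarrow> nat \<Rightarrow> (nat \<Rightarrow> 'a) \<Rightarrow> 'a \<Rightarrow> real" where
  "condk M X k y a =
     measure M {\<omega>\<in>space M. X 0 \<omega> = a \<and> (\<forall>j<k. X (- (int j + 1)) \<omega> = y j)} / blockP M X k y"

text \<open>Pasts all of whose finite blocks have positive probability (where the conditional
  probabilities are meaningful).\<close>
definition past_support :: "'m measure \<Rightarrow> (int \<Rightarrow> 'm \<Rightarrow> 'a) \<Rightarrow> (nat \<Rightarrow> 'a) set" where
  "past_support M X = {y. \<forall>k. 0 < blockP M X k y}"

definition gamma_up ::
  "'m measure \<Rightarrow> (int \<Rightarrow> 'm \<Rightarrow> 'a::finite) \<Rightarrow> ((nat \<Rightarrow> 'a) \<Rightarrow> 'a \<Rightarrow> real) \<Rightarrow> nat \<Rightarrow> real" where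
  "gamma_up M X p k = (SUP y \<in> past_support M X. \<Sum>a\<in>UNIV. \<bar>condk M X k y a - p y a\<bar>)"

definition gamma_low ::
  "'m measure \<Rightarrow> (int \<Rightarrow> 'm \<Rightarrow> 'a::finite) \<Rightarrow> ((nat \<Rightarrow> 'a) \<Rightarrow> 'a \<Rightarrow> real) \<Rightarrow> nat \<Rightarrow> real" where
  "gamma_low M X p k = (INF y \<in> past_support M X. \<Sum>a\<in>UNIV. \<bar>condk M X k y a - p y a\<bar>)"

definition weakly_non_null ::
  "'m measure \<Rightarrow> (int \<Rightarrow> 'm \<Rightarrow> 'a::finite) \<Rightarrow> ((nat \<Rightarrow> 'a) \<Rightarrow> 'a \<Rightarrow> real) \<Rightarrow> bool" where
  "weakly_non_null M X p \<longleftrightarrow> 0 < (\<Sum>a\<in>UNIV. INF y \<in> past_support M X. p y a)"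

section \<open>Estimators (sample x_1^n is the list xs of length n, x_i = xs ! (i-1))\<close>

text \<open>N_n(w) for the sample xs (n = length xs); N_{n-1}(w) is cnt (butlast xs) w.\<close>
definition cnt :: "'a list \<Rightarrow> 'a list \<Rightarrow> nat" where
  "cnt xs w = card {i. i + length w \<le> length xs \<and> take (length w) (drop i xs) = w}"

definition MLk :: "nat \<Rightarrow> ('a::finite) list \<Rightarrow> real" where
  "MLk k xs = (\<Prod>w \<in> {w::'a list. length w = k + 1}.
      (real (cnt xs w) / real (cnt (butlast xs) (butlast w))) ^ cnt xs w)"

definition PML :: "(nat \<Rightarrow> real) \<Rightarrow> nat \<Rightarrow> ('a::finite) list \<Rightarrow> real" where
  "PML pen k xs = - log 2 (MLk k xs)
      + (real CARD('a) - 1) * real CARD('a) ^ k * pen (length xs)"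

definition NML :: "nat \<Rightarrow> ('a::finite) list \<Rightarrow> real" where
  "NML k xs = - log 2 (MLk k xs)
      + log 2 (\<Sum>ys \<in> {ys::'a list. length ys = length xs}. MLk k ys)"

definition P_KT :: "nat \<Rightarrow> ('a::finite) list \<Rightarrow> real" where
  "P_KT k xs = (1 / real CARD('a) ^ k) *
     (\<Prod>u \<in> {u::'a list. length u = k \<and> 1 \<le> cnt (butlast xs) u}.
        (\<Prod>a \<in> {a. 1 \<le> cnt xs (u @ [a])}. \<Prod>j<cnt xs (u @ [a]). (real j + 1/2))
        / (\<Prod>j<cnt (butlast xs) u. (real j + real CARD('a) / 2)))"

definition KT :: "nat \<Rightarrow> ('a::finite) list \<Rightarrow> real" where
  "KT k xs = - log 2 (P_KT k xs)"

definition khat :: "(nat \<Rightarrow> 'a list \<Rightarrow> real) \<Rightarrow> 'a list \<Rightarrow> nat" where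
  "khat IC xs = (LEAST k. k < length xs \<and> (\<forall>j<length xs. IC k xs \<le> IC j xs))"

definition sample :: "(int \<Rightarrow> 'm \<Rightarrow> 'a) \<Rightarrow> nat \<Rightarrow> 'm \<Rightarrow> 'a list" where
  "sample X n \<omega> = map (\<lambda>i. X (int i) \<omega>) [1..<n+1]"

end

theory Submission
  imports Defs "HOL-Library.Sublist" "HOL-Real_Asymp.Real_Asymp"
begin

text \<open>Summable continuity rates and a uniformly non-null letter let us dominate the influence of the
  distant past by a transient house-of-cards chain. Hence the Doob martingale of a block count has
  increments of the order of the block length, and by an Azuma inequality all counts of blocks of
  length \<open>O(log n)\<close> are within \<open>n powr (7/10)\<close> of their means, off an event of probability at most
  \<open>exp (- n powr (1/4))\<close>.

  On the remaining event an order \<open>k\<close> below the bound is compared with the order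
  \<open>m \<approx> log n / (4 \<zeta>1)\<close>. By a Pinsker-type inequality the log-likelihood gains at least a multiple of
  \<open>n * (2 powr (- \<zeta>2 * k))\<^sup>2\<close>, which is of order at least \<open>n powr (1/2 + \<epsilon>)\<close>, since \<open>gamma_low\<close> bounds the distance
  of the transition probabilities of orders \<open>k\<close> and \<open>m\<close>. All three criteria differ from the negative
  log-likelihood by at most \<open>O(|A| ^ m * sqrt n)\<close>, and \<open>|A| ^ m = O(n powr (\<epsilon> / 24))\<close> by the lower bound
  on \<open>\<epsilon>\<close>; so order \<open>m\<close> beats order \<open>k\<close>.\<close>

section \<open>Sums over words and elementary inequalities\<close>

text \<open>The exponents come from a balance. For \<open>k\<close> below the bound,
  \<open>2 powr (- \<zeta>2 * k)\<close> is at least \<open>n powr (- 1/4 + \<epsilon> / 2)\<close>,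
  so the l1 separation of the counts is at least of order
  \<open>n powr (3/4 + \<epsilon> / 2)\<close>. The count error \<open>n powr (7/10)\<close>, summed
  over all blocks of length \<open>m + 1\<close>, has to stay below \<open>n powr (3/4)\<close>,
  while the Azuma exponent \<open>2 * (7/10) - 1\<close>, reduced by the square of the block length,
  has to exceed 1/4. The order \<open>m\<close> is chosen so that the upper rate at \<open>m\<close>
  is at most half of the lower rate at \<open>k\<close>: for the purpose of
  \<open>gamma_low\<close>, order \<open>m\<close> then stands in for the infinite past. With
  \<open>\<epsilon>0 = 6 * log 2 |A| / \<zeta>1\<close> one has \<open>|A| powr (log 2 n / (4 *
  \<zeta>1)) = n powr (\<epsilon>0 / 24)\<close>, and \<open>\<epsilon>0 < 1/2\<close> puts this
  below \<open>n powr (1/48)\<close>. The rates concern the infinite past, whereas the estimators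
  see finite words. The argument is therefore carried out with block probabilities, as finite sums
  over words; \<open>p\<close> serves as a common reference point to which the kernels of two words
  are compared along a shared past.\<close>

definition words :: "nat \<Rightarrow> 'a::finite list set" where
  "words n = {xs. length xs = n}"

lemma length_words: "xs \<in> words n \<Longrightarrow> length xs = n"
  by (simp add: words_def)

lemma finite_words [simp]: "finite (words n)"
  using finite_lists_length_eq[of "UNIV :: 'a::finite set" n] by (simp add: words_def)

lemma card_words: "card (words n :: 'a::finite list set) = CARD('a) ^ n"
  using card_lists_length_eq[of "UNIV :: 'a set" n] by (simp add: words_def)

lemma words_0 [simp]: "words 0 = {[]}"
  by (auto simp: words_def)

lemma sum_words_Suc_snoc:
  fixes f :: "'a::finite list \<Rightarrow> 'b::comm_monoid_add"
  shows "(\<Sum>xs\<in>words (Suc n). f xs) = (\<Sum>xs\<in>words n. \<Sum>a\<in>UNIV. f (xs @ [a]))"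
proof -
  have "bij_betw (\<lambda>(xs, a). xs @ [a]) (words n \<times> UNIV) (words (Suc n))"
    by (rule bij_betwI[where g = "\<lambda>xs. (butlast xs, last xs)"])
      (auto simp: words_def append_butlast_last_id simp flip: length_greater_0_conv)
  from sum.reindex_bij_betw[OF this, of f] show ?thesis
    by (simp add: sum.cartesian_product case_prod_unfold)
qed

lemma sum_words_Suc_Cons:
  fixes f :: "'a::finite list \<Rightarrow> real"
  shows "(\<Sum>xs\<in>words (Suc n). f xs) = (\<Sum>a\<in>UNIV. \<Sum>xs\<in>words n. f (a # xs))"
proof -
  have "bij_betw (\<lambda>(a, xs). a # xs) (UNIV \<times> words n) (words (Suc n))"
    by (rule bij_betwI[where g = "\<lambda>xs. (hd xs, tl xs)"]) (auto simp: words_def length_Suc_conv)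
  from sum.reindex_bij_betw[OF this, of f] show ?thesis
    by (simp add: sum.cartesian_product case_prod_unfold)
qed

lemma sum_words_append:
  fixes f :: "'a::finite list \<Rightarrow> real"
  shows "(\<Sum>xs\<in>words (m + n). f xs) = (\<Sum>u\<in>words m. \<Sum>v\<in>words n. f (u @ v))"
  by (induction m arbitrary: f) (simp_all add: sum_words_Suc_Cons)

section \<open>Exponential moments and couplings on a finite alphabet\<close>

lemma exp_le_add_exp_square:
  fixes x :: real
  shows "exp x \<le> x + exp (x\<^sup>2)"
proof -
  have e: "1 + x\<^sup>2 \<le> exp (x\<^sup>2)"
    by (rule exp_ge_add_one_self)
  consider "x > 1" | "0 \<le> x" "x \<le> 1" | "x < 0"
    by linarith
  then show ?thesis
  proof cases
    case 1
    then have "x \<le> x\<^sup>2"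
      by (simp add: power2_eq_square)
    then show ?thesis using 1 by (smt (verit) exp_le_cancel_iff)
  next
    case 2
    then show ?thesis using exp_bound[of x] e by linarith
  next
    case 3
    define y where "y = - x"
    have y: "y > 0" using 3 by (simp add: y_def)
    \<comment> \<open>The second factor is at most \<open>exp y\<close>, so this gives
      \<open>exp (- y) \<le> 1 - y + y\<^sup>2\<close>, the quadratic bound for negative
      arguments.\<close>
    have "1 \<le> (1 - y + y\<^sup>2) * (1 + y + y\<^sup>2 / 2)"
    proof -
      have "(1 - y + y\<^sup>2) * (1 + y + y\<^sup>2 / 2) = 1 + y\<^sup>2 / 2 + y^3 / 2 + y^4 / 2"
        by (simp add: field_simps power2_eq_square power3_eq_cube power4_eq_xxxx)
      then show ?thesis using y by simp
    qed
    moreover have "1 - y + y\<^sup>2 > 0"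
    proof -
      have "1 - y + y\<^sup>2 = (y - 1/2)\<^sup>2 + 3/4" by (simp add: power2_eq_square algebra_simps)
      also have "\<dots> > 0" by (rule add_nonneg_pos) simp_all
      finally show ?thesis .
    qed
    moreover have "1 + y + y\<^sup>2 / 2 \<le> exp y"
      using exp_lower_Taylor_quadratic[of y] y by simp
    ultimately have "1 \<le> (1 - y + y\<^sup>2) * exp y"
      using mult_left_mono[of "1 + y + y\<^sup>2 / 2" "exp y" "1 - y + y\<^sup>2"] by linarith
    then have "exp x \<le> 1 - y + y\<^sup>2"
      by (simp add: y_def exp_minus field_simps)
    then have "exp x \<le> 1 + x + x\<^sup>2" by (simp add: y_def)
    then show ?thesis using e by linarith
  qed
qed

text \<open>After centring at the mean the linear term of \<open>exp_le_add_exp_square\<close>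
  averages to zero, and a centred value is an average of pairwise differences, hence at most
  \<open>D\<close>. The constant is cruder than the usual 1/8, which only affects constants later.
  Letters of weight zero are exempt because kernels are controlled on the support only.\<close>

lemma finite_Hoeffding:
  fixes q z :: "'a::finite \<Rightarrow> real"
  assumes q: "\<And>a. q a \<ge> 0" "(\<Sum>a\<in>UNIV. q a) = 1"
    and D: "\<And>a b. q a > 0 \<Longrightarrow> q b > 0 \<Longrightarrow> \<bar>z a - z b\<bar> \<le> D"
  shows "(\<Sum>a\<in>UNIV. q a * exp (t * z a)) \<le> exp (t * (\<Sum>a\<in>UNIV. q a * z a) + t\<^sup>2 * D\<^sup>2)"
proof -
  define m where "m = (\<Sum>a\<in>UNIV. q a * z a)"
  have dev: "q a * (t * (z a - m))\<^sup>2 \<le> q a * (t\<^sup>2 * D\<^sup>2)" for a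
  proof (cases "q a > 0")
    case True
    have "z a - m = (\<Sum>b\<in>UNIV. q b * (z a - z b))"
      by (simp add: m_def right_diff_distrib sum_subtractf sum_distrib_right[symmetric] q)
    then have "\<bar>z a - m\<bar> \<le> (\<Sum>b\<in>UNIV. \<bar>q b * (z a - z b)\<bar>)"
      by simp
    also have "\<dots> \<le> (\<Sum>b\<in>UNIV. q b * D)"
    proof (rule sum_mono)
      fix b
      show "\<bar>q b * (z a - z b)\<bar> \<le> q b * D"
        using q(1)[of b] D[OF True, of b] by (cases "q b = 0") (auto simp: abs_mult)
    qed
    also have "\<dots> = D" by (simp add: sum_distrib_right[symmetric] q)
    finally have "(z a - m)\<^sup>2 \<le> D\<^sup>2"
      by (meson abs_le_square_iff abs_ge_self order_trans)
    then show ?thesis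
      using q by (intro mult_left_mono) (auto simp: power_mult_distrib intro!: mult_left_mono)
  qed (use q(1)[of a] in auto)
  have "(\<Sum>a\<in>UNIV. q a * exp (t * (z a - m))) \<le> (\<Sum>a\<in>UNIV. q a * (t * (z a - m)) + q a * exp (t\<^sup>2 * D\<^sup>2))"
  proof (rule sum_mono)
    fix a
    have "q a * exp (t * (z a - m)) \<le> q a * (t * (z a - m)) + q a * exp ((t * (z a - m))\<^sup>2)"
      using mult_left_mono[OF exp_le_add_exp_square q(1)[of a]] by (simp add: distrib_left)
    also have "q a * exp ((t * (z a - m))\<^sup>2) \<le> q a * exp (t\<^sup>2 * D\<^sup>2)"
      using dev[of a] q(1)[of a] by (cases "q a = 0") auto
    finally show "q a * exp (t * (z a - m)) \<le> q a * (t * (z a - m)) + q a * exp (t\<^sup>2 * D\<^sup>2)"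
      by simp
  qed
  also have "\<dots> = t * (\<Sum>a\<in>UNIV. q a * z a) - t * m * (\<Sum>a\<in>UNIV. q a)
      + exp (t\<^sup>2 * D\<^sup>2) * (\<Sum>a\<in>UNIV. q a)"
    unfolding sum_distrib_left sum_subtractf[symmetric] sum.distrib[symmetric]
    by (simp add: algebra_simps)
  also have "\<dots> = exp (t\<^sup>2 * D\<^sup>2)" by (simp add: q m_def)
  finally have "exp (t * m) * (\<Sum>a\<in>UNIV. q a * exp (t * (z a - m))) \<le> exp (t * m) * exp (t\<^sup>2 * D\<^sup>2)"
    by simp
  moreover have "exp (t * m) * (\<Sum>a\<in>UNIV. q a * exp (t * (z a - m))) = (\<Sum>a\<in>UNIV. q a * exp (t * z a))"
    by (simp add: sum_distrib_left mult.left_commute exp_add[symmetric] algebra_simps)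
  ultimately show ?thesis by (simp only: m_def[symmetric] exp_add)
qed

text \<open>Maximal coupling: with weight \<open>\<Sum>a. min (q a) (r a)\<close> both sides use the same letter.\<close>

lemma expectation_diff_le_coupling:
  fixes q r f h :: "'a::finite \<Rightarrow> real"
  assumes q: "\<And>a. q a \<ge> 0" "(\<Sum>a\<in>UNIV. q a) = 1"
    and r: "\<And>a. r a \<ge> 0" "(\<Sum>a\<in>UNIV. r a) = 1"
    and ov: "1 - \<eta> \<le> (\<Sum>a\<in>UNIV. min (q a) (r a))"
    and b: "\<And>a. q a > 0 \<Longrightarrow> r a > 0 \<Longrightarrow> \<bar>f a - h a\<bar> \<le> b"
    and B: "\<And>a a'. q a > 0 \<Longrightarrow> r a' > 0 \<Longrightarrow> \<bar>f a - h a'\<bar> \<le> B"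
    and bB: "0 \<le> b" "b \<le> B"
  shows "\<bar>(\<Sum>a\<in>UNIV. q a * f a) - (\<Sum>a\<in>UNIV. r a * h a)\<bar> \<le> (1 - \<eta>) * b + \<eta> * B"
proof -
  define m where "m a = min (q a) (r a)" for a
  define \<tau> where "\<tau> = 1 - (\<Sum>a\<in>UNIV. m a)"
  have q': "(\<Sum>a\<in>UNIV. q a - m a) = \<tau>" and r': "(\<Sum>a\<in>UNIV. r a - m a) = \<tau>"
    by (simp_all add: sum_subtractf q r \<tau>_def)
  have "\<tau> \<ge> 0" unfolding q'[symmetric] by (rule sum_nonneg) (simp add: m_def)
  have "\<tau> \<le> \<eta>" using ov by (simp add: \<tau>_def m_def)
  have common: "\<bar>\<Sum>a\<in>UNIV. m a * (f a - h a)\<bar> \<le> (1 - \<tau>) * b"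
  proof -
    have "\<bar>\<Sum>a\<in>UNIV. m a * (f a - h a)\<bar> \<le> (\<Sum>a\<in>UNIV. \<bar>m a * (f a - h a)\<bar>)" by simp
    also have "\<dots> \<le> (\<Sum>a\<in>UNIV. m a * b)"
    proof (rule sum_mono)
      fix a
      show "\<bar>m a * (f a - h a)\<bar> \<le> m a * b"
      proof (cases "q a = 0 \<or> r a = 0")
        case True
        then show ?thesis using q(1)[of a] r(1)[of a] by (auto simp: m_def min_def)
      next
        case False
        then have "q a > 0" "r a > 0" using q(1)[of a] r(1)[of a] by auto
        then show ?thesis using b[of a] by (auto simp: abs_mult m_def intro!: mult_left_mono)
      qed
    qed
    also have "\<dots> = (1 - \<tau>) * b" by (simp add: sum_distrib_right[symmetric] \<tau>_def)
    finally show ?thesis .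
  qed
  have rest: "\<bar>(\<Sum>a\<in>UNIV. (q a - m a) * f a) - (\<Sum>a\<in>UNIV. (r a - m a) * h a)\<bar> \<le> \<tau> * B"
  proof (cases "\<tau> = 0")
    case True
    have "\<forall>a\<in>UNIV. q a - m a = 0"
      by (subst sum_nonneg_eq_0_iff[symmetric]) (use q' True in \<open>auto simp: m_def\<close>)
    moreover have "\<forall>a\<in>UNIV. r a - m a = 0"
      by (subst sum_nonneg_eq_0_iff[symmetric]) (use r' True in \<open>auto simp: m_def\<close>)
    ultimately have "q a - m a = 0" "r a - m a = 0" for a by auto
    then show ?thesis using True by simp
  next
    case False
    then have "\<tau> > 0" using \<open>\<tau> \<ge> 0\<close> by simp
    \<comment> \<open>Independent coupling of the two residual weights. Both have total mass
      \<open>\<tau>\<close>, so summing out the other coordinate produces the factor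
      \<open>\<tau>\<close> that is cancelled at the end.\<close>
    let ?S = "\<Sum>a\<in>UNIV. \<Sum>a'\<in>UNIV. (q a - m a) * (r a' - m a') * (f a - h a')"
    have "?S = \<tau> * ((\<Sum>a\<in>UNIV. (q a - m a) * f a) - (\<Sum>a\<in>UNIV. (r a - m a) * h a))"
    proof -
      have "?S = (\<Sum>a\<in>UNIV. \<Sum>a'\<in>UNIV. (q a - m a) * f a * (r a' - m a'))
                - (\<Sum>a\<in>UNIV. \<Sum>a'\<in>UNIV. (q a - m a) * ((r a' - m a') * h a'))"
        by (simp add: sum_subtractf[symmetric] algebra_simps)
      also have "\<dots> = (\<Sum>a\<in>UNIV. (q a - m a) * f a) * \<tau> - \<tau> * (\<Sum>a\<in>UNIV. (r a - m a) * h a)"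
        by (simp add: sum_product[symmetric] q' r')
      finally show ?thesis by (simp add: algebra_simps)
    qed
    moreover have "\<bar>?S\<bar> \<le> \<tau> * \<tau> * B"
    proof -
      have "\<bar>?S\<bar> \<le> (\<Sum>a\<in>UNIV. \<Sum>a'\<in>UNIV. \<bar>(q a - m a) * (r a' - m a') * (f a - h a')\<bar>)"
        by (intro order_trans[OF sum_abs] sum_mono) simp
      also have "\<dots> \<le> (\<Sum>a\<in>UNIV. \<Sum>a'\<in>UNIV. (q a - m a) * (r a' - m a') * B)"
      proof (intro sum_mono)
        fix a a'
        show "\<bar>(q a - m a) * (r a' - m a') * (f a - h a')\<bar> \<le> (q a - m a) * (r a' - m a') * B"
        proof (cases "q a > 0 \<and> r a' > 0")
          case True
          have "q a - m a \<ge> 0" "r a' - m a' \<ge> 0" by (auto simp: m_def)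
          then show ?thesis using B[of a a'] True by (auto simp: abs_mult intro!: mult_left_mono)
        next
          case False
          then have "q a = 0 \<or> r a' = 0" using q(1)[of a] r(1)[of a'] by force
          then have "q a - m a = 0 \<or> r a' - m a' = 0" using q(1)[of a] r(1)[of a] q(1)[of a'] r(1)[of a']
            by (auto simp: m_def)
          then show ?thesis by auto
        qed
      qed
      also have "\<dots> = \<tau> * \<tau> * B"
        by (simp add: sum_distrib_right[symmetric] sum_product[symmetric] q' r')
      finally show ?thesis .
    qed
    ultimately show ?thesis
      using \<open>\<tau> > 0\<close> by (simp add: abs_mult mult.assoc)
  qed
  have "(\<Sum>a\<in>UNIV. q a * f a) - (\<Sum>a\<in>UNIV. r a * h a) = (\<Sum>a\<in>UNIV. m a * (f a - h a)) +
      ((\<Sum>a\<in>UNIV. (q a - m a) * f a) - (\<Sum>a\<in>UNIV. (r a - m a) * h a))"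
    by (simp add: sum_subtractf[symmetric] sum.distrib[symmetric] algebra_simps)
  then have "\<bar>(\<Sum>a\<in>UNIV. q a * f a) - (\<Sum>a\<in>UNIV. r a * h a)\<bar> \<le> (1 - \<tau>) * b + \<tau> * B"
    using common rest by linarith
  also have "\<dots> = b + \<tau> * (B - b)" by (simp add: algebra_simps)
  also have "\<dots> \<le> b + \<eta> * (B - b)" using \<open>\<tau> \<le> \<eta>\<close> bB by (simp add: mult_right_mono)
  finally show ?thesis by (simp add: algebra_simps)
qed

section \<open>Concentration of block counts\<close>

text \<open>Block probabilities of a stationary process as a function on words:
  \<open>\<mu>_snoc\<close> is consistency and \<open>\<mu>_Cons\<close> is stationarity.
  Expectations become finite sums.\<close>

locale block_measure =
  fixes \<mu> :: "'a::finite list \<Rightarrow> real"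
  assumes \<mu>_nonneg: "\<mu> u \<ge> 0"
    and \<mu>_Nil: "\<mu> [] = 1"
    and \<mu>_snoc: "(\<Sum>a\<in>UNIV. \<mu> (u @ [a])) = \<mu> u"
    and \<mu>_Cons: "(\<Sum>a\<in>UNIV. \<mu> (a # u)) = \<mu> u"
begin

text \<open>For \<open>\<mu> u = 0\<close> the division yields the zero function, so a row sums to 1
  or to 0; this is why \<open>kernel_sum_le\<close> needs no positivity.\<close>

definition kernel :: "'a list \<Rightarrow> 'a \<Rightarrow> real" where
  "kernel u a = \<mu> (u @ [a]) / \<mu> u"

text \<open>Conditional expectation one letter ahead. Thus \<open>(step ^^ s) F u\<close> is the
  conditional expectation of \<open>F\<close> at the word \<open>u\<close> continued by
  \<open>s\<close> letters, that is, a value of the Doob martingale of \<open>F\<close>.\<close>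

definition step :: "('a list \<Rightarrow> real) \<Rightarrow> 'a list \<Rightarrow> real" where
  "step f u = (\<Sum>a\<in>UNIV. kernel u a * f (u @ [a]))"

lemma kernel_nonneg: "kernel u a \<ge> 0"
  by (simp add: kernel_def \<mu>_nonneg)

lemma kernel_sum: "\<mu> u > 0 \<Longrightarrow> (\<Sum>a\<in>UNIV. kernel u a) = 1"
  by (simp add: kernel_def sum_divide_distrib[symmetric] \<mu>_snoc)

lemma kernel_sum_le: "(\<Sum>a\<in>UNIV. kernel u a) \<le> 1"
  using kernel_sum[of u] \<mu>_nonneg[of u] by (cases "\<mu> u = 0") (auto simp: kernel_def)

lemma \<mu>_snoc_le: "\<mu> (u @ [a]) \<le> \<mu> u"
  unfolding \<mu>_snoc[of u, symmetric] by (rule member_le_sum) (auto simp: \<mu>_nonneg)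

lemma \<mu>_Cons_le: "\<mu> (a # u) \<le> \<mu> u"
  unfolding \<mu>_Cons[of u, symmetric] by (rule member_le_sum[where f = "\<lambda>a. \<mu> (a # u)"]) (auto simp: \<mu>_nonneg)

lemma \<mu>_suffix_le: "\<mu> (v @ u) \<le> \<mu> u"
  by (induction v) (use \<mu>_Cons_le order_trans in \<open>auto, blast\<close>)

lemma \<mu>_mult_kernel: "\<mu> u * kernel u a = \<mu> (u @ [a])"
  using \<mu>_snoc_le[of u a] \<mu>_nonneg[of "u @ [a]"] by (cases "\<mu> u = 0") (auto simp: kernel_def)

lemma kernel_pos: "kernel u a > 0 \<Longrightarrow> \<mu> (u @ [a]) > 0"
  using \<mu>_mult_kernel[of u a] \<mu>_nonneg[of u] \<mu>_nonneg[of "u @ [a]"]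
  by (cases "\<mu> (u @ [a]) = 0") (auto simp: kernel_def)

lemma sum_\<mu>_prefix: "(\<Sum>v\<in>words n. \<mu> (v @ u)) = \<mu> u"
proof (induction n arbitrary: u)
  case (Suc n)
  have "(\<Sum>v\<in>words (Suc n). \<mu> (v @ u)) = (\<Sum>v\<in>words n. \<Sum>a\<in>UNIV. \<mu> (v @ a # u))"
    by (simp add: sum_words_Suc_snoc)
  also have "\<dots> = (\<Sum>a\<in>UNIV. \<Sum>v\<in>words n. \<mu> (v @ a # u))"
    by (rule sum.swap)
  also have "\<dots> = \<mu> u" by (simp add: Suc \<mu>_Cons)
  finally show ?case .
qed simp

lemma sum_\<mu>: "(\<Sum>v\<in>words n. \<mu> v) = 1"
  using sum_\<mu>_prefix[of "[]" n] by (simp add: \<mu>_Nil)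

lemma step_cong:
  assumes "\<And>a. \<mu> (u @ [a]) > 0 \<Longrightarrow> f (u @ [a]) = g (u @ [a])"
  shows "step f u = step g u"
  unfolding step_def
proof (rule sum.cong)
  fix a
  show "kernel u a * f (u @ [a]) = kernel u a * g (u @ [a])"
    using assms[of a] kernel_pos[of u a] kernel_nonneg[of u a] by (cases "kernel u a = 0") auto
qed simp

lemma step_mono:
  assumes "\<And>a. \<mu> (u @ [a]) > 0 \<Longrightarrow> f (u @ [a]) \<le> g (u @ [a])"
  shows "step f u \<le> step g u"
  unfolding step_def
proof (rule sum_mono)
  fix a
  show "kernel u a * f (u @ [a]) \<le> kernel u a * g (u @ [a])"
    using assms[of a] kernel_pos[of u a] kernel_nonneg[of u a] by (cases "kernel u a = 0") auto
qed

lemma step_iterate: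
  "\<mu> u * (step ^^ n) f u = (\<Sum>x\<in>words n. \<mu> (u @ x) * f (u @ x))"
proof (induction n arbitrary: u)
  case (Suc n)
  have "\<mu> u * (step ^^ Suc n) f u = (\<Sum>a\<in>UNIV. \<mu> (u @ [a]) * (step ^^ n) f (u @ [a]))"
    by (simp add: step_def sum_distrib_left mult.assoc[symmetric] \<mu>_mult_kernel)
  also have "\<dots> = (\<Sum>a\<in>UNIV. \<Sum>x\<in>words n. \<mu> (u @ a # x) * f (u @ a # x))"
    by (simp add: Suc)
  finally show ?case by (simp add: sum_words_Suc_Cons)
qed simp

lemma expectation_eq_step: "(\<Sum>x\<in>words n. \<mu> x * f x) = (step ^^ n) f []"
  using step_iterate[of "[]" n f] by (simp add: \<mu>_Nil)

text \<open>Peeling off the next letter, \<open>finite_Hoeffding\<close> is applied to the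
  martingale values \<open>(step ^^ n) F (u @ [a])\<close>, so each letter costs a factor
  \<open>exp (t\<^sup>2 * D\<^sup>2)\<close>. The bound \<open>D\<close> is required for every
  number of remaining steps, since that number changes along the induction.\<close>

lemma step_exp_le:
  assumes D: "\<And>s u a b. \<mu> (u @ [a]) > 0 \<Longrightarrow> \<mu> (u @ [b]) > 0 \<Longrightarrow>
      \<bar>(step ^^ s) F (u @ [a]) - (step ^^ s) F (u @ [b])\<bar> \<le> D"
    and "\<mu> u > 0"
  shows "(step ^^ n) (\<lambda>x. exp (t * F x)) u \<le> exp (t * (step ^^ n) F u + real n * (t\<^sup>2 * D\<^sup>2))"
  using assms(2)
proof (induction n arbitrary: u)
  case (Suc n)
  have "(step ^^ Suc n) (\<lambda>x. exp (t * F x)) u = step ((step ^^ n) (\<lambda>x. exp (t * F x))) u"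
    by simp
  also have "\<dots> \<le> step (\<lambda>u. exp (t * (step ^^ n) F u + real n * (t\<^sup>2 * D\<^sup>2))) u"
    by (rule step_mono) (rule Suc.IH)
  also have "\<dots> = exp (real n * (t\<^sup>2 * D\<^sup>2)) * (\<Sum>a\<in>UNIV. kernel u a * exp (t * (step ^^ n) F (u @ [a])))"
    by (simp add: step_def exp_add sum_distrib_left mult_ac)
  also have "\<dots> \<le> exp (real n * (t\<^sup>2 * D\<^sup>2)) *
      exp (t * (\<Sum>a\<in>UNIV. kernel u a * (step ^^ n) F (u @ [a])) + t\<^sup>2 * D\<^sup>2)"
    by (intro mult_left_mono finite_Hoeffding D kernel_pos kernel_nonneg kernel_sum Suc.prems) simp_all
  also have "\<dots> = exp (t * (step ^^ Suc n) F u + real (Suc n) * (t\<^sup>2 * D\<^sup>2))"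
    by (simp add: step_def exp_add[symmetric] algebra_simps)
  finally show ?case .
qed simp

lemma Azuma_upper:
  assumes D: "\<And>s u a b. \<mu> (u @ [a]) > 0 \<Longrightarrow> \<mu> (u @ [b]) > 0 \<Longrightarrow>
      \<bar>(step ^^ s) F (u @ [a]) - (step ^^ s) F (u @ [b])\<bar> \<le> D"
    and "D > 0" "n > 0" "e \<ge> 0"
  shows "(\<Sum>x\<in>{x\<in>words n. F x - (step ^^ n) F [] \<ge> e}. \<mu> x) \<le> exp (- e\<^sup>2 / (4 * real n * D\<^sup>2))"
proof -
  \<comment> \<open>The minimizer of the Chernoff exponent
    \<open>n * t\<^sup>2 * D\<^sup>2 - t * e\<close>.\<close>
  define t where "t = e / (2 * real n * D\<^sup>2)"
  have "t \<ge> 0" using assms by (simp add: t_def)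
  let ?E = "(step ^^ n) F []"
  have "(\<Sum>x\<in>{x\<in>words n. F x - ?E \<ge> e}. \<mu> x) \<le>
      (\<Sum>x\<in>{x\<in>words n. F x - ?E \<ge> e}. \<mu> x * exp (t * (F x - ?E - e)))"
  proof (rule sum_mono)
    fix x assume "x \<in> {x\<in>words n. F x - ?E \<ge> e}"
    then have "1 \<le> exp (t * (F x - ?E - e))" using \<open>t \<ge> 0\<close> by simp
    then show "\<mu> x \<le> \<mu> x * exp (t * (F x - ?E - e))"
      using mult_left_mono[OF _ \<mu>_nonneg[of x]] by fastforce
  qed
  also have "\<dots> \<le> (\<Sum>x\<in>words n. \<mu> x * exp (t * (F x - ?E - e)))"
    by (rule sum_mono2) (auto simp: \<mu>_nonneg)
  also have "\<dots> = exp (- t * (?E + e)) * (\<Sum>x\<in>words n. \<mu> x * exp (t * F x))"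
    unfolding sum_distrib_left by (rule sum.cong) (simp_all add: exp_add[symmetric] algebra_simps)
  also have "(\<Sum>x\<in>words n. \<mu> x * exp (t * F x)) \<le> exp (t * ?E + real n * (t\<^sup>2 * D\<^sup>2))"
    unfolding expectation_eq_step by (rule step_exp_le[OF D]) (simp_all add: \<mu>_Nil)
  then have "exp (- t * (?E + e)) * (\<Sum>x\<in>words n. \<mu> x * exp (t * F x)) \<le>
      exp (- t * (?E + e)) * exp (t * ?E + real n * (t\<^sup>2 * D\<^sup>2))"
    by simp
  also have "\<dots> = exp (real n * (t\<^sup>2 * D\<^sup>2) - t * e)"
    by (simp add: exp_add[symmetric] algebra_simps)
  also have "real n * (t\<^sup>2 * D\<^sup>2) - t * e = - e\<^sup>2 / (4 * real n * D\<^sup>2)"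
    using assms by (simp add: t_def field_simps power2_eq_square)
  finally show ?thesis .
qed

lemma step_iterate_uminus: "(step ^^ s) (\<lambda>x. - F x) = (\<lambda>u. - (step ^^ s) F u)"
  by (induction s) (simp_all add: step_def sum_negf)

lemma Azuma:
  assumes D: "\<And>s u a b. \<mu> (u @ [a]) > 0 \<Longrightarrow> \<mu> (u @ [b]) > 0 \<Longrightarrow>
      \<bar>(step ^^ s) F (u @ [a]) - (step ^^ s) F (u @ [b])\<bar> \<le> D"
    and "D > 0" "n > 0" "e \<ge> 0"
  shows "(\<Sum>x\<in>{x\<in>words n. \<bar>F x - (step ^^ n) F []\<bar> \<ge> e}. \<mu> x) \<le> 2 * exp (- e\<^sup>2 / (4 * real n * D\<^sup>2))"
proof -
  let ?U = "{x\<in>words n. F x - (step ^^ n) F [] \<ge> e}"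
  let ?L = "{x\<in>words n. - F x - (step ^^ n) (\<lambda>x. - F x) [] \<ge> e}"
  have "(\<Sum>x\<in>?U. \<mu> x) \<le> exp (- e\<^sup>2 / (4 * real n * D\<^sup>2))"
    by (rule Azuma_upper[OF D]) (use assms in auto)
  moreover have "(\<Sum>x\<in>?L. \<mu> x) \<le> exp (- e\<^sup>2 / (4 * real n * D\<^sup>2))"
    by (rule Azuma_upper) (use assms D in \<open>auto simp: step_iterate_uminus abs_minus_commute\<close>)
  moreover have "(\<Sum>x\<in>{x\<in>words n. \<bar>F x - (step ^^ n) F []\<bar> \<ge> e}. \<mu> x) \<le> (\<Sum>x\<in>?U \<union> ?L. \<mu> x)"
    by (rule sum_mono2) (auto simp: \<mu>_nonneg step_iterate_uminus)
  moreover have "(\<Sum>x\<in>?U \<union> ?L. \<mu> x) \<le> (\<Sum>x\<in>?U. \<mu> x) + (\<Sum>x\<in>?L. \<mu> x)"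
    by (subst sum_Un) (auto simp: \<mu>_nonneg intro!: sum_nonneg)
  ultimately show ?thesis by linarith
qed

end

section \<open>Counting identities for blocks\<close>

lemma suffix_append_short: "length w \<le> length v \<Longrightarrow> suffix w (u @ v) \<longleftrightarrow> suffix w v"
  by (metis suffix_def suffix_appendI suffix_length_suffix)

lemma suffix_iff_drop: "suffix w xs \<longleftrightarrow> length w \<le> length xs \<and> drop (length xs - length w) xs = w"
  by (metis append_take_drop_id suffix_def suffix_length_le append_eq_conv_conj diff_diff_cancel
      length_drop same_suffix_suffix append_same_eq length_append diff_add_inverse2)

text \<open>An occurrence either lies inside \<open>xs\<close> or ends at the new letter, at a
  forced position. A count is thereby a sum over time of suffix indicators, the form in which
  martingale steps act on it.\<close>

lemma cnt_snoc: "cnt (xs @ [a]) w = cnt xs w + of_bool (suffix w (xs @ [a]))"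
proof -
  let ?l = "length w" and ?n = "length xs"
  let ?A = "{i. i + ?l \<le> ?n \<and> take ?l (drop i xs) = w}"
  let ?B = "{i. i + ?l = Suc ?n \<and> suffix w (xs @ [a])}"
  have "{i. i + ?l \<le> length (xs @ [a]) \<and> take ?l (drop i (xs @ [a])) = w} = ?A \<union> ?B"
  proof (rule set_eqI)
    fix i
    consider "i + ?l \<le> ?n" | "i + ?l = Suc ?n" | "i + ?l > Suc ?n" by linarith
    then show "i \<in> {i. i + ?l \<le> length (xs @ [a]) \<and> take ?l (drop i (xs @ [a])) = w} \<longleftrightarrow> i \<in> ?A \<union> ?B"
    proof cases
      case 2
      then have i: "i = length (xs @ [a]) - ?l" by simp
      have "take ?l (drop i (xs @ [a])) = drop i (xs @ [a])" using 2 by simp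
      then show ?thesis using 2 suffix_iff_drop[of w "xs @ [a]"] i by auto
    qed auto
  qed
  then have "cnt (xs @ [a]) w = card (?A \<union> ?B)" by (simp add: cnt_def)
  also have "\<dots> = card ?A + card ?B"
    by (rule card_Un_disjoint) (auto intro: finite_subset[of _ "{..Suc ?n}"])
  also have "card ?B = of_bool (suffix w (xs @ [a]))"
  proof (cases "suffix w (xs @ [a])")
    case True
    then have "?B = {Suc ?n - ?l}" using suffix_length_le[OF True] by auto
    then have "card ?B = 1" by (simp only: card.insert) simp
    then show ?thesis using True by (simp only: of_bool_eq)
  next
    case False
    then have "?B = {}" by blast
    then show ?thesis using False by (simp only: card.empty of_bool_eq)
  qed
  finally show ?thesis by (simp add: cnt_def)
qed

lemma cnt_Nil: "cnt [] w = of_bool (w = [])"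
  by (auto simp: cnt_def)

lemma suffix_snoc_iff: "suffix (u @ [a]) (ys @ [b]) \<longleftrightarrow> a = b \<and> suffix u ys"
  by (auto simp: suffix_def)

text \<open>Every occurrence in \<open>ys\<close> is followed by exactly one letter once
  \<open>b\<close> is appended. This also covers \<open>u = []\<close>, whose count in
  \<open>ys\<close> is \<open>length ys + 1\<close>, in accordance with the convention that the
  empty context has count \<open>n\<close>.\<close>

lemma sum_cnt_snoc: "(\<Sum>a\<in>UNIV. cnt (ys @ [b]) (u @ [a :: 'a::finite])) = cnt ys u"
proof (induction ys arbitrary: b rule: rev_induct)
  case Nil
  have "cnt ([] @ [b]) (u @ [a]) = of_bool (a = b \<and> u = [])" for a
    by (simp only: cnt_snoc cnt_Nil suffix_snoc_iff) auto
  then show ?case by (cases "u = []") (simp_all add: cnt_Nil)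
next
  case (snoc c ys)
  have "(\<Sum>a\<in>UNIV. cnt ((ys @ [c]) @ [b]) (u @ [a])) =
      (\<Sum>a\<in>UNIV. cnt (ys @ [c]) (u @ [a]) + of_bool (suffix (u @ [a]) ((ys @ [c]) @ [b])))"
    by (simp only: cnt_snoc)
  also have "\<dots> = cnt ys u + (\<Sum>a\<in>UNIV. of_bool (a = b \<and> suffix u (ys @ [c])))"
    by (simp only: sum.distrib snoc suffix_snoc_iff)
  also have "(\<Sum>a\<in>UNIV. of_bool (a = b \<and> suffix u (ys @ [c]))) = (of_bool (suffix u (ys @ [c])) :: nat)"
    by (cases "suffix u (ys @ [c])") simp_all
  finally show ?case by (simp add: cnt_snoc)
qed

lemma cnt_butlast: "xs \<noteq> [] \<Longrightarrow> cnt (butlast xs) u = (\<Sum>a\<in>UNIV. cnt xs (u @ [a :: 'a::finite]))"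
  using sum_cnt_snoc[of "butlast xs" "last xs" u] by simp

lemma sum_of_bool_suffix_le:
  "(\<Sum>v\<in>words j. of_bool (suffix (v @ u) xs)) \<le> (of_bool (suffix u xs) :: nat)"
proof (cases "\<exists>v\<in>words j. suffix (v @ u) xs")
  case True
  then obtain v where v: "v \<in> words j" "suffix (v @ u) xs" by auto
  have uniq: "v' = v" if "v' \<in> words j" "suffix (v' @ u) xs" for v'
  proof -
    have "length (v' @ u) = length (v @ u)" using that v by (simp add: words_def)
    then have "v' @ u = v @ u" using that v by (simp add: suffix_iff_drop)
    then show ?thesis by simp
  qed
  have "(\<Sum>v\<in>words j. of_bool (suffix (v @ u) xs)) = (\<Sum>v'\<in>words j. of_bool (v' = v) :: nat)"
  proof (rule sum.cong)
    fix v' :: "'a list" assume "v' \<in> words j"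
    then show "of_bool (suffix (v' @ u) xs) = (of_bool (v' = v) :: nat)"
      using uniq[of v'] v(2) by (cases "v' = v") auto
  qed simp
  also have "\<dots> = 1" using v by simp
  finally show ?thesis using v suffix_appendD[of v u xs] by simp
next
  case False
  then have "(\<Sum>v\<in>words j. of_bool (suffix (v @ u) xs)) = (0::nat)"
    by (intro sum.neutral) auto
  then show ?thesis by simp
qed

text \<open>Only an inequality: occurrences of \<open>u\<close> that start within the first
  \<open>j\<close> letters have no left extension of length \<open>j\<close>.\<close>

lemma sum_cnt_prefix_le: "u \<noteq> [] \<Longrightarrow> (\<Sum>v\<in>words j. cnt xs (v @ u)) \<le> cnt xs u"
proof (induction xs rule: rev_induct)
  case (snoc a xs)
  then show ?case
    using sum_of_bool_suffix_le[where j = j and u = u and xs = "xs @ [a]"]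
    by (simp add: cnt_snoc sum.distrib del: sum_of_bool_eq)
qed (simp add: cnt_Nil)

lemma sum_cnt_le_length: "l > 0 \<Longrightarrow> (\<Sum>w\<in>words l. cnt xs w) \<le> length xs"
proof (induction xs rule: rev_induct)
  case (snoc a xs)
  then show ?case
    using sum_of_bool_suffix_le[where j = l and u = "[]" and xs = "xs @ [a]"]
    by (simp add: cnt_snoc sum.distrib del: sum_of_bool_eq)
next
  case Nil
  then show ?case by (auto simp: cnt_Nil intro!: sum.neutral dest: length_words simp del: sum_of_bool_eq)
qed

section \<open>Mixing through a transient house-of-cards chain\<close>

lemma prod_one_minus_ge:
  fixes f :: "'i \<Rightarrow> real"
  assumes "finite A" "\<And>i. i \<in> A \<Longrightarrow> 0 \<le> f i" "\<And>i. i \<in> A \<Longrightarrow> f i \<le> 1"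
  shows "1 - sum f A \<le> (\<Prod>i\<in>A. 1 - f i)"
  using assms
proof (induction A rule: finite_induct)
  case (insert x A)
  have p: "(\<Prod>i\<in>A. 1 - f i) \<le> 1"
    using insert by (intro prod_le_1) auto
  have "f x * (\<Prod>i\<in>A. 1 - f i) \<le> f x"
    using p insert.prems(1)[of x] by (simp add: mult_left_le)
  then show ?case using insert by (simp add: algebra_simps)
qed simp

text \<open>This is transience: with probability bounded below, the chain started at 0 never falls
  back. Beyond some \<open>N\<close> the tail sums are below 1/2, so the remaining product is at
  least 1/2; the finitely many factors before \<open>N\<close> are positive because each
  \<open>\<eta> i\<close> is below 1.\<close>

lemma summable_prod_one_minus_bounded_below:
  fixes \<eta> :: "nat \<Rightarrow> real"
  assumes "\<And>i. 0 \<le> \<eta> i" "\<And>i. \<eta> i < 1" "summable \<eta>"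
  obtains \<kappa> where "\<kappa> > 0" "\<And>j. \<kappa> \<le> (\<Prod>i<j. 1 - \<eta> i)"
proof -
  obtain N where N: "\<And>m n. m \<ge> N \<Longrightarrow> norm (sum \<eta> {m..<n}) < 1/2"
    using assms(3) unfolding summable_Cauchy by (metis half_gt_zero zero_less_one)
  define \<kappa> where "\<kappa> = (\<Prod>i<N. 1 - \<eta> i) * (1/2)"
  have pos: "(\<Prod>i\<in>I. 1 - \<eta> i) > 0" for I :: "nat set"
    by (rule prod_pos) (simp add: assms)
  have le1: "(\<Prod>i\<in>I. 1 - \<eta> i) \<le> 1" for I :: "nat set"
    by (rule prod_le_1) (simp add: assms less_imp_le)
  have "\<kappa> \<le> (\<Prod>i<j. 1 - \<eta> i)" for j
  proof (cases "j \<le> N")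
    case True
    have "(\<Prod>i<N. 1 - \<eta> i) = (\<Prod>i<j. 1 - \<eta> i) * (\<Prod>i\<in>{j..<N}. 1 - \<eta> i)"
      using True by (simp add: lessThan_atLeast0 prod.atLeastLessThan_concat)
    also have "\<dots> \<le> (\<Prod>i<j. 1 - \<eta> i)"
      using pos[of "{..<j}"] le1[of "{j..<N}"] by (simp add: mult_left_le)
    finally show ?thesis using pos[of "{..<N}"] by (simp add: \<kappa>_def)
  next
    case False
    have "(\<Prod>i<N. 1 - \<eta> i) * (1/2) \<le> (\<Prod>i<N. 1 - \<eta> i) * (\<Prod>i\<in>{N..<j}. 1 - \<eta> i)"
    proof (rule mult_left_mono)
      have "1 - sum \<eta> {N..<j} \<le> (\<Prod>i\<in>{N..<j}. 1 - \<eta> i)"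
        by (rule prod_one_minus_ge) (auto simp: assms less_imp_le)
      then show "1 / 2 \<le> (\<Prod>i\<in>{N..<j}. 1 - \<eta> i)" using N[of N j] by simp
    qed (use pos[of "{..<N}"] in simp)
    also have "\<dots> = (\<Prod>i<j. 1 - \<eta> i)"
      using False by (simp add: lessThan_atLeast0 prod.atLeastLessThan_concat)
    finally show ?thesis by (simp add: \<kappa>_def)
  qed
  moreover have "\<kappa> > 0" using pos[of "{..<N}"] by (simp add: \<kappa>_def)
  ultimately show ?thesis using that by blast
qed

text \<open>\<open>\<eta> j\<close> bounds the total variation distance between the next-letter laws
  of two pasts that share their last \<open>j\<close> letters; \<open>overlap\<close> states this
  through the common mass.\<close>

locale mixing_block_measure = block_measure \<mu> for \<mu> :: "'a::finite list \<Rightarrow> real" +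
  fixes \<eta> :: "nat \<Rightarrow> real"
  assumes \<eta>_nonneg: "0 \<le> \<eta> j" and \<eta>_less_1: "\<eta> j < 1"
    and \<eta>_antimono: "\<eta> (Suc j) \<le> \<eta> j" and \<eta>_summable: "summable \<eta>"
    and overlap: "\<mu> (u @ w) > 0 \<Longrightarrow> \<mu> (v @ w) > 0 \<Longrightarrow>
      1 - \<eta> (length w) \<le> (\<Sum>a\<in>UNIV. min (kernel (u @ w) a) (kernel (v @ w) a))"
begin

text \<open>Expectation after \<open>s\<close> steps from \<open>j\<close> of the indicator of \<open>{..<l}\<close> for the house-of-cards chain,
  which moves from \<open>j\<close> to \<open>0\<close> with probability \<open>\<eta> j\<close> and to \<open>j + 1\<close> otherwise. It dominates the
  influence of the past beyond the last \<open>j\<close> letters.\<close>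

fun osc :: "nat \<Rightarrow> nat \<Rightarrow> nat \<Rightarrow> real" where
  "osc l 0 j = of_bool (j < l)"
| "osc l (Suc s) j = (1 - \<eta> j) * osc l s (Suc j) + \<eta> j * osc l s 0"

lemma osc_nonneg: "0 \<le> osc l s j"
  by (induction s arbitrary: j) (auto simp: \<eta>_nonneg \<eta>_less_1 less_imp_le)

text \<open>Longer agreement means less influence, which supplies the hypothesis
  \<open>b \<le> B\<close> of the coupling lemma. Antimonotonicity of \<open>\<eta>\<close> enters
  because a larger fall-back probability moves weight to the largest value
  \<open>osc l s 0\<close>.\<close>

lemma osc_le_osc_0: "osc l s (Suc j) \<le> osc l s j \<and> osc l s j \<le> osc l s 0"
proof (induction s arbitrary: j)
  case (Suc s)
  have dec: "osc l (Suc s) (Suc j) \<le> osc l (Suc s) j" for j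
  proof -
    let ?x = "osc l s 0" and ?y = "osc l s (Suc j)" and ?z = "osc l s (Suc (Suc j))"
    have "osc l (Suc s) (Suc j) = (1 - \<eta> (Suc j)) * ?z + \<eta> (Suc j) * ?x" by simp
    also have "\<dots> \<le> (1 - \<eta> (Suc j)) * ?y + \<eta> (Suc j) * ?x"
      using Suc[of "Suc j"] \<eta>_less_1[of "Suc j"] by (simp add: mult_left_mono)
    also have "\<dots> = ?y + \<eta> (Suc j) * (?x - ?y)" by (simp add: algebra_simps)
    also have "\<dots> \<le> ?y + \<eta> j * (?x - ?y)"
      using Suc[of "Suc j"] \<eta>_antimono[of j] by (simp add: mult_right_mono)
    also have "\<dots> = osc l (Suc s) j" by (simp add: algebra_simps)
    finally show ?thesis .
  qed
  then have "osc l (Suc s) j \<le> osc l (Suc s) 0" for j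
    by (induction j) (auto intro: order_trans simp del: osc.simps)
  then show ?case using dec by blast
qed auto

text \<open>The next letters after the two pasts are coupled maximally. If they coincide, the common
  suffix grows by one; otherwise all agreement is treated as lost. With no steps left, a common
  suffix at least as long as \<open>w0\<close> decides the indicator by itself, and a shorter one
  gives the trivial bound 1.\<close>

lemma step_indicator_osc:
  fixes u v w w0 :: "'a list"
  assumes "\<mu> (u @ w) > 0" "\<mu> (v @ w) > 0"
  defines "g \<equiv> \<lambda>x. of_bool (suffix w0 x) :: real"
  shows "\<bar>(step ^^ s) g (u @ w) - (step ^^ s) g (v @ w)\<bar> \<le> osc (length w0) s (length w)"
  using assms(1,2)
proof (induction s arbitrary: u v w)
  case 0
  then show ?case
    by (cases "length w < length w0") (auto simp: g_def suffix_append_short)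
next
  case (Suc s)
  let ?f = "(step ^^ s) g" and ?q = "kernel (u @ w)" and ?r = "kernel (v @ w)"
  have "\<bar>(\<Sum>a\<in>UNIV. ?q a * ?f (u @ w @ [a])) - (\<Sum>a\<in>UNIV. ?r a * ?f (v @ w @ [a]))\<bar>
     \<le> (1 - \<eta> (length w)) * osc (length w0) s (Suc (length w)) + \<eta> (length w) * osc (length w0) s 0"
  proof (rule expectation_diff_le_coupling)
    show "1 - \<eta> (length w) \<le> (\<Sum>a\<in>UNIV. min (?q a) (?r a))"
      by (rule overlap) fact+
  next
    fix a assume "?q a > 0" "?r a > 0"
    then show "\<bar>?f (u @ w @ [a]) - ?f (v @ w @ [a])\<bar> \<le> osc (length w0) s (Suc (length w))"
      using Suc.IH[of u "w @ [a]" v] kernel_pos[of "u @ w" a] kernel_pos[of "v @ w" a] by simp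
  next
    fix a a' assume "?q a > 0" "?r a' > 0"
    then show "\<bar>?f (u @ w @ [a]) - ?f (v @ w @ [a'])\<bar> \<le> osc (length w0) s 0"
      \<comment> \<open>The new letters may differ, so the common suffix is restarted as the empty
        word.\<close>
      using Suc.IH[of "u @ w @ [a]" "[]" "v @ w @ [a']"]
        kernel_pos[of "u @ w" a] kernel_pos[of "v @ w" a'] by simp
  qed (use Suc.prems osc_le_osc_0 in \<open>auto simp: kernel_nonneg kernel_sum osc_nonneg\<close>)
  then show ?case by (simp add: step_def[of "(step ^^ s) g"])
qed

text \<open>The weights \<open>\<Prod>i<j. 1 - \<eta> i\<close> form a potential that drops by at least \<open>\<kappa> * osc l s 0\<close> per step.\<close>

lemma osc_potential:
  fixes \<kappa> :: real
  defines "c \<equiv> \<lambda>j. \<Prod>i<j. 1 - \<eta> i"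
  assumes \<kappa>: "\<And>j. \<kappa> \<le> c j"
  shows "(\<Sum>j<J. c j * osc l T j) + \<kappa> * (\<Sum>s<T. osc l s 0) \<le> (\<Sum>j<J+T. c j * osc l 0 j)"
proof (induction T arbitrary: J)
  case (Suc T)
  have c_Suc: "c (Suc j) = c j * (1 - \<eta> j)" for j by (simp add: c_def)
  \<comment> \<open>\<open>c (Suc j)\<close> is the mass that moves on and
    \<open>c j - c (Suc j)\<close> the mass that falls back. The former shifts the range by one,
    which is why \<open>J\<close> is arbitrary in the induction.\<close>
  have "c j * osc l (Suc T) j = c (Suc j) * osc l T (Suc j) + (c j - c (Suc j)) * osc l T 0" for j
    by (simp add: c_Suc algebra_simps)
  then have "(\<Sum>j<J. c j * osc l (Suc T) j) =
      (\<Sum>j<J. c (Suc j) * osc l T (Suc j)) + (\<Sum>j<J. c j - c (Suc j)) * osc l T 0"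
    by (simp only: sum.distrib sum_distrib_right)
  also have "(\<Sum>j<J. c j - c (Suc j)) = 1 - c J"
    by (simp add: sum_lessThan_telescope') (simp add: c_def)
  also have "(\<Sum>j<J. c (Suc j) * osc l T (Suc j)) = (\<Sum>j<Suc J. c j * osc l T j) - osc l T 0"
    by (subst sum.lessThan_Suc_shift) (simp add: c_def)
  finally have "(\<Sum>j<J. c j * osc l (Suc T) j) = (\<Sum>j<Suc J. c j * osc l T j) - c J * osc l T 0"
    by (simp add: algebra_simps)
  moreover have "\<kappa> * osc l T 0 \<le> c J * osc l T 0"
    by (rule mult_right_mono) (simp_all add: \<kappa> osc_nonneg)
  ultimately show ?case using Suc[of "Suc J"] by (simp add: distrib_left)
qed simp

text \<open>The left side is the expected number of visits to \<open>{..<l}\<close> of the chain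
  started at 0. The potential inequality with \<open>J = 0\<close> bounds it by
  \<open>l / \<kappa>\<close> uniformly in the horizon.\<close>

lemma osc_sum_bounded:
  obtains \<kappa> where "\<kappa> > 0" "\<And>l T. (\<Sum>s<T. osc l s 0) \<le> \<kappa> * real l"
proof -
  obtain \<kappa> where \<kappa>: "\<kappa> > 0" "\<And>j. \<kappa> \<le> (\<Prod>i<j. 1 - \<eta> i)"
    using summable_prod_one_minus_bounded_below[of \<eta>] \<eta>_nonneg \<eta>_less_1 \<eta>_summable by metis
  have "(\<Sum>s<T. osc l s 0) \<le> 1 / \<kappa> * real l" for l T
  proof -
    have "\<kappa> * (\<Sum>s<T. osc l s 0) \<le> (\<Sum>j<T. (\<Prod>i<j. 1 - \<eta> i) * osc l 0 j)"
      using osc_potential[where \<kappa> = \<kappa> and J = 0 and l = l and T = T] \<kappa>(2) by simp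
    also have "\<dots> \<le> (\<Sum>j<T. of_bool (j < l))"
      by (intro sum_mono) (auto intro!: prod_le_1 simp: \<eta>_nonneg \<eta>_less_1 less_imp_le)
    also have "\<dots> = real (card ({..<T} \<inter> {j. j < l}))" by simp
    also have "card ({..<T} \<inter> {j. j < l}) \<le> card {..<l}" by (rule card_mono) auto
    finally show ?thesis using \<kappa>(1) by (simp add: field_simps)
  qed
  then show ?thesis using that[of "1 / \<kappa>"] \<kappa>(1) by simp
qed

lemma step_cnt:
  fixes u w :: "'a list"
  assumes "\<mu> u > 0"
  defines "g \<equiv> \<lambda>x. of_bool (suffix w x) :: real"
  shows "(step ^^ s) (\<lambda>x. real (cnt x w)) u = real (cnt u w) + (\<Sum>i<s. (step ^^ Suc i) g u)"
  using assms(1)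
proof (induction s arbitrary: u)
  case (Suc s)
  have "(step ^^ Suc s) (\<lambda>x. real (cnt x w)) u = step ((step ^^ s) (\<lambda>x. real (cnt x w))) u" by simp
  also have "\<dots> = step (\<lambda>x. real (cnt x w) + (\<Sum>i<s. (step ^^ Suc i) g x)) u"
    by (rule step_cong) (use Suc.IH in simp)
  also have "\<dots> = step (\<lambda>x. real (cnt x w)) u + (\<Sum>i<s. step ((step ^^ Suc i) g) u)"
    by (simp only: step_def distrib_left sum.distrib sum_distrib_left sum.swap[of _ UNIV])
  also have "step (\<lambda>x. real (cnt x w)) u = real (cnt u w) * (\<Sum>a\<in>UNIV. kernel u a) + step g u"
    by (simp add: step_def cnt_snoc g_def algebra_simps sum.distrib sum_distrib_left)
  also have "\<dots> = real (cnt u w) + step g u" using Suc.prems by (simp add: kernel_sum)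
  finally show ?case
    by (simp add: sum.lessThan_Suc_shift del: sum.lessThan_Suc)
qed simp

text \<open>By stationarity the suffix indicator has mean \<open>\<mu> w\<close> at each time from
  \<open>length w\<close> on and vanishes before. The bias comes only from the fewer than
  \<open>length w\<close> missing times.\<close>

lemma step_cnt_Nil:
  assumes "w \<noteq> []"
  shows "\<bar>(step ^^ n) (\<lambda>x. real (cnt x w)) [] - real n * \<mu> w\<bar> \<le> real (length w)"
proof -
  let ?g = "\<lambda>x. of_bool (suffix w x) :: real"
  have g: "(step ^^ s) ?g [] = (if length w \<le> s then \<mu> w else 0)" for s
  proof (cases "length w \<le> s")
    case True
    have "(step ^^ s) ?g [] = (\<Sum>x\<in>words (s - length w + length w). \<mu> x * ?g x)"
      using True by (simp add: expectation_eq_step[symmetric])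
    also have "\<dots> = (\<Sum>v\<in>words (s - length w). \<Sum>x\<in>words (length w). \<mu> (v @ x) * of_bool (x = w))"
      unfolding sum_words_append
      by (intro sum.cong) (auto simp: suffix_append_short length_words suffix_iff_drop)
    also have "\<dots> = (\<Sum>v\<in>words (s - length w). \<mu> (v @ w))"
      by (simp add: of_bool_def if_distrib sum.delta' cong: if_cong) (simp add: words_def)
    also have "\<dots> = \<mu> w" by (rule sum_\<mu>_prefix)
    finally show ?thesis using True by simp
  next
    case False
    then show ?thesis unfolding expectation_eq_step[symmetric]
      by (auto intro!: sum.neutral dest: suffix_length_le length_words)
  qed
  have "(step ^^ n) (\<lambda>x. real (cnt x w)) [] = (\<Sum>i<n. if length w \<le> Suc i then \<mu> w else 0)"
    using assms by (subst step_cnt) (simp_all only: \<mu>_Nil cnt_Nil g, simp_all)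
  then have "(step ^^ n) (\<lambda>x. real (cnt x w)) [] - real n * \<mu> w =
      (\<Sum>i<n. (if length w \<le> Suc i then \<mu> w else 0) - \<mu> w)"
    by (simp add: sum_subtractf)
  then have "\<bar>(step ^^ n) (\<lambda>x. real (cnt x w)) [] - real n * \<mu> w\<bar> \<le>
      (\<Sum>i<n. \<bar>(if length w \<le> Suc i then \<mu> w else 0) - \<mu> w\<bar>)"
    by (simp only: sum_abs)
  also have "\<dots> \<le> (\<Sum>i<n. of_bool (i < length w))"
  proof (rule sum_mono)
    fix i
    have "\<mu> w \<le> 1" using \<mu>_suffix_le[of w "[]"] by (simp add: \<mu>_Nil)
    then show "\<bar>(if length w \<le> Suc i then \<mu> w else 0) - \<mu> w\<bar> \<le> of_bool (i < length w)"
      using \<mu>_nonneg[of w] by auto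
  qed
  also have "\<dots> = real (card ({..<n} \<inter> {i. i < length w}))" by simp
  also have "card ({..<n} \<inter> {i. i < length w}) \<le> card {..<length w}" by (rule card_mono) auto
  finally show ?thesis by simp
qed

lemma cnt_concentration:
  obtains K where "K > 0"
    "\<And>w n e. w \<noteq> [] \<Longrightarrow> n > 0 \<Longrightarrow> e \<ge> 0 \<Longrightarrow>
      (\<Sum>x\<in>{x\<in>words n. \<bar>real (cnt x w) - real n * \<mu> w\<bar> \<ge> e + real (length w)}. \<mu> x)
        \<le> 2 * exp (- e\<^sup>2 / (real n * (K * real (length w))\<^sup>2))"
proof -
  obtain \<kappa> where \<kappa>: "\<kappa> > 0" "\<And>l T. (\<Sum>s<T. osc l s 0) \<le> \<kappa> * real l"
    using osc_sum_bounded by blast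
  have "(\<Sum>x\<in>{x\<in>words n. \<bar>real (cnt x w) - real n * \<mu> w\<bar> \<ge> e + real (length w)}. \<mu> x)
        \<le> 2 * exp (- e\<^sup>2 / (real n * (2 * \<kappa> * real (length w))\<^sup>2))"
    if "w \<noteq> []" "n > 0" "e \<ge> 0" for w n e
  proof -
    let ?F = "\<lambda>x. real (cnt x w)" and ?g = "\<lambda>x. of_bool (suffix w x) :: real"
    have D: "\<bar>(step ^^ s) ?F (u @ [a]) - (step ^^ s) ?F (u @ [b])\<bar> \<le> \<kappa> * real (length w)"
      if ab: "\<mu> (u @ [a]) > 0" "\<mu> (u @ [b]) > 0" for s u a b
    proof -
      \<comment> \<open>Occurrences inside \<open>u\<close> cancel. The term \<open>i = 0\<close>
        accounts for the occurrence that may end at the differing letter, hence \<open>Suc s\<close>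
        terms.\<close>
      have "(step ^^ s) ?F (u @ [a]) - (step ^^ s) ?F (u @ [b]) =
          (\<Sum>i<Suc s. (step ^^ i) ?g (u @ [a]) - (step ^^ i) ?g (u @ [b]))"
        unfolding step_cnt[OF ab(1)] step_cnt[OF ab(2)] sum.lessThan_Suc_shift sum_subtractf
        by (simp add: cnt_snoc)
      also have "\<bar>\<dots>\<bar> \<le> (\<Sum>i<Suc s. osc (length w) i 0)"
        using step_indicator_osc[of "u @ [a]" "[]" "u @ [b]"] ab
        by (intro order_trans[OF sum_abs] sum_mono) simp
      also have "\<dots> \<le> \<kappa> * real (length w)" by (rule \<kappa>)
      finally show ?thesis .
    qed
    have "(\<Sum>x\<in>{x\<in>words n. \<bar>?F x - real n * \<mu> w\<bar> \<ge> e + real (length w)}. \<mu> x) \<le>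
        (\<Sum>x\<in>{x\<in>words n. \<bar>?F x - (step ^^ n) ?F []\<bar> \<ge> e}. \<mu> x)"
      using step_cnt_Nil[OF \<open>w \<noteq> []\<close>, of n] by (intro sum_mono2) (auto simp: \<mu>_nonneg)
    also have "\<dots> \<le> 2 * exp (- e\<^sup>2 / (4 * real n * (\<kappa> * real (length w))\<^sup>2))"
      by (rule Azuma[OF D]) (use that \<kappa> in auto)
    finally show ?thesis by (simp add: power_mult_distrib mult_ac)
  qed
  then show ?thesis using that[of "2 * \<kappa>"] \<kappa>(1) by simp
qed

end

section \<open>Maximum likelihoods of different orders\<close>

text \<open>A block of count zero contributes \<open>x ^ 0 = 1\<close> even if its context never
  occurs, so the likelihood is positive; correspondingly its summand has the factor 0 in front of
  the logarithm.\<close>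

lemma MLk_pos: "xs \<noteq> [] \<Longrightarrow> MLk k xs > 0"
  and ln_MLk: "xs \<noteq> [] \<Longrightarrow> ln (MLk k xs) =
    (\<Sum>u\<in>words k. \<Sum>a\<in>UNIV. real (cnt xs (u @ [a])) *
      ln (real (cnt xs (u @ [a])) / real (cnt (butlast xs) u)))"
proof -
  assume xs: "xs \<noteq> []"
  let ?F = "\<lambda>w. (real (cnt xs w) / real (cnt (butlast xs) (butlast w))) ^ cnt xs w"
  have le: "cnt xs w \<le> cnt (butlast xs) (butlast w)" if "w \<in> words (k + 1)" for w
  proof -
    have w: "butlast w @ [last w] = w" using that by (cases w) (auto simp: words_def)
    have "cnt xs (butlast w @ [last w]) \<le> (\<Sum>a\<in>UNIV. cnt xs (butlast w @ [a]))"
      by (rule member_le_sum) auto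
    then show ?thesis using xs by (simp add: cnt_butlast w)
  qed
  have pos: "?F w > 0" if "w \<in> words (k + 1)" for w
    using le[OF that] by (cases "cnt xs w = 0") (auto intro!: divide_pos_pos)
  have MLk_eq: "MLk k xs = prod ?F (words (k + 1))"
    by (simp add: MLk_def words_def)
  show "MLk k xs > 0" unfolding MLk_eq using pos by (rule prod_pos)
  have "ln (MLk k xs) = (\<Sum>w\<in>words (Suc k). ln (?F w))"
    unfolding MLk_eq Suc_eq_plus1 by (rule ln_prod[OF finite_words less_imp_neq[OF pos, symmetric]])
  also have "\<dots> = (\<Sum>u\<in>words k. \<Sum>a\<in>UNIV. ln (?F (u @ [a])))"
    by (rule sum_words_Suc_snoc)
  also have "\<dots> = (\<Sum>u\<in>words k. \<Sum>a\<in>UNIV. real (cnt xs (u @ [a])) *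
      ln (real (cnt xs (u @ [a])) / real (cnt (butlast xs) u)))"
  proof (intro sum.cong refl)
    fix u :: "'a list" and a assume "u \<in> words k"
    then have w: "u @ [a] \<in> words (k + 1)" by (simp add: words_def)
    show "ln (?F (u @ [a])) = real (cnt xs (u @ [a])) *
      ln (real (cnt xs (u @ [a])) / real (cnt (butlast xs) u))"
      using le[OF w] by (cases "cnt xs (u @ [a]) = 0") (auto simp: ln_realpow)
  qed
  finally show "ln (MLk k xs) = (\<Sum>u\<in>words k. \<Sum>a\<in>UNIV. real (cnt xs (u @ [a])) *
      ln (real (cnt xs (u @ [a])) / real (cnt (butlast xs) u)))" .
qed

text \<open>Going through the squared Hellinger distance avoids any bound on the logarithms.\<close>

lemma divergence_ge_l1_distance:
  fixes P Q :: "'i \<Rightarrow> real"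
  assumes "finite I" and P: "\<And>i. i \<in> I \<Longrightarrow> P i \<ge> 0" and Q: "\<And>i. i \<in> I \<Longrightarrow> Q i \<ge> 0"
    and PQ: "\<And>i. i \<in> I \<Longrightarrow> P i > 0 \<Longrightarrow> Q i > 0"
    and "sum Q I \<le> sum P I" "sum P I \<le> T" "T > 0"
  shows "(\<Sum>i\<in>I. \<bar>P i - Q i\<bar>)\<^sup>2 / (4 * T) \<le> (\<Sum>i\<in>I. P i * ln (P i / Q i))"
proof -
  have "P i * ln (P i / Q i) \<ge> 2 * P i - 2 * (sqrt (P i) * sqrt (Q i))" if i: "i \<in> I" for i
  proof (cases "P i > 0")
    case True
    \<comment> \<open>Applying \<open>ln r \<le> r - 1\<close> to the square root rather than to the
      ratio itself is what produces the Hellinger term.\<close>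
    define r where "r = sqrt (Q i / P i)"
    have r: "r > 0" using True PQ[OF i True] by (simp add: r_def)
    have "ln (P i / Q i) = - ln (r\<^sup>2)"
      using True PQ[OF i True] by (simp add: r_def ln_div)
    also have "\<dots> = - 2 * ln r" using r by (simp add: ln_realpow)
    finally have "ln (P i / Q i) \<ge> 2 - 2 * r" using ln_le_minus_one[OF r] by simp
    then have "P i * ln (P i / Q i) \<ge> P i * (2 - 2 * r)" using True by simp
    moreover have "P i * r = sqrt (P i) * sqrt (Q i)"
      using True by (simp add: r_def real_sqrt_divide field_simps)
    ultimately show ?thesis by (simp add: algebra_simps)
  next
    case False
    then have "P i = 0" using P[OF i] by simp
    then show ?thesis by simp
  qed
  then have "(\<Sum>i\<in>I. P i * ln (P i / Q i)) \<ge> (\<Sum>i\<in>I. 2 * P i - 2 * (sqrt (P i) * sqrt (Q i)))"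
    by (rule sum_mono)
  moreover have "(\<Sum>i\<in>I. 2 * P i - 2 * (sqrt (P i) * sqrt (Q i))) \<ge>
      (\<Sum>i\<in>I. (sqrt (P i) - sqrt (Q i))\<^sup>2)"
  proof -
    have "(\<Sum>i\<in>I. (sqrt (P i) - sqrt (Q i))\<^sup>2) = (\<Sum>i\<in>I. P i + Q i - 2 * (sqrt (P i) * sqrt (Q i)))"
      by (rule sum.cong) (simp_all add: power2_diff P Q)
    \<comment> \<open>Here \<open>sum Q I \<le> sum P I\<close> replaces one copy of
      \<open>Q\<close> by \<open>P\<close>.\<close>
    also have "\<dots> \<le> (\<Sum>i\<in>I. 2 * P i - 2 * (sqrt (P i) * sqrt (Q i)))"
      using assms(5) by (simp add: sum.distrib sum_subtractf sum_distrib_left[symmetric])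
    finally show ?thesis .
  qed
  moreover have "(\<Sum>i\<in>I. \<bar>P i - Q i\<bar>)\<^sup>2 \<le> (\<Sum>i\<in>I. (sqrt (P i) - sqrt (Q i))\<^sup>2) * (4 * T)"
  proof -
    have "\<bar>P i - Q i\<bar> = \<bar>sqrt (P i) - sqrt (Q i)\<bar> * (sqrt (P i) + sqrt (Q i))" if i: "i \<in> I" for i
    proof -
      have "P i - Q i = (sqrt (P i) - sqrt (Q i)) * (sqrt (P i) + sqrt (Q i))"
        using P[OF i] Q[OF i] by (simp add: algebra_simps)
      moreover have "sqrt (P i) + sqrt (Q i) \<ge> 0"
        using P[OF i] Q[OF i] by simp
      ultimately show ?thesis by (simp add: abs_mult)
    qed
    then have "(\<Sum>i\<in>I. \<bar>P i - Q i\<bar>)\<^sup>2 = (\<Sum>i\<in>I. \<bar>sqrt (P i) - sqrt (Q i)\<bar> * (sqrt (P i) + sqrt (Q i)))\<^sup>2"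
      by simp
    also have "\<dots> \<le> (\<Sum>i\<in>I. \<bar>sqrt (P i) - sqrt (Q i)\<bar>\<^sup>2) * (\<Sum>i\<in>I. (sqrt (P i) + sqrt (Q i))\<^sup>2)"
      by (rule Cauchy_Schwarz_ineq_sum)
    also have "\<dots> \<le> (\<Sum>i\<in>I. (sqrt (P i) - sqrt (Q i))\<^sup>2) * (4 * T)"
    proof -
      have "(sqrt (P i) + sqrt (Q i))\<^sup>2 \<le> 2 * P i + 2 * Q i" if i: "i \<in> I" for i
      proof -
        have "(sqrt (P i) + sqrt (Q i))\<^sup>2 + (sqrt (P i) - sqrt (Q i))\<^sup>2 = 2 * P i + 2 * Q i"
          using P[OF i] Q[OF i] by (simp add: power2_sum power2_diff)
        then show ?thesis using zero_le_power2[of "sqrt (P i) - sqrt (Q i)"] by linarith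
      qed
      then have "(\<Sum>i\<in>I. (sqrt (P i) + sqrt (Q i))\<^sup>2) \<le> (\<Sum>i\<in>I. 2 * P i + 2 * Q i)"
        by (rule sum_mono)
      also have "\<dots> \<le> 4 * T" using assms(5,6) by (simp add: sum.distrib sum_distrib_left[symmetric])
      finally show ?thesis by (auto intro!: mult_left_mono sum_nonneg)
    qed
    finally show ?thesis .
  qed
  then have "(\<Sum>i\<in>I. \<bar>P i - Q i\<bar>)\<^sup>2 / (4 * T) \<le> (\<Sum>i\<in>I. (sqrt (P i) - sqrt (Q i))\<^sup>2)"
    using \<open>T > 0\<close> by (simp add: field_simps)
  ultimately show ?thesis by linarith
qed

text \<open>Expanding by the following letter makes the word nonempty, so that
  \<open>sum_cnt_prefix_le\<close> applies for every \<open>u\<close>, including the empty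
  one.\<close>

lemma sum_cnt_butlast_prefix_le:
  assumes "xs \<noteq> []"
  shows "(\<Sum>v\<in>words j. cnt (butlast xs) (v @ u)) \<le> cnt (butlast xs) (u :: 'a::finite list)"
proof -
  have "(\<Sum>v\<in>words j. cnt (butlast xs) (v @ u)) = (\<Sum>a\<in>UNIV. \<Sum>v\<in>words j. cnt xs (v @ u @ [a]))"
    using assms by (simp add: cnt_butlast) (rule sum.swap)
  also have "\<dots> \<le> (\<Sum>a\<in>UNIV. cnt xs (u @ [a]))"
    by (intro sum_mono sum_cnt_prefix_le) simp
  finally show ?thesis using assms by (simp add: cnt_butlast)
qed

text \<open>The empirical kernel of order \<open>k\<close> is read as a kernel of order
  \<open>j + k\<close> that ignores the oldest \<open>j\<close> letters. The likelihood gain is then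
  at least the divergence of the counts \<open>P\<close> from \<open>Q\<close>, the context counts
  times these coarser frequencies. \<open>Q\<close> may have smaller mass than \<open>P\<close>,
  which the divergence inequality permits.\<close>

lemma ln_MLk_diff_ge:
  fixes xs :: "'a::finite list"
  assumes "xs \<noteq> []"
  defines "N \<equiv> \<lambda>w. real (cnt xs w)" and "C \<equiv> \<lambda>u. real (cnt (butlast xs) u)"
  shows "(\<Sum>w\<in>words (j + k). \<Sum>a\<in>UNIV. \<bar>N (w @ [a]) - C w * (N (drop j w @ [a]) / C (drop j w))\<bar>)\<^sup>2
      / (4 * real (length xs)) \<le> ln (MLk (j + k) xs) - ln (MLk k xs)"
proof -
  let ?I = "(words (j + k) :: 'a list set) \<times> (UNIV :: 'a set)"
  define q where "q u a = N (u @ [a]) / C u" for u a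
  define P where "P = (\<lambda>(w, a). N (w @ [a]))"
  define Q where "Q = (\<lambda>(w, a). C w * q (drop j w) a)"
  have C_sum: "C u = (\<Sum>a\<in>UNIV. N (u @ [a]))" for u
    using assms(1) by (simp add: C_def N_def cnt_butlast)
  have N_le_C: "N (u @ [a]) \<le> C u" for u a
    unfolding C_sum by (rule member_le_sum) (auto simp: N_def)
  have N_suffix: "N (v @ u @ [a]) \<le> N (u @ [a])" for v u a
  proof -
    have "cnt xs (v @ u @ [a]) \<le> (\<Sum>v\<in>words (length v). cnt xs (v @ u @ [a]))"
      by (rule member_le_sum[where f = "\<lambda>v. cnt xs (v @ u @ [a])", OF _ _ finite_words]) (simp_all add: words_def)
    also have "\<dots> \<le> cnt xs (u @ [a])" by (rule sum_cnt_prefix_le) simp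
    finally show ?thesis by (simp add: N_def)
  qed
  have N_drop: "N (w @ [a]) \<le> N (drop j w @ [a])" for w a
    using N_suffix[of "take j w" "drop j w" a] by (simp only: append_assoc[symmetric] append_take_drop_id)
  have q_sum: "(\<Sum>a\<in>UNIV. q u a) \<le> 1" for u
    by (cases "C u = 0") (simp_all add: q_def sum_divide_distrib[symmetric] C_sum[symmetric])
  have q01: "0 \<le> q u a" "q u a \<le> 1" for u a
    using N_le_C[of u a] by (auto simp: q_def N_def C_def divide_le_eq_1)
  have "ln (MLk k xs) = (\<Sum>u\<in>words k. \<Sum>a\<in>UNIV. N (u @ [a]) * ln (q u a))"
    using assms(1) by (simp add: ln_MLk N_def C_def q_def)
  \<comment> \<open>Passing to left extensions loses the occurrences near the beginning of the
    sample; as \<open>ln (q u a) \<le> 0\<close>, the loss has the favourable sign.\<close>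
  also have "\<dots> \<le> (\<Sum>u\<in>words k. \<Sum>a\<in>UNIV. (\<Sum>v\<in>words j. N (v @ u @ [a])) * ln (q u a))"
  proof (intro sum_mono mult_right_mono_neg)
    fix u a
    have "(\<Sum>v\<in>words j. cnt xs (v @ u @ [a])) \<le> cnt xs (u @ [a])"
      by (rule sum_cnt_prefix_le) simp
    then have "real (\<Sum>v\<in>words j. cnt xs (v @ u @ [a])) \<le> real (cnt xs (u @ [a]))"
      by (rule of_nat_mono)
    then show "(\<Sum>v\<in>words j. N (v @ u @ [a])) \<le> N (u @ [a])" by (simp add: N_def)
    show "ln (q u a) \<le> 0"
      using q01[of u a] by (cases "q u a = 0") auto
  qed
  also have "\<dots> = (\<Sum>v\<in>words j. \<Sum>u\<in>words k. \<Sum>a\<in>UNIV. N (v @ u @ [a]) * ln (q u a))"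
  proof -
    have "(\<Sum>u\<in>words k. \<Sum>a\<in>UNIV. (\<Sum>v\<in>words j. N (v @ u @ [a])) * ln (q u a)) =
        (\<Sum>u\<in>words k. \<Sum>v\<in>words j. \<Sum>a\<in>UNIV. N (v @ u @ [a]) * ln (q u a))"
      by (intro sum.cong refl) (simp add: sum_distrib_right, rule sum.swap)
    then show ?thesis by (simp add: sum.swap[of _ "words k"])
  qed
  also have "\<dots> = (\<Sum>w\<in>words (j + k). \<Sum>a\<in>UNIV. N (w @ [a]) * ln (q (drop j w) a))"
    unfolding sum_words_append by (intro sum.cong refl) (simp add: length_words)
  finally have "ln (MLk (j + k) xs) - ln (MLk k xs) \<ge>
      (\<Sum>w\<in>words (j + k). \<Sum>a\<in>UNIV. N (w @ [a]) * ln (N (w @ [a]) / C w) - N (w @ [a]) * ln (q (drop j w) a))"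
    using assms(1) by (simp add: ln_MLk N_def C_def sum_subtractf)
  also have "(\<Sum>w\<in>words (j + k). \<Sum>a\<in>UNIV. N (w @ [a]) * ln (N (w @ [a]) / C w) - N (w @ [a]) * ln (q (drop j w) a))
      = (\<Sum>i\<in>?I. P i * ln (P i / Q i))"
    unfolding sum.cartesian_product
  proof (rule sum.cong)
    fix i assume "i \<in> ?I"
    then obtain w a where i: "i = (w, a)" by (cases i)
    have "N (w @ [a]) * ln (N (w @ [a]) / C w) - N (w @ [a]) * ln (q (drop j w) a) = P i * ln (P i / Q i)"
    proof (cases "N (w @ [a]) = 0")
      case False
      then have pos: "N (w @ [a]) > 0" by (simp add: N_def)
      have "N (drop j w @ [a]) > 0" using pos N_drop[of w a] by linarith
      then have "q (drop j w) a > 0" and "C w > 0"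
        using N_le_C[of "drop j w" a] N_le_C[of w a] pos by (auto simp: q_def)
      then show ?thesis using pos by (simp add: i P_def Q_def ln_div ln_mult algebra_simps)
    qed (simp add: i P_def)
    then show "(case i of (w, a) \<Rightarrow> N (w @ [a]) * ln (N (w @ [a]) / C w) - N (w @ [a]) * ln (q (drop j w) a)) =
        P i * ln (P i / Q i)" by (simp add: i)
  qed simp
  finally have "(\<Sum>i\<in>?I. P i * ln (P i / Q i)) \<le> ln (MLk (j + k) xs) - ln (MLk k xs)" .
  moreover have "(\<Sum>i\<in>?I. \<bar>P i - Q i\<bar>)\<^sup>2 / (4 * real (length xs)) \<le> (\<Sum>i\<in>?I. P i * ln (P i / Q i))"
  proof (rule divergence_ge_l1_distance)
    fix i assume "i \<in> ?I"
    then obtain w a where i: "i = (w, a)" by (cases i)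
    show "P i \<ge> 0" "Q i \<ge> 0" using q01 by (auto simp: i P_def Q_def N_def C_def)
    assume "P i > 0"
    then have pos: "N (w @ [a]) > 0" by (simp add: i P_def)
    have "N (drop j w @ [a]) > 0" using pos N_drop[of w a] by linarith
    then show "Q i > 0"
      using N_le_C[of "drop j w" a] N_le_C[of w a] pos by (auto simp: q_def i Q_def)
  next
    have "sum Q ?I = (\<Sum>w\<in>words (j + k). C w * (\<Sum>a\<in>UNIV. q (drop j w) a))"
      by (simp add: Q_def sum.cartesian_product[symmetric] sum_distrib_left)
    also have "\<dots> \<le> (\<Sum>w\<in>words (j + k). C w)"
      using q_sum by (intro sum_mono mult_left_le) (auto simp: C_def)
    also have "\<dots> = sum P ?I"
      by (simp add: P_def sum.cartesian_product[symmetric] C_sum)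
    finally show "sum Q ?I \<le> sum P ?I" .
    have "sum P ?I = real (\<Sum>w\<in>words (Suc (j + k)). cnt xs w)"
      unfolding of_nat_sum sum_words_Suc_snoc by (simp add: P_def sum.cartesian_product[symmetric] N_def)
    also have "\<dots> \<le> real (length xs)"
      by (rule of_nat_mono) (rule sum_cnt_le_length, simp)
    finally show "sum P ?I \<le> real (length xs)" .
  qed (use assms(1) in auto)
  moreover have "(\<Sum>i\<in>?I. \<bar>P i - Q i\<bar>) =
      (\<Sum>w\<in>words (j + k). \<Sum>a\<in>UNIV. \<bar>N (w @ [a]) - C w * (N (drop j w @ [a]) / C (drop j w))\<bar>)"
    by (simp add: P_def Q_def q_def sum.cartesian_product case_prod_unfold)
  ultimately show ?thesis by simp
qed

context block_measure
begin

text \<open>A deterministic statement transferring the separation \<open>G\<close> of the true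
  kernels to the counts. Replacing empirical by true kernels of order \<open>k\<close> costs
  \<open>2 * |A| ^ (k + 1) * e\<close>; replacing the counts of order \<open>j + k\<close> by their
  means costs \<open>2 * |A| ^ (j + k + 1) * e\<close>. Together they give the factor 4.\<close>

lemma ln_MLk_gap:
  fixes xs :: "'a list" and e :: real
  assumes xs: "xs \<noteq> []" and n: "n = length xs" and "e \<ge> 0"
    and good: "\<And>z. z \<noteq> [] \<Longrightarrow> length z \<le> j + k + 1 \<Longrightarrow> \<bar>real (cnt xs z) - real n * \<mu> z\<bar> \<le> e"
    and sep: "\<And>w. length w = j + k \<Longrightarrow> \<mu> w > 0 \<Longrightarrow> G \<le> (\<Sum>a\<in>UNIV. \<bar>kernel w a - kernel (drop j w) a\<bar>)"
    and S: "S \<ge> 0" "S \<le> real n * G - 4 * real CARD('a) ^ (j + k + 1) * e"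
  shows "S\<^sup>2 / (4 * real n) \<le> ln (MLk (j + k) xs) - ln (MLk k xs)"
proof -
  define N where "N w = real (cnt xs w)" for w
  define C where "C u = real (cnt (butlast xs) u)" for u
  let ?A = "real CARD('a)"
  let ?W = "words (j + k) :: 'a list set"
  have A1: "?A \<ge> 1" by (simp add: Suc_leI)
  have C_sum: "C u = (\<Sum>a\<in>UNIV. N (u @ [a]))" for u
    using xs by (simp add: C_def N_def cnt_butlast)
  have N_err: "\<bar>N (u @ [a]) - real n * \<mu> (u @ [a])\<bar> \<le> e" if "length u \<le> j + k" for u a
    using good[of "u @ [a]"] that by (simp add: N_def)
  have C_err: "\<bar>C u - real n * \<mu> u\<bar> \<le> ?A * e" if "length u \<le> j + k" for u
  proof -
    have "C u - real n * \<mu> u = (\<Sum>a\<in>UNIV. N (u @ [a]) - real n * \<mu> (u @ [a]))"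
      by (simp add: C_sum sum_subtractf sum_distrib_left[symmetric] \<mu>_snoc)
    also have "\<bar>\<dots>\<bar> \<le> (\<Sum>a\<in>UNIV. \<bar>N (u @ [a]) - real n * \<mu> (u @ [a])\<bar>)"
      by (rule sum_abs)
    also have "\<dots> \<le> (\<Sum>a\<in>(UNIV :: 'a set). e)"
      by (intro sum_mono N_err that)
    finally show ?thesis by simp
  qed
  have kernel_C: "(\<Sum>a\<in>UNIV. kernel u a * \<bar>C w - real n * \<mu> w\<bar>) \<le> ?A * e" if "length w \<le> j + k" for u w
    using mult_mono[OF kernel_sum_le C_err[OF that]] by (simp add: sum_distrib_right[symmetric])
  have context_err: "(\<Sum>u\<in>words k. \<Sum>a\<in>UNIV. \<bar>N (u @ [a]) - C u * kernel u a\<bar>) \<le> 2 * ?A ^ (k + 1) * e"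
  proof -
    have "(\<Sum>a\<in>UNIV. \<bar>N (u @ [a]) - C u * kernel u a\<bar>) \<le> 2 * ?A * e" if "u \<in> words k" for u
    proof -
      have len: "length u \<le> j + k" using that by (simp add: words_def)
      have "(\<Sum>a\<in>UNIV. \<bar>N (u @ [a]) - C u * kernel u a\<bar>) \<le>
          (\<Sum>a\<in>UNIV. \<bar>N (u @ [a]) - real n * \<mu> (u @ [a])\<bar> + kernel u a * \<bar>C u - real n * \<mu> u\<bar>)"
      proof (rule sum_mono)
        fix a
        have "N (u @ [a]) - C u * kernel u a =
            (N (u @ [a]) - real n * \<mu> (u @ [a])) - kernel u a * (C u - real n * \<mu> u)"
          by (simp add: algebra_simps \<mu>_mult_kernel[symmetric])
        also have "\<bar>\<dots>\<bar> \<le> \<bar>N (u @ [a]) - real n * \<mu> (u @ [a])\<bar> + \<bar>kernel u a * (C u - real n * \<mu> u)\<bar>"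
          by (rule abs_triangle_ineq4)
        finally show "\<bar>N (u @ [a]) - C u * kernel u a\<bar> \<le>
            \<bar>N (u @ [a]) - real n * \<mu> (u @ [a])\<bar> + kernel u a * \<bar>C u - real n * \<mu> u\<bar>"
          by (simp add: abs_mult kernel_nonneg)
      qed
      also have "\<dots> \<le> (\<Sum>a\<in>(UNIV :: 'a set). e) + ?A * e"
        unfolding sum.distrib by (intro add_mono sum_mono N_err kernel_C len)
      finally show ?thesis by (simp add: mult_ac)
    qed
    then have "(\<Sum>u\<in>words k. \<Sum>a\<in>UNIV. \<bar>N (u @ [a]) - C u * kernel u a\<bar>) \<le> (\<Sum>u\<in>(words k :: 'a list set). 2 * ?A * e)"
      by (rule sum_mono)
    then show ?thesis by (simp add: card_words mult_ac)
  qed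
  \<comment> \<open>Summing the weights \<open>C w\<close> over the oldest \<open>j\<close> letters
    leaves at most the context count \<open>C u\<close>, which cancels the denominator of the
    empirical kernel. No lower bound on context counts is required.\<close>
  have emp_err: "(\<Sum>w\<in>?W. \<Sum>a\<in>UNIV. C w * \<bar>N (drop j w @ [a]) / C (drop j w) - kernel (drop j w) a\<bar>)
      \<le> 2 * ?A ^ (k + 1) * e"
  proof -
    let ?d = "\<lambda>u a. \<bar>N (u @ [a]) / C u - kernel u a\<bar>"
    have "(\<Sum>w\<in>?W. \<Sum>a\<in>UNIV. C w * ?d (drop j w) a) = (\<Sum>v\<in>words j. \<Sum>u\<in>words k. C (v @ u) * (\<Sum>a\<in>UNIV. ?d u a))"
      unfolding sum_words_append sum_distrib_left by (intro sum.cong refl) (simp add: length_words)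
    also have "\<dots> = (\<Sum>u\<in>words k. (\<Sum>v\<in>words j. C (v @ u)) * (\<Sum>a\<in>UNIV. ?d u a))"
      unfolding sum_distrib_right by (rule sum.swap)
    also have "\<dots> \<le> (\<Sum>u\<in>words k. C u * (\<Sum>a\<in>UNIV. ?d u a))"
    proof (intro sum_mono mult_right_mono)
      fix u
      have "real (\<Sum>v\<in>words j. cnt (butlast xs) (v @ u)) \<le> real (cnt (butlast xs) u)"
        using sum_cnt_butlast_prefix_le[OF xs] by (rule of_nat_mono)
      then show "(\<Sum>v\<in>words j. C (v @ u)) \<le> C u" by (simp add: C_def)
    qed (simp add: sum_nonneg)
    also have "\<dots> = (\<Sum>u\<in>words k. \<Sum>a\<in>UNIV. \<bar>N (u @ [a]) - C u * kernel u a\<bar>)"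
      unfolding sum_distrib_left
    proof (intro sum.cong refl)
      fix u a
      have "N (u @ [a]) \<le> C u" unfolding C_sum by (rule member_le_sum) (auto simp: N_def)
      moreover have "N (u @ [a]) \<ge> 0" "C u \<ge> 0" by (simp_all add: N_def C_def)
      ultimately have "N (u @ [a]) - C u * kernel u a = C u * (N (u @ [a]) / C u - kernel u a)"
        by (cases "C u = 0") (auto simp: algebra_simps)
      then show "C u * ?d u a = \<bar>N (u @ [a]) - C u * kernel u a\<bar>"
        using \<open>C u \<ge> 0\<close> by (simp add: abs_mult)
    qed
    finally show ?thesis using context_err by linarith
  qed
  have main: "real n * G \<le> (\<Sum>w\<in>?W. \<Sum>a\<in>UNIV. real n * \<bar>\<mu> (w @ [a]) - \<mu> w * kernel (drop j w) a\<bar>)"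
  proof -
    have "real n * G = (\<Sum>w\<in>?W. real n * (\<mu> w * G))"
      by (simp add: sum_distrib_left[symmetric] sum_distrib_right[symmetric] sum_\<mu>)
    also have "\<dots> \<le> (\<Sum>w\<in>?W. real n * (\<mu> w * (\<Sum>a\<in>UNIV. \<bar>kernel w a - kernel (drop j w) a\<bar>)))"
    proof (rule sum_mono, rule mult_left_mono)
      fix w assume "w \<in> ?W"
      then show "\<mu> w * G \<le> \<mu> w * (\<Sum>a\<in>UNIV. \<bar>kernel w a - kernel (drop j w) a\<bar>)"
        using sep[of w] \<mu>_nonneg[of w] by (cases "\<mu> w = 0") (auto simp: words_def)
    qed simp
    also have "\<dots> = (\<Sum>w\<in>?W. \<Sum>a\<in>UNIV. real n * \<bar>\<mu> (w @ [a]) - \<mu> w * kernel (drop j w) a\<bar>)"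
      by (simp add: sum_distrib_left \<mu>_mult_kernel[symmetric] right_diff_distrib[symmetric] abs_mult \<mu>_nonneg)
    finally show ?thesis .
  qed
  let ?X = "\<Sum>w\<in>?W. \<Sum>a\<in>UNIV. \<bar>N (w @ [a]) - C w * (N (drop j w @ [a]) / C (drop j w))\<bar>"
  have "(\<Sum>w\<in>?W. \<Sum>a\<in>UNIV. real n * \<bar>\<mu> (w @ [a]) - \<mu> w * kernel (drop j w) a\<bar>) \<le>
      (\<Sum>w\<in>?W. \<Sum>a\<in>UNIV. \<bar>N (w @ [a]) - C w * (N (drop j w @ [a]) / C (drop j w))\<bar> +
        (C w * \<bar>N (drop j w @ [a]) / C (drop j w) - kernel (drop j w) a\<bar> +
         (e + kernel (drop j w) a * \<bar>C w - real n * \<mu> w\<bar>)))"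
  proof (intro sum_mono)
    fix w a assume w: "w \<in> ?W"
    let ?q = "N (drop j w @ [a]) / C (drop j w)" and ?t = "kernel (drop j w) a"
    have "real n * (\<mu> (w @ [a]) - \<mu> w * ?t) = (N (w @ [a]) - C w * ?q) + C w * (?q - ?t)
        - (N (w @ [a]) - real n * \<mu> (w @ [a])) + ?t * (C w - real n * \<mu> w)"
      by (simp add: algebra_simps)
    moreover have "real n * \<bar>\<mu> (w @ [a]) - \<mu> w * ?t\<bar> = \<bar>real n * (\<mu> (w @ [a]) - \<mu> w * ?t)\<bar>"
      by (simp add: abs_mult)
    ultimately have "real n * \<bar>\<mu> (w @ [a]) - \<mu> w * ?t\<bar> \<le> \<bar>N (w @ [a]) - C w * ?q\<bar> + \<bar>C w * (?q - ?t)\<bar>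
        + \<bar>N (w @ [a]) - real n * \<mu> (w @ [a])\<bar> + \<bar>?t * (C w - real n * \<mu> w)\<bar>"
      by linarith
    moreover have "C w \<ge> 0" by (simp add: C_def)
    moreover have "\<bar>N (w @ [a]) - real n * \<mu> (w @ [a])\<bar> \<le> e" using w by (intro N_err) (simp add: words_def)
    ultimately show "real n * \<bar>\<mu> (w @ [a]) - \<mu> w * ?t\<bar> \<le> \<bar>N (w @ [a]) - C w * ?q\<bar> +
        (C w * \<bar>?q - ?t\<bar> + (e + ?t * \<bar>C w - real n * \<mu> w\<bar>))"
      by (simp add: abs_mult kernel_nonneg)
  qed
  also have "\<dots> = ?X + ((\<Sum>w\<in>?W. \<Sum>a\<in>UNIV. C w * \<bar>N (drop j w @ [a]) / C (drop j w) - kernel (drop j w) a\<bar>) +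
      (\<Sum>w\<in>?W. \<Sum>a\<in>(UNIV::'a set). e + kernel (drop j w) a * \<bar>C w - real n * \<mu> w\<bar>))"
    by (simp only: sum.distrib)
  also have "(\<Sum>w\<in>?W. \<Sum>a\<in>(UNIV::'a set). e + kernel (drop j w) a * \<bar>C w - real n * \<mu> w\<bar>) \<le> (\<Sum>w\<in>?W. 2 * ?A * e)"
  proof (rule sum_mono)
    fix w assume "w \<in> ?W"
    then have "(\<Sum>a\<in>UNIV. kernel (drop j w) a * \<bar>C w - real n * \<mu> w\<bar>) \<le> ?A * e"
      by (intro kernel_C) (simp add: words_def)
    then show "(\<Sum>a\<in>(UNIV::'a set). e + kernel (drop j w) a * \<bar>C w - real n * \<mu> w\<bar>) \<le> 2 * ?A * e"
      by (simp add: sum.distrib mult_ac)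
  qed
  also have "(\<Sum>w\<in>?W. 2 * ?A * e) = 2 * ?A ^ (j + k + 1) * e"
    by (simp add: card_words)
  finally have "real n * G \<le> ?X + 2 * ?A ^ (k + 1) * e + 2 * ?A ^ (j + k + 1) * e"
    using main emp_err by linarith
  moreover have "?A ^ (k + 1) * e \<le> ?A ^ (j + k + 1) * e"
    using A1 \<open>e \<ge> 0\<close> by (intro mult_right_mono power_increasing) auto
  ultimately have "S \<le> ?X" using S(2) by linarith
  then have "S\<^sup>2 / (4 * real n) \<le> ?X\<^sup>2 / (4 * real n)"
    using S(1) by (intro divide_right_mono power_mono) auto
  also have "\<dots> \<le> ln (MLk (j + k) xs) - ln (MLk k xs)"
    using ln_MLk_diff_ge[OF xs, of j k] by (simp add: N_def C_def n)
  finally show ?thesis .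
qed

end

section \<open>Penalty terms\<close>

lemma ln_Suc_le_sqrt: "ln (real n + 1) \<le> 2 * sqrt (real n)"
proof -
  have "ln (real n + 1) = 2 * ln (sqrt (real n + 1))" by (simp add: ln_sqrt)
  also have "\<dots> \<le> 2 * (sqrt (real n + 1) - 1)"
    using ln_le_minus_one[of "sqrt (real n + 1)"] by simp
  also have "sqrt (real n + 1) \<le> sqrt (real n) + 1"
    using sqrt_add_le_add_sqrt[of "real n" 1] by simp
  finally show ?thesis by simp
qed

text \<open>A telescoping form of the bound of harmonic sums by square roots. Accuracy
  \<open>sqrt n\<close> suffices, because that is the scale allowed for the penalty.\<close>

lemma inverse_Suc_le_sqrt_diff: "1 / (real n + 1) \<le> 2 * (sqrt (real n + 1) - sqrt (real n))"
proof -
  let ?a = "sqrt (real n + 1)" and ?b = "sqrt (real n)"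
  have "?a \<le> real n + 1" "?b \<le> real n + 1"
    by (auto intro!: real_le_lsqrt simp: power2_eq_square algebra_simps)
  then have s: "?a + ?b \<le> 2 * (real n + 1)" by simp
  have "(?a - ?b) * (?a + ?b) = 1" by (simp add: algebra_simps)
  moreover have "?a - ?b \<ge> 0" by simp
  ultimately have "1 \<le> (?a - ?b) * (2 * (real n + 1))"
    using mult_left_mono[OF s] by metis
  then show ?thesis by (simp add: field_simps)
qed

text \<open>A crude Stirling formula for the logarithm of a Gamma quotient. Passing from
  \<open>x\<close> to 1 and from the sum to the primitive of the logarithm each costs a multiple of
  \<open>1 / (N + 1)\<close> per term. The condition on \<open>x\<close> gives
  \<open>N + x \<ge> (N + 1) / 2\<close> and admits both shifts needed for KT, \<open>1/2\<close>
  and \<open>|A| / 2\<close>.\<close>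

lemma sum_ln_shift:
  fixes x :: real
  assumes "x \<ge> 1/2"
  shows "\<bar>(\<Sum>j<N. ln (real j + x)) - (real N * ln (real N) - real N)\<bar> \<le> 2 * (2 * x + 3) * sqrt (real N)"
proof (induction N)
  case (Suc N)
  let ?\<phi> = "\<lambda>N. real N * ln (real N) - real N"
  have up: "?\<phi> (Suc N) - ?\<phi> N \<le> ln (real N + 1)"
    and lo: "ln (real N + 1) - 1 / (real N + 1) \<le> ?\<phi> (Suc N) - ?\<phi> N"
  proof -
    have eq: "?\<phi> (Suc N) - ?\<phi> N = ln (real N + 1) + (real N * (ln (real N + 1) - ln (real N)) - 1)"
      by (simp add: algebra_simps)
    have "real N * (ln (real N + 1) - ln (real N)) \<le> 1"
    proof (cases "N = 0")
      case False
      then have "ln (real N + 1) - ln (real N) \<le> 1 / real N"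
        using ln_diff_le[of "real N + 1" "real N"] by simp
      then show ?thesis using False by (simp add: field_simps)
    qed simp
    then show "?\<phi> (Suc N) - ?\<phi> N \<le> ln (real N + 1)" unfolding eq by simp
    have "real N * (ln (real N + 1) - ln (real N)) \<ge> real N / (real N + 1)"
    proof (cases "N = 0")
      case False
      then have "ln (real N) - ln (real N + 1) \<le> - 1 / (real N + 1)"
        using ln_diff_le[of "real N" "real N + 1"] by simp
      then have "real N * (1 / (real N + 1)) \<le> real N * (ln (real N + 1) - ln (real N))"
        by (intro mult_left_mono) auto
      then show ?thesis by simp
    qed simp
    moreover have "real N / (real N + 1) - 1 = - 1 / (real N + 1)" by (simp add: field_simps)
    ultimately show "ln (real N + 1) - 1 / (real N + 1) \<le> ?\<phi> (Suc N) - ?\<phi> N" unfolding eq by simp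
  qed
  have shift: "\<bar>ln (real N + x) - ln (real N + 1)\<bar> \<le> (2 * x + 2) / (real N + 1)"
  proof -
    have pos: "real N + x > 0" using assms by simp
    have "ln (real N + x) - ln (real N + 1) \<le> (x - 1) / (real N + 1)"
      using ln_diff_le[of "real N + x" "real N + 1"] pos by (simp add: algebra_simps)
    moreover have "(x - 1) / (real N + 1) \<le> (2 * x + 2) / (real N + 1)"
      using assms by (intro divide_right_mono) auto
    moreover have "ln (real N + 1) - ln (real N + x) \<le> (1 - x) / (real N + x)"
      using ln_diff_le[of "real N + 1" "real N + x"] pos by (simp add: algebra_simps)
    moreover have "(1 - x) / (real N + x) \<le> (2 * x + 2) / (real N + 1)"
    proof -
      have "(1 - x) / (real N + x) \<le> 1 / (real N + x)"
        using assms pos by (intro divide_right_mono) auto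
      also have "\<dots> \<le> 2 / (real N + 1)" using assms pos by (simp add: field_simps)
      also have "\<dots> \<le> (2 * x + 2) / (real N + 1)" using assms by (intro divide_right_mono) auto
      finally show ?thesis .
    qed
    ultimately show ?thesis by linarith
  qed
  have "\<bar>(\<Sum>j<Suc N. ln (real j + x)) - ?\<phi> (Suc N)\<bar> \<le>
      \<bar>(\<Sum>j<N. ln (real j + x)) - ?\<phi> N\<bar> + ((2 * x + 2) / (real N + 1) + 1 / (real N + 1))"
    using up lo shift unfolding sum.lessThan_Suc by linarith
  also have "(2 * x + 2) / (real N + 1) + 1 / (real N + 1) = (2 * x + 3) * (1 / (real N + 1))"
    by (simp add: field_simps)
  also have "\<dots> \<le> (2 * x + 3) * (2 * (sqrt (real N + 1) - sqrt (real N)))"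
    using inverse_Suc_le_sqrt_diff assms by (intro mult_left_mono) auto
  finally show ?case using Suc by (simp add: algebra_simps)
qed simp

text \<open>Unseen letters and unseen contexts contribute empty products, so the restricted products
  extend to all letters and all words.\<close>

lemma ln_P_KT:
  fixes xs :: "'a::finite list"
  assumes "xs \<noteq> []"
  shows "ln (P_KT k xs) = - real k * ln (real CARD('a)) +
    (\<Sum>u\<in>words k. (\<Sum>a\<in>UNIV. \<Sum>j<cnt xs (u @ [a]). ln (real j + 1/2))
      - (\<Sum>j<cnt (butlast xs) u. ln (real j + real CARD('a) / 2)))"
    and "P_KT k xs > 0"
proof -
  let ?A = "real CARD('a)"
  have A: "?A > 0" by simp
  let ?num = "\<lambda>u. \<Prod>a\<in>UNIV. \<Prod>j<cnt xs (u @ [a]). (real j + 1/2)"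
  let ?den = "\<lambda>u. \<Prod>j<cnt (butlast xs) u. (real j + ?A / 2)"
  have num': "(\<Prod>a \<in> {a. 1 \<le> cnt xs (u @ [a])}. \<Prod>j<cnt xs (u @ [a]). (real j + 1/2)) = ?num u" for u
  proof (rule prod.mono_neutral_left)
    show "\<forall>a\<in>UNIV - {a. 1 \<le> cnt xs (u @ [a])}. (\<Prod>j<cnt xs (u @ [a]). real j + 1/2) = 1"
    proof
      fix a assume "a \<in> UNIV - {a. 1 \<le> cnt xs (u @ [a])}"
      then have "cnt xs (u @ [a]) = 0" by simp
      then show "(\<Prod>j<cnt xs (u @ [a]). real j + 1/2) = 1" by simp
    qed
  qed auto
  have num: "?num u > 0" for u by (intro prod_pos) (auto intro: add_nonneg_pos)
  have den: "?den u > 0" for u using A by (intro prod_pos) (auto intro: add_nonneg_pos)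
  have triv: "?num u / ?den u = 1" if "cnt (butlast xs) u = 0" for u
  proof -
    have "(\<Sum>a\<in>UNIV. cnt xs (u @ [a])) = 0" using that assms by (simp add: cnt_butlast)
    then show ?thesis using that by simp
  qed
  have eq: "P_KT k xs = (1 / ?A ^ k) * (\<Prod>u\<in>words k. ?num u / ?den u)"
    unfolding P_KT_def num'
  proof (intro arg_cong2[where f = "(*)"] refl prod.mono_neutral_left)
    show "\<forall>u\<in>words k - {u. length u = k \<and> 1 \<le> cnt (butlast xs) u}. ?num u / ?den u = 1"
    proof
      fix u :: "'a list" assume "u \<in> words k - {u. length u = k \<and> 1 \<le> cnt (butlast xs) u}"
      then have "cnt (butlast xs) u = 0" by (auto simp: words_def not_le)
      then show "?num u / ?den u = 1" by (rule triv)
    qed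
    show "{u. length u = k \<and> 1 \<le> cnt (butlast xs) u} \<subseteq> words k" by (auto simp: words_def)
  qed simp
  have contexts: "(\<Prod>u\<in>words k. ?num u / ?den u) > 0"
    by (intro prod_pos divide_pos_pos num den)
  show "P_KT k xs > 0" unfolding eq using A by (intro mult_pos_pos contexts) simp
  have "ln (P_KT k xs) = ln (1 / ?A ^ k) + ln (\<Prod>u\<in>words k. ?num u / ?den u)"
    unfolding eq using A by (intro ln_mult_pos contexts) simp
  also have "ln (1 / ?A ^ k) = - real k * ln ?A"
    using A by (simp add: ln_div ln_realpow)
  also have "ln (\<Prod>u\<in>words k. ?num u / ?den u) = (\<Sum>u\<in>words k. ln (?num u / ?den u))"
    by (rule ln_prod) (simp, use num den in \<open>metis divide_pos_pos less_irrefl\<close>)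
  also have "\<dots> = (\<Sum>u\<in>words k. (\<Sum>a\<in>UNIV. \<Sum>j<cnt xs (u @ [a]). ln (real j + 1/2))
      - (\<Sum>j<cnt (butlast xs) u. ln (real j + ?A / 2)))"
  proof (rule sum.cong)
    fix u :: "'a list"
    have "ln (?num u / ?den u) = ln (?num u) - ln (?den u)"
      using num[of u] den[of u] by (rule ln_divide_pos)
    also have "ln (?num u) = (\<Sum>a\<in>UNIV. ln (\<Prod>j<cnt xs (u @ [a]). real j + 1/2))"
      by (rule ln_prod) (simp, rule less_imp_neq[symmetric], auto intro!: prod_pos add_nonneg_pos)
    also have "\<dots> = (\<Sum>a\<in>UNIV. \<Sum>j<cnt xs (u @ [a]). ln (real j + 1/2))"
      by (rule sum.cong[OF refl], rule ln_prod) auto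
    also have "ln (?den u) = (\<Sum>j<cnt (butlast xs) u. ln (real j + ?A / 2))"
      using A by (intro ln_prod) (auto simp: add_nonneg_pos less_imp_neq[symmetric])
    finally show "ln (?num u / ?den u) = (\<Sum>a\<in>UNIV. \<Sum>j<cnt xs (u @ [a]). ln (real j + 1/2))
      - (\<Sum>j<cnt (butlast xs) u. ln (real j + ?A / 2))" .
  qed simp
  finally show "ln (P_KT k xs) = - real k * ln ?A +
    (\<Sum>u\<in>words k. (\<Sum>a\<in>UNIV. \<Sum>j<cnt xs (u @ [a]). ln (real j + 1/2))
      - (\<Sum>j<cnt (butlast xs) u. ln (real j + ?A / 2)))" .
qed

lemma cnt_le_length: "w \<noteq> [] \<Longrightarrow> cnt xs w \<le> length (xs :: 'a::finite list)"
proof -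
  assume "w \<noteq> []"
  have "cnt xs w \<le> (\<Sum>w\<in>words (length w). cnt xs w)"
    by (rule member_le_sum[where f = "cnt xs", OF _ _ finite_words]) (simp_all add: words_def)
  also have "\<dots> \<le> length xs" using \<open>w \<noteq> []\<close> by (intro sum_cnt_le_length) simp
  finally show ?thesis .
qed

lemma cnt_butlast_le_length:
  assumes "xs \<noteq> []"
  shows "cnt (butlast xs) u \<le> length (xs :: 'a::finite list)"
proof -
  have "cnt (butlast xs) u = (\<Sum>a\<in>UNIV. cnt xs (u @ [a]))"
    using assms by (rule cnt_butlast)
  also have "\<dots> \<le> (\<Sum>u\<in>words (length u). \<Sum>a\<in>UNIV. cnt xs (u @ [a]))"
    by (rule member_le_sum[where f = "\<lambda>u. \<Sum>a\<in>UNIV. cnt xs (u @ [a])", OF _ _ finite_words])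
       (simp_all add: words_def)
  also have "\<dots> \<le> length xs"
    unfolding sum_words_Suc_snoc[symmetric] by (rule sum_cnt_le_length) simp
  finally show ?thesis .
qed

text \<open>Absorbs the factor \<open>|A| ^ k\<close> of KT and of the NML normalizer into the
  common penalty shape \<open>|A| ^ k * sqrt n\<close>.\<close>

lemma order_le_card_power:
  assumes A: "CARD('a::finite) \<ge> 2" and n: "n > 0"
  shows "real k * ln (real CARD('a)) \<le> real CARD('a) * real CARD('a) ^ k * sqrt (real n)"
proof -
  have "real k \<le> 2 ^ k" using of_nat_mono[OF less_imp_le[OF less_exp[of k]], where 'a = real] by simp
  also have "\<dots> \<le> real CARD('a) ^ k" using A by (intro power_mono) auto
  finally have "real k \<le> real CARD('a) ^ k" .
  moreover have "ln (real CARD('a)) \<le> real CARD('a)" using ln_le_minus_one[of "real CARD('a)"] A by simp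
  moreover have "ln (real CARD('a)) \<ge> 0" using A by simp
  ultimately have "real k * ln (real CARD('a)) \<le> real CARD('a) * real CARD('a) ^ k"
    by (metis mult.commute mult_mono of_nat_0_le_iff zero_le_power)
  also have "\<dots> = real CARD('a) * real CARD('a) ^ k * 1" by simp
  also have "\<dots> \<le> real CARD('a) * real CARD('a) ^ k * sqrt (real n)"
    using n by (intro mult_left_mono) (simp_all add: Suc_leI)
  finally show ?thesis .
qed

text \<open>The linear parts of \<open>\<phi>\<close> cancel since a context count is the sum of its
  letter counts, leaving exactly the likelihood. Each context has \<open>|A|\<close> letter errors
  with coefficient 8 and one context error with coefficient \<open>2 * |A| + 6\<close>; both are
  below \<open>2 * |A| + 8\<close>.\<close>

lemma KT_penalty:
  fixes xs :: "'a::finite list"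
  assumes A2: "CARD('a) \<ge> 2" and xs: "xs \<noteq> []"
  shows "\<bar>ln (P_KT k xs) - ln (MLk k xs)\<bar> \<le>
    (real CARD('a) + (real CARD('a) + 1) * (2 * real CARD('a) + 8)) * real CARD('a) ^ k * sqrt (real (length xs))"
proof -
  let ?A = "real CARD('a)" and ?s = "sqrt (real (length xs))"
  define \<phi> where "\<phi> N = real N * ln (real N) - real N" for N
  define S where "S x N = (\<Sum>j<N. ln (real j + x))" for x :: real and N
  define N where "N u a = cnt xs (u @ [a])" for u a
  define C where "C u = cnt (butlast xs) u" for u
  have C_sum: "C u = (\<Sum>a\<in>UNIV. N u a)" for u using xs by (simp add: C_def N_def cnt_butlast)
  have N_err: "\<bar>S (1/2) (N u a) - \<phi> (N u a)\<bar> \<le> (2 * ?A + 8) * ?s" for u a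
  proof -
    have "\<bar>S (1/2) (N u a) - \<phi> (N u a)\<bar> \<le> 2 * (2 * (1/2) + 3) * sqrt (real (N u a))"
      unfolding S_def \<phi>_def by (rule sum_ln_shift) simp
    also have "\<dots> \<le> (2 * ?A + 8) * ?s"
      by (intro mult_mono) (auto simp: N_def cnt_le_length)
    finally show ?thesis .
  qed
  have C_err: "\<bar>S (?A / 2) (C u) - \<phi> (C u)\<bar> \<le> (2 * ?A + 8) * ?s" for u
  proof -
    have "\<bar>S (?A / 2) (C u) - \<phi> (C u)\<bar> \<le> 2 * (2 * (?A / 2) + 3) * sqrt (real (C u))"
      unfolding S_def \<phi>_def using A2 by (intro sum_ln_shift) simp
    also have "\<dots> \<le> (2 * ?A + 8) * ?s"
      using xs by (intro mult_mono) (auto simp: C_def cnt_butlast_le_length)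
    finally show ?thesis .
  qed
  have "ln (MLk k xs) = (\<Sum>u\<in>words k. (\<Sum>a\<in>UNIV. \<phi> (N u a)) - \<phi> (C u))"
    unfolding ln_MLk[OF xs]
  proof (rule sum.cong)
    fix u
    have "(\<Sum>a\<in>UNIV. real (N u a) * ln (real (N u a) / real (C u))) =
        (\<Sum>a\<in>UNIV. real (N u a) * ln (real (N u a)) - real (N u a) * ln (real (C u)))"
    proof (rule sum.cong)
      fix a
      have "N u a \<le> C u" unfolding C_sum by (rule member_le_sum) auto
      then show "real (N u a) * ln (real (N u a) / real (C u)) =
          real (N u a) * ln (real (N u a)) - real (N u a) * ln (real (C u))"
        by (cases "N u a = 0") (auto simp: ln_div algebra_simps)
    qed simp
    also have "\<dots> = (\<Sum>a\<in>UNIV. \<phi> (N u a)) - \<phi> (C u)"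
      by (simp add: \<phi>_def sum_subtractf sum_distrib_right[symmetric] C_sum)
    finally show "(\<Sum>a\<in>UNIV. real (cnt xs (u @ [a])) * ln (real (cnt xs (u @ [a])) / real (cnt (butlast xs) u)))
        = (\<Sum>a\<in>UNIV. \<phi> (N u a)) - \<phi> (C u)" by (simp add: N_def C_def)
  qed simp
  then have "ln (P_KT k xs) - ln (MLk k xs) = (\<Sum>u\<in>words k. (\<Sum>a\<in>UNIV. S (1/2) (N u a) - \<phi> (N u a))
      - (S (?A / 2) (C u) - \<phi> (C u))) - real k * ln ?A"
    unfolding ln_P_KT(1)[OF xs] by (simp add: S_def N_def C_def sum_subtractf)
  then have "\<bar>ln (P_KT k xs) - ln (MLk k xs)\<bar> \<le> \<bar>\<Sum>u\<in>words k. (\<Sum>a\<in>UNIV. S (1/2) (N u a) - \<phi> (N u a))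
      - (S (?A / 2) (C u) - \<phi> (C u))\<bar> + real k * ln ?A"
  proof -
    have "real k * ln ?A \<ge> 0" using A2 by simp
    then show "X = Y - real k * ln ?A \<Longrightarrow> \<bar>X\<bar> \<le> \<bar>Y\<bar> + real k * ln ?A" for X Y by linarith
  qed
  also have "\<bar>\<Sum>u\<in>words k. (\<Sum>a\<in>UNIV. S (1/2) (N u a) - \<phi> (N u a)) - (S (?A / 2) (C u) - \<phi> (C u))\<bar>
      \<le> (\<Sum>u\<in>(words k :: 'a list set). (?A + 1) * ((2 * ?A + 8) * ?s))"
  proof (rule order_trans[OF sum_abs], rule sum_mono)
    fix u
    have "\<bar>\<Sum>a\<in>UNIV. S (1/2) (N u a) - \<phi> (N u a)\<bar> \<le> (\<Sum>a\<in>(UNIV :: 'a set). (2 * ?A + 8) * ?s)"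
      by (rule order_trans[OF sum_abs]) (intro sum_mono N_err)
    also have "\<dots> = ?A * ((2 * ?A + 8) * ?s)" by simp
    finally have "\<bar>\<Sum>a\<in>UNIV. S (1/2) (N u a) - \<phi> (N u a)\<bar> \<le> ?A * ((2 * ?A + 8) * ?s)" .
    then show "\<bar>(\<Sum>a\<in>UNIV. S (1/2) (N u a) - \<phi> (N u a)) - (S (?A / 2) (C u) - \<phi> (C u))\<bar>
        \<le> (?A + 1) * ((2 * ?A + 8) * ?s)"
      using C_err[of u] unfolding distrib_right[of ?A 1] by linarith
  qed
  also have "\<dots> = (?A + 1) * (2 * ?A + 8) * ?A ^ k * ?s" by (simp add: card_words)
  also have "real k * ln ?A \<le> ?A * ?A ^ k * ?s"
    using xs by (intro order_le_card_power A2) simp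
  finally show ?thesis by (simp add: algebra_simps)
qed

section \<open>Normalizing sums of maximum likelihoods\<close>

lemma sum_Markov_likelihood_le:
  fixes q :: "'a::finite list \<Rightarrow> real"
  assumes q: "\<And>w. q w \<ge> 0" "\<And>u. (\<Sum>a\<in>UNIV. q (u @ [a])) \<le> 1"
  shows "(\<Sum>xs\<in>words n. \<Prod>w\<in>words (k + 1). q w ^ cnt xs w) \<le> real CARD('a) ^ k"
proof (induction n)
  case 0
  have "(\<Prod>w\<in>words (k + 1). q w ^ cnt [] w) = 1"
    by (rule prod.neutral) (auto simp: cnt_Nil words_def)
  then show ?case by (simp add: Suc_leI one_le_power)
next
  case (Suc n)
  let ?R = "\<lambda>xs. \<Prod>w\<in>words (k + 1). q w ^ cnt xs w"
  show ?case
  proof (cases "k \<le> n")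
    case True
    \<comment> \<open>One more letter multiplies the likelihood by a single transition weight, and
      summing over that letter gives at most 1. Only the first \<open>k\<close> letters are free,
      whence the bound \<open>|A| ^ k\<close>.\<close>
    have R: "?R (xs @ [a]) = ?R xs * q (drop (n - k) xs @ [a])" if "xs \<in> words n" for xs a
    proof -
      let ?w = "drop (n - k) xs @ [a]"
      have w: "?w \<in> words (k + 1)" using that True by (simp add: words_def)
      have suf: "suffix w (xs @ [a]) \<longleftrightarrow> w = ?w" if "w \<in> words (k + 1)" for w
        using that True \<open>xs \<in> words n\<close> by (auto simp: suffix_iff_drop words_def)
      have "?R (xs @ [a]) = ?R xs * (\<Prod>w\<in>words (k + 1). q w ^ of_bool (suffix w (xs @ [a])))"
        by (simp only: cnt_snoc power_add prod.distrib)
      also have "(\<Prod>w\<in>words (k + 1). q w ^ of_bool (suffix w (xs @ [a]))) =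
          (\<Prod>w\<in>words (k + 1). if w = ?w then q w else 1)"
        by (intro prod.cong refl) (simp add: suf del: suffix_snoc)
      also have "\<dots> = q ?w" using w by (simp add: prod.delta)
      finally show ?thesis .
    qed
    have "(\<Sum>xs\<in>words (Suc n). ?R xs) = (\<Sum>xs\<in>words n. ?R xs * (\<Sum>a\<in>UNIV. q (drop (n - k) xs @ [a])))"
      unfolding sum_words_Suc_snoc by (intro sum.cong refl) (simp only: R sum_distrib_left)
    also have "\<dots> \<le> (\<Sum>xs\<in>words n. ?R xs)"
      by (intro sum_mono mult_left_le q prod_nonneg) (simp add: q)
    finally show ?thesis using Suc by simp
  next
    case False
    have "?R xs = 1" if "xs \<in> words (Suc n)" for xs
    proof (rule prod.neutral, rule ballI)
      fix w :: "'a list" assume "w \<in> words (k + 1)"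
      then have "cnt xs w = 0" using False that by (auto simp: words_def cnt_def)
      then show "q w ^ cnt xs w = 1" by simp
    qed
    then have "(\<Sum>xs\<in>words (Suc n). ?R xs) = real CARD('a) ^ Suc n" by (simp add: card_words del: power_Suc)
    also have "\<dots> \<le> real CARD('a) ^ k" using False by (intro power_increasing) (auto simp: Suc_leI)
    finally show ?thesis .
  qed
qed

text \<open>Each maximum likelihood is the likelihood under the Markov kernel read off from the
  block counts of the sample, and there are at most \<open>(n + 1) ^ |A| ^ (k + 1)\<close> count vectors.\<close>

lemma sum_MLk_le:
  assumes "n > 0"
  shows "(\<Sum>xs\<in>words n. MLk k (xs :: 'a::finite list)) \<le> real CARD('a) ^ k * (real n + 1) ^ (CARD('a) ^ (k + 1))"
proof -
  let ?T = "words (k + 1) \<rightarrow>\<^sub>E {..n} :: ('a list \<Rightarrow> nat) set"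
  define q where "q c w = (if w \<in> words (k + 1) then real (c w) / real (\<Sum>a\<in>UNIV. c (butlast w @ [a])) else 0)"
    for c :: "'a list \<Rightarrow> nat" and w
  let ?R = "\<lambda>c xs. \<Prod>w\<in>words (k + 1). q c w ^ cnt xs w"
  have q0: "q c w \<ge> 0" for c w by (simp add: q_def sum_nonneg)
  have q1: "(\<Sum>a\<in>UNIV. q c (u @ [a])) \<le> 1" for c u
  proof (cases "u \<in> words k")
    case True
    then have "(\<Sum>a\<in>UNIV. q c (u @ [a])) = (\<Sum>a\<in>UNIV. real (c (u @ [a])) / real (\<Sum>a\<in>UNIV. c (u @ [a])))"
      by (intro sum.cong) (auto simp: q_def words_def)
    also have "\<dots> = real (\<Sum>a\<in>UNIV. c (u @ [a])) / real (\<Sum>a\<in>UNIV. c (u @ [a]))"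
      by (simp only: sum_divide_distrib[symmetric] of_nat_sum)
    also have "\<dots> \<le> 1" by simp
    finally show ?thesis .
  next
    case False
    then have "q c (u @ [a]) = 0" for a by (simp add: q_def words_def)
    then show ?thesis by simp
  qed
  have finT: "finite ?T" by (intro finite_PiE) auto
  have "(\<Sum>xs\<in>words n. MLk k (xs :: 'a list)) \<le> (\<Sum>xs\<in>words n. \<Sum>c\<in>?T. ?R c xs)"
  proof (rule sum_mono)
    fix xs :: "'a list" assume xs: "xs \<in> words n"
    then have ne: "xs \<noteq> []" using assms by (auto simp: words_def)
    \<comment> \<open>Restriction makes the count vector extensional, hence an element of the finite
      set \<open>?T\<close>.\<close>
    define c where "c = restrict (cnt xs) (words (k + 1))"
    have c: "c \<in> ?T"
      unfolding c_def restrict_PiE_iff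
    proof
      fix w :: "'a list" assume "w \<in> words (k + 1)"
      then have "w \<noteq> []" by (auto simp: words_def)
      from cnt_le_length[OF this, of xs] show "cnt xs w \<in> {..n}"
        using xs by (simp add: words_def)
    qed
    have "MLk k xs = ?R c xs"
      unfolding MLk_def words_def[symmetric]
    proof (rule prod.cong)
      fix w :: "'a list" assume w: "w \<in> words (k + 1)"
      then have "butlast w @ [a] \<in> words (k + 1)" for a by (auto simp: words_def)
      then have "(\<Sum>a\<in>UNIV. c (butlast w @ [a])) = cnt (butlast xs) (butlast w)"
        using ne by (simp add: c_def cnt_butlast)
      then show "(real (cnt xs w) / real (cnt (butlast xs) (butlast w))) ^ cnt xs w = q c w ^ cnt xs w"
        using w by (simp add: q_def c_def)
    qed simp
    also have "\<dots> \<le> (\<Sum>c\<in>?T. ?R c xs)"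
      by (rule member_le_sum[where f = "\<lambda>c. ?R c xs", OF c _ finT]) (intro prod_nonneg zero_le_power q0)
    finally show "MLk k xs \<le> (\<Sum>c\<in>?T. ?R c xs)" .
  qed
  also have "\<dots> = (\<Sum>c\<in>?T. \<Sum>xs\<in>words n. ?R c xs)" by (rule sum.swap)
  also have "\<dots> \<le> (\<Sum>c\<in>?T. real CARD('a) ^ k)"
    by (intro sum_mono sum_Markov_likelihood_le q0 q1)
  also have "\<dots> = real CARD('a) ^ k * (real n + 1) ^ (CARD('a) ^ (k + 1))"
    by (simp add: card_PiE card_words add.commute)
  finally show ?thesis .
qed

text \<open>A constant word has only deterministic transitions, so its maximum likelihood is 1. This
  makes the logarithm of the NML normalizer nonnegative.\<close>

lemma sum_MLk_ge_1:
  assumes "n > 0"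
  shows "1 \<le> (\<Sum>xs\<in>words n. MLk k (xs :: 'a::finite list))"
proof -
  obtain b :: 'a where True by simp
  let ?xs = "replicate n b"
  have ne: "?xs \<noteq> []" using assms by simp
  have zero: "cnt ?xs (u @ [a]) = 0" if "a \<noteq> b" for u a
  proof -
    have "take l (drop i ?xs) \<noteq> u @ [a]" for i l
      using that by (metis (no_types) drop_replicate take_replicate in_set_conv_decomp in_set_replicate)
    then show ?thesis by (simp add: cnt_def)
  qed
  have "ln (MLk k ?xs) = 0"
    unfolding ln_MLk[OF ne]
  proof (intro sum.neutral ballI)
    fix u a
    show "real (cnt ?xs (u @ [a])) * ln (real (cnt ?xs (u @ [a])) / real (cnt (butlast ?xs) u)) = 0"
    proof (cases "a = b")
      case True
      have "cnt (butlast ?xs) u = (\<Sum>a\<in>{b}. cnt ?xs (u @ [a]))"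
        unfolding cnt_butlast[OF ne] by (rule sum.mono_neutral_right) (auto simp: zero)
      then show ?thesis using True by (cases "cnt ?xs (u @ [b]) = 0") auto
    qed (simp add: zero)
  qed
  then have "MLk k ?xs = 1" using MLk_pos[OF ne] by simp
  moreover have "MLk k ?xs \<le> (\<Sum>xs\<in>words n. MLk k (xs :: 'a list))"
  proof (rule member_le_sum[where i = ?xs and f = "MLk k"])
    show "0 \<le> MLk k xs" if "xs \<in> words n - {?xs}" for xs :: "'a list"
      using that assms by (intro less_imp_le MLk_pos) (auto simp: words_def)
    show "?xs \<in> words n" by (simp add: words_def)
  qed simp
  ultimately show ?thesis by simp
qed

lemma NML_penalty:
  assumes A2: "CARD('a::finite) \<ge> 2" and n: "n > 0"
  shows "ln (\<Sum>xs\<in>words n. MLk k (xs :: 'a list)) \<le> 3 * real CARD('a) * real CARD('a) ^ k * sqrt (real n)"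
proof -
  let ?A = "real CARD('a)"
  have "ln (\<Sum>xs\<in>words n. MLk k (xs :: 'a list)) \<le> ln (?A ^ k * (real n + 1) ^ (CARD('a) ^ (k + 1)))"
    using sum_MLk_ge_1[OF n, where 'a = 'a and k = k] sum_MLk_le[OF n, where 'a = 'a and k = k]
    by (intro ln_mono) auto
  also have "\<dots> = real k * ln ?A + ?A ^ (k + 1) * ln (real n + 1)"
    by (simp add: ln_mult ln_realpow add_pos_nonneg)
  also have "real k * ln ?A \<le> ?A * ?A ^ k * sqrt (real n)"
    by (rule order_le_card_power[OF A2 n])
  also have "?A ^ (k + 1) * ln (real n + 1) \<le> ?A ^ (k + 1) * (2 * sqrt (real n))"
    by (intro mult_left_mono ln_Suc_le_sqrt) simp
  finally show ?thesis by (simp add: algebra_simps)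
qed

text \<open>A common two-sided form of the three criteria; \<open>ln 2\<close> converts base-2
  logarithms to natural ones. The threshold \<open>n1\<close> comes from the asymptotic bound on
  \<open>pen\<close> and is 0 for NML and KT.\<close>

lemma criterion_penalty:
  fixes IC :: "nat \<Rightarrow> 'a::finite list \<Rightarrow> real"
  assumes A2: "CARD('a) \<ge> 2"
    and IC: "(IC = PML pen \<and> pen \<in> O(\<lambda>n. sqrt (real n))) \<or> IC = NML \<or> IC = KT"
  obtains B n1 where "B > 0" "\<And>k xs. length xs \<ge> n1 \<Longrightarrow> xs \<noteq> [] \<Longrightarrow>
      \<bar>ln 2 * IC k xs + ln (MLk k xs)\<bar> \<le> B * real CARD('a) ^ k * sqrt (real (length xs))"
  using IC
proof (elim disjE conjE)
  let ?A = "real CARD('a)"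
  assume PML: "IC = PML pen" and "pen \<in> O(\<lambda>n. sqrt (real n))"
  then obtain c where "c > 0" "\<forall>\<^sub>F n in sequentially. norm (pen n) \<le> c * norm (sqrt (real n))"
    by (elim landau_o.bigE)
  then obtain n1 where c: "c > 0" "\<And>n. n \<ge> n1 \<Longrightarrow> \<bar>pen n\<bar> \<le> c * sqrt (real n)"
    unfolding eventually_sequentially by (metis abs_of_nonneg of_nat_0_le_iff real_norm_def real_sqrt_ge_0_iff)
  show ?thesis
  proof (rule that[of "?A * c" n1])
    fix k and xs :: "'a list" assume xs: "length xs \<ge> n1" "xs \<noteq> []"
    have "ln 2 * IC k xs + ln (MLk k xs) = ln 2 * ((?A - 1) * ?A ^ k * pen (length xs))"
      by (simp add: PML PML_def log_def algebra_simps)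
    also have "\<bar>\<dots>\<bar> = ln 2 * (?A - 1) * ?A ^ k * \<bar>pen (length xs)\<bar>"
      using A2 by (simp add: abs_mult)
    also have "\<dots> \<le> ?A * ?A ^ k * (c * sqrt (real (length xs)))"
    proof (intro mult_mono c xs)
      show "ln 2 * (?A - 1) \<le> ?A"
        using mult_mono[of "ln 2 :: real" 1 "?A - 1" ?A] ln_2_less_1 A2 by simp
    qed auto
    finally show "\<bar>ln 2 * IC k xs + ln (MLk k xs)\<bar> \<le> ?A * c * ?A ^ k * sqrt (real (length xs))"
      by (simp add: mult_ac)
  qed (use c in simp)
next
  let ?A = "real CARD('a)"
  assume NML: "IC = NML"
  show ?thesis
  proof (rule that[of "3 * ?A" 0])
    fix k and xs :: "'a list" assume xs: "xs \<noteq> []"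
    let ?S = "\<Sum>ys\<in>words (length xs). MLk k (ys :: 'a list)"
    have "ln 2 * IC k xs + ln (MLk k xs) = ln ?S"
      by (simp add: NML NML_def log_def algebra_simps words_def)
    moreover have "ln ?S \<ge> 0" using sum_MLk_ge_1[of "length xs" k, where 'a = 'a] xs by (intro ln_ge_zero) auto
    moreover have "ln ?S \<le> 3 * ?A * ?A ^ k * sqrt (real (length xs))"
      using xs by (intro NML_penalty A2) auto
    ultimately show "\<bar>ln 2 * IC k xs + ln (MLk k xs)\<bar> \<le> 3 * ?A * ?A ^ k * sqrt (real (length xs))"
      by simp
  qed simp
next
  let ?A = "real CARD('a)"
  assume KT: "IC = KT"
  show ?thesis
  proof (rule that[of "?A + (?A + 1) * (2 * ?A + 8)" 0])
    fix k and xs :: "'a list" assume xs: "xs \<noteq> []"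
    have "ln 2 * IC k xs + ln (MLk k xs) = - (ln (P_KT k xs) - ln (MLk k xs))"
      by (simp add: KT KT_def log_def)
    then show "\<bar>ln 2 * IC k xs + ln (MLk k xs)\<bar> \<le>
        (?A + (?A + 1) * (2 * ?A + 8)) * ?A ^ k * sqrt (real (length xs))"
      using KT_penalty[OF A2 xs, of k] by simp
  qed (auto intro!: add_pos_nonneg)
qed

section \<open>Block probabilities of a stationary process\<close>

definition block_prob :: "'m measure \<Rightarrow> (int \<Rightarrow> 'm \<Rightarrow> 'a) \<Rightarrow> 'a list \<Rightarrow> real" where
  "block_prob M X w = measure M {\<omega>\<in>space M. \<forall>j<length w. X (int j) \<omega> = w ! j}"

locale stationary_process = prob_space M for M :: "'m measure" +
  fixes X :: "int \<Rightarrow> 'm \<Rightarrow> 'a::finite"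
  assumes process: "process M X" and stationary: "stationary M X"
begin

abbreviation "\<mu> \<equiv> block_prob M X"

lemma X_eq_sets [measurable]: "{\<omega>\<in>space M. X i \<omega> = a} \<in> sets M"
proof -
  have "X i -` {a} \<inter> space M \<in> sets M"
    using process by (intro measurable_sets[of _ M "count_space UNIV"]) (auto simp: process_def)
  also have "X i -` {a} \<inter> space M = {\<omega>\<in>space M. X i \<omega> = a}" by auto
  finally show ?thesis .
qed

lemma block_sets: "{\<omega>\<in>space M. \<forall>j<l. X (t + int j) \<omega> = f j} \<in> sets M"
  by (induction l) (auto simp: less_Suc_eq all_conj_distrib imp_conjL conj_disj_distribR
      intro: sets.sets_Collect_conj X_eq_sets)

lemma shift: "measure M {\<omega>\<in>space M. \<forall>j<length w. X (t + int j) \<omega> = w ! j} = \<mu> w"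
  using stationary unfolding stationary_def block_prob_def by metis

text \<open>Splitting over the last letter is plain additivity. Splitting over the first letter
  leaves \<open>u\<close> at time 1, and stationarity moves it back to time 0.\<close>

sublocale block_measure \<mu>
proof
  fix u
  show "0 \<le> \<mu> u" by (simp add: block_prob_def)
  show "\<mu> [] = 1" by (simp add: block_prob_def prob_space)
  let ?E = "\<lambda>t w. {\<omega>\<in>space M. \<forall>j<length w. X (t + int j) \<omega> = w ! j}"
  have "(\<Sum>a\<in>UNIV. \<mu> (u @ [a])) = measure M (\<Union>a\<in>UNIV. ?E 0 (u @ [a]))"
    unfolding shift[where t = 0, symmetric]
    by (rule finite_measure_finite_Union[symmetric])
       (auto simp: disjoint_family_on_def nth_append all_conj_distrib intro!: block_sets)
  also have "(\<Union>a\<in>UNIV. ?E 0 (u @ [a])) = ?E 0 u"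
    by (auto simp: nth_append less_Suc_eq)
  finally show "(\<Sum>a\<in>UNIV. \<mu> (u @ [a])) = \<mu> u" by (simp only: shift)
  have "(\<Sum>a\<in>UNIV. \<mu> (a # u)) = measure M (\<Union>a\<in>UNIV. ?E 0 (a # u))"
    unfolding shift[where t = 0, symmetric]
    by (rule finite_measure_finite_Union[symmetric])
       (auto simp: disjoint_family_on_def All_less_Suc2 intro!: block_sets)
  also have "(\<Union>a\<in>UNIV. ?E 0 (a # u)) = ?E 1 u"
    by (auto simp: nth_Cons All_less_Suc2 add.commute)
  finally show "(\<Sum>a\<in>UNIV. \<mu> (a # u)) = \<mu> u" by (simp only: shift)
qed

lemma sample_eq_iff:
  assumes "length xs = n"
  shows "sample X n \<omega> = xs \<longleftrightarrow> (\<forall>j<n. X (1 + int j) \<omega> = xs ! j)"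
  using assms by (auto simp: sample_def list_eq_iff_nth_eq simp del: upt_Suc)

lemma length_sample: "length (sample X n \<omega>) = n"
  by (simp add: sample_def del: upt_Suc)

lemma sample_in:
  assumes "B \<subseteq> words n"
  shows "{\<omega>\<in>space M. sample X n \<omega> \<in> B} \<in> sets M"
    and "measure M {\<omega>\<in>space M. sample X n \<omega> \<in> B} = (\<Sum>xs\<in>B. \<mu> xs)"
proof -
  have fin: "finite B" using assms finite_subset finite_words by blast
  have eq: "{\<omega>\<in>space M. sample X n \<omega> \<in> B} = (\<Union>xs\<in>B. {\<omega>\<in>space M. \<forall>j<length xs. X (1 + int j) \<omega> = xs ! j})"
    (is "_ = (\<Union>xs\<in>B. ?E xs)")
  proof -
    have "sample X n \<omega> \<in> B \<longleftrightarrow> (\<exists>xs\<in>B. \<forall>j<length xs. X (1 + int j) \<omega> = xs ! j)" for \<omega>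
    proof -
      have "sample X n \<omega> \<in> B \<longleftrightarrow> (\<exists>xs\<in>B. sample X n \<omega> = xs)" by auto
      also have "\<dots> \<longleftrightarrow> (\<exists>xs\<in>B. \<forall>j<length xs. X (1 + int j) \<omega> = xs ! j)"
      proof (rule bex_cong[OF refl])
        fix xs assume "xs \<in> B"
        then have "length xs = n" using assms by (auto simp: words_def)
        then show "sample X n \<omega> = xs \<longleftrightarrow> (\<forall>j<length xs. X (1 + int j) \<omega> = xs ! j)"
          by (simp add: sample_eq_iff)
      qed
      finally show ?thesis .
    qed
    then show ?thesis by auto
  qed
  show "{\<omega>\<in>space M. sample X n \<omega> \<in> B} \<in> sets M"
    unfolding eq using fin by (intro sets.finite_UN block_sets)
  have "disjoint_family_on ?E B"
    unfolding disjoint_family_on_def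
  proof (intro ballI impI)
    fix xs ys assume "xs \<in> B" "ys \<in> B" "xs \<noteq> ys"
    moreover from this have "length xs = n" "length ys = n" using assms by (auto simp: words_def)
    ultimately show "?E xs \<inter> ?E ys = {}" by (auto simp: list_eq_iff_nth_eq)
  qed
  then have "measure M (\<Union>xs\<in>B. ?E xs) = (\<Sum>xs\<in>B. measure M (?E xs))"
    using fin by (intro finite_measure_finite_Union) (auto intro: block_sets)
  then show "measure M {\<omega>\<in>space M. sample X n \<omega> \<in> B} = (\<Sum>xs\<in>B. \<mu> xs)"
    unfolding eq by (simp only: shift)
qed

lemma all_less_rev: "(\<forall>j<k. P (k - 1 - j)) \<longleftrightarrow> (\<forall>j<k. P (j::nat))"
proof safe
  fix j assume *: "\<forall>j<k. P (k - 1 - j)" and j: "j < k"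
  have "P (k - 1 - (k - 1 - j))" using *[rule_format, of "k - 1 - j"] j by linarith
  then show "P j" using j by simp
qed auto

text \<open>Pasts are indexed backwards in time and words forwards, hence the reversal and the shift
  to time \<open>- k\<close>.\<close>

lemma blockP_eq: "blockP M X k y = \<mu> (rev (map y [0..<k]))"
proof -
  let ?w = "rev (map y [0..<k])"
  have "(\<forall>j<length ?w. X (- int k + int j) \<omega> = ?w ! j) \<longleftrightarrow> (\<forall>j<k. X (- (int j + 1)) \<omega> = y j)" for \<omega>
  proof -
    have "(\<forall>j<length ?w. X (- int k + int j) \<omega> = ?w ! j) \<longleftrightarrow>
        (\<forall>j<k. X (- (int (k - 1 - j) + 1)) \<omega> = y (k - 1 - j))"
      by (auto simp: rev_nth of_nat_diff)
    also have "\<dots> \<longleftrightarrow> (\<forall>j<k. X (- (int j + 1)) \<omega> = y j)"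
      by (rule all_less_rev)
    finally show ?thesis .
  qed
  then show ?thesis
    using shift[of ?w "- int k"] by (simp only: blockP_def)
qed

lemma condk_eq: "condk M X k y a = kernel (rev (map y [0..<k])) a"
proof -
  let ?u = "rev (map y [0..<k])" let ?w = "?u @ [a]"
  have "(\<forall>j<length ?w. X (- int k + int j) \<omega> = ?w ! j) \<longleftrightarrow>
      X 0 \<omega> = a \<and> (\<forall>j<k. X (- (int j + 1)) \<omega> = y j)" for \<omega>
  proof -
    have "(\<forall>j<length ?w. X (- int k + int j) \<omega> = ?w ! j) \<longleftrightarrow>
        X 0 \<omega> = a \<and> (\<forall>j<k. X (- (int (k - 1 - j) + 1)) \<omega> = y (k - 1 - j))"
      by (auto simp: nth_append less_Suc_eq rev_nth of_nat_diff)
    also have "(\<forall>j<k. X (- (int (k - 1 - j) + 1)) \<omega> = y (k - 1 - j)) \<longleftrightarrow> (\<forall>j<k. X (- (int j + 1)) \<omega> = y j)"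
      by (rule all_less_rev)
    finally show ?thesis .
  qed
  then show ?thesis
    using shift[of ?w "- int k"] by (simp only: condk_def kernel_def blockP_eq)
qed

text \<open>By \<open>\<mu>_Cons\<close> a word of positive probability has a left extension by one
  letter of positive probability; iterating gives an infinite past. Through this the rates, which
  range over \<open>past_support\<close>, reach the kernel of every word of positive
  probability.\<close>

lemma past_support_extension:
  assumes "\<mu> w > 0"
  obtains y where "y \<in> past_support M X" "rev (map y [0..<length w]) = w"
proof -
  have ext: "\<exists>a. \<mu> (a # u) > 0" if "\<mu> u > 0" for u
  proof (rule ccontr)
    assume "\<not> ?thesis"
    then have "(\<Sum>a\<in>UNIV. \<mu> (a # u)) \<le> 0" by (intro sum_nonpos) (auto simp: not_less)
    then show False using that by (simp add: \<mu>_Cons)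
  qed
  define next_past where "next_past u = (SOME a. \<mu> (a # u) > 0) # u" for u
  define ws where "ws n = (next_past ^^ n) w" for n
  have pos: "\<mu> (ws n) > 0" for n
    by (induction n) (auto simp: ws_def next_past_def assms intro: someI_ex[OF ext])
  have len: "length (ws n) = length w + n" for n
    by (induction n) (auto simp: ws_def next_past_def)
  have suf: "suffix (ws n) (ws (n + i))" for n i
    by (induction i) (auto simp: ws_def next_past_def intro: suffix_ConsI)
  have agree: "rev (ws n) ! j = rev (ws m) ! j" if "j < length (ws n)" "n \<le> m" for n m j
  proof -
    obtain z where "ws m = z @ ws n" using suf[of n "m - n"] \<open>n \<le> m\<close> by (auto simp: suffix_def)
    then show ?thesis using that by (simp add: nth_append)
  qed
  \<comment> \<open>Stage \<open>Suc j\<close> has more than \<open>j\<close> letters, so the letter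
    read here is already final.\<close>
  define y where "y j = rev (ws (Suc j)) ! j" for j
  have y: "map y [0..<k] = take k (rev (ws n))" if "k \<le> length (ws n)" for k n
  proof (rule nth_equalityI)
    fix j assume "j < length (map y [0..<k])"
    then have j: "j < k" by simp
    have "rev (ws (Suc j)) ! j = rev (ws n) ! j"
    proof (cases "Suc j \<le> n")
      case True
      then show ?thesis by (intro agree) (simp_all add: len)
    next
      case False
      then show ?thesis using j that by (intro agree[symmetric]) simp_all
    qed
    then show "map y [0..<k] ! j = take k (rev (ws n)) ! j" using j by (simp add: y_def)
  qed (use that in simp)
  have "rev (map y [0..<length w]) = w"
    using y[of "length w" 0] by (simp add: ws_def)
  moreover have "y \<in> past_support M X"
    unfolding past_support_def
  proof safe
    fix k
    have "rev (map y [0..<k]) = drop (length (ws k) - k) (ws k)"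
      using y[of k k] by (simp add: len take_rev)
    moreover have "\<mu> (ws k) \<le> \<mu> (drop (length (ws k) - k) (ws k))"
      using \<mu>_suffix_le[of "take (length (ws k) - k) (ws k)" "drop (length (ws k) - k) (ws k)"] by simp
    ultimately show "0 < blockP M X k y" using pos[of k] by (simp add: blockP_eq)
  qed
  ultimately show ?thesis using that by blast
qed

lemma past_suffix:
  assumes "rev (map y [0..<length (u @ w)]) = u @ w"
  shows "rev (map y [0..<length w]) = w"
proof -
  have "[0..<length (u @ w)] = [0..<length w] @ [length w..<length (u @ w)]"
    using upt_add_eq_append[of 0 "length w" "length u"] by (simp add: add.commute)
  then show ?thesis using assms by simp
qed

end

section \<open>From continuity rates to kernels of finite words\<close>

locale continuous_process = stationary_process M X
  for M :: "'m measure" and X :: "int \<Rightarrow> 'm \<Rightarrow> 'a::finite" +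
  fixes p :: "(nat \<Rightarrow> 'a) \<Rightarrow> 'a \<Rightarrow> real" and \<beta> \<alpha> :: "nat \<Rightarrow> real"
  assumes p: "0 \<le> p y a" "(\<Sum>a\<in>UNIV. p y a) = 1"
    and non_null: "weakly_non_null M X p"
    and gamma_up_le: "gamma_up M X p k \<le> \<beta> k" and gamma_low_ge: "\<alpha> k \<le> gamma_low M X p k"
    and \<beta>_antimono: "\<beta> (Suc k) \<le> \<beta> k" and \<beta>_nonneg: "0 \<le> \<beta> k" and \<beta>_summable: "summable \<beta>"
begin

lemma p_le_1: "p y a \<le> 1"
  unfolding p(2)[of y, symmetric] by (rule member_le_sum) (auto simp: p)

lemma deviation_le_\<beta>:
  assumes y: "y \<in> past_support M X"
  shows "(\<Sum>a\<in>UNIV. \<bar>kernel (rev (map y [0..<k])) a - p y a\<bar>) \<le> \<beta> k"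
proof -
  have "(\<Sum>a\<in>UNIV. \<bar>condk M X k y a - p y a\<bar>) \<le> gamma_up M X p k"
    unfolding gamma_up_def
  proof (rule cSUP_upper[OF y])
    \<comment> \<open>A real supremum dominates its members only for a bounded family; two weight
      vectors of mass at most 1 differ by at most 2.\<close>
    show "bdd_above ((\<lambda>y. \<Sum>a\<in>UNIV. \<bar>condk M X k y a - p y a\<bar>) ` past_support M X)"
    proof (rule bdd_aboveI2)
      fix z
      have "(\<Sum>a\<in>UNIV. \<bar>condk M X k z a - p z a\<bar>) \<le> (\<Sum>a\<in>UNIV. condk M X k z a + p z a)"
        by (intro sum_mono) (auto simp: condk_eq abs_le_iff intro: add_increasing add_increasing2 kernel_nonneg p
            order_trans[OF _ add_increasing2])
      also have "\<dots> \<le> 2" using kernel_sum_le by (simp add: sum.distrib p condk_eq)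
      finally show "(\<Sum>a\<in>UNIV. \<bar>condk M X k z a - p z a\<bar>) \<le> 2" .
    qed
  qed
  then show ?thesis using gamma_up_le[of k] by (simp add: condk_eq)
qed

lemma deviation_ge_\<alpha>:
  assumes y: "y \<in> past_support M X"
  shows "\<alpha> k \<le> (\<Sum>a\<in>UNIV. \<bar>kernel (rev (map y [0..<k])) a - p y a\<bar>)"
proof -
  have "gamma_low M X p k \<le> (\<Sum>a\<in>UNIV. \<bar>condk M X k y a - p y a\<bar>)"
    unfolding gamma_low_def
    by (rule cINF_lower[OF _ y]) (auto intro!: bdd_belowI2[where m = 0] sum_nonneg)
  then show ?thesis using gamma_low_ge[of k] by (simp add: condk_eq)
qed

lemma \<beta>_antimono': "i \<le> j \<Longrightarrow> \<beta> j \<le> \<beta> i"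
  using \<beta>_antimono by (rule lift_Suc_antimono_le)

text \<open>The infimum of \<open>p\<close> controls \<open>kernel w\<close> only up to
  \<open>\<beta> (length w)\<close>, which may be useless for short \<open>w\<close>. But
  \<open>kernel w\<close> is an average of kernels of the longer words \<open>v @ w\<close>, whose
  error tends to 0 as \<open>v\<close> grows.\<close>

lemma non_null_letter:
  obtains a \<theta> where "\<theta> > 0" "\<theta> \<le> 1" "\<And>w. \<mu> w > 0 \<Longrightarrow> \<theta> \<le> kernel w a"
proof -
  let ?\<theta> = "\<lambda>a. INF y \<in> past_support M X. p y a"
  obtain a where \<theta>: "?\<theta> a > 0"
  proof (rule ccontr)
    assume "\<not> thesis"
    then have "(\<Sum>a\<in>UNIV. ?\<theta> a) \<le> 0" using that by (intro sum_nonpos) (meson not_less)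
    then show False using non_null by (simp add: weakly_non_null_def)
  qed
  have \<theta>_le: "?\<theta> a \<le> p y a" if "y \<in> past_support M X" for y
    by (rule cINF_lower[OF _ that]) (auto intro!: bdd_belowI2[where m = 0] p)
  have long: "?\<theta> a - \<beta> (length w) \<le> kernel w a" if pos: "\<mu> w > 0" for w
  proof -
    obtain y where y: "y \<in> past_support M X" "rev (map y [0..<length w]) = w"
      using past_support_extension[OF pos] .
    have "\<bar>kernel w a - p y a\<bar> \<le> (\<Sum>a\<in>UNIV. \<bar>kernel w a - p y a\<bar>)"
      by (rule member_le_sum) auto
    also have "\<dots> \<le> \<beta> (length w)" using deviation_le_\<beta>[OF y(1), of "length w"] by (simp add: y(2))
    finally show ?thesis using \<theta>_le[OF y(1)] by linarith
  qed
  have "?\<theta> a \<le> kernel w a" if w: "\<mu> w > 0" for w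
  proof -
    have "?\<theta> a - \<beta> j \<le> kernel w a" for j
    proof -
      have "\<mu> w * (?\<theta> a - \<beta> j) = (\<Sum>v\<in>words j. \<mu> (v @ w) * (?\<theta> a - \<beta> j))"
        by (simp add: sum_distrib_right[symmetric] sum_\<mu>_prefix)
      also have "\<dots> \<le> (\<Sum>v\<in>words j. \<mu> (v @ w) * kernel (v @ w) a)"
      proof (rule sum_mono)
        fix v :: "'a list" assume "v \<in> words j"
        then have "\<beta> (length (v @ w)) \<le> \<beta> j" by (intro \<beta>_antimono') (simp add: words_def)
        then show "\<mu> (v @ w) * (?\<theta> a - \<beta> j) \<le> \<mu> (v @ w) * kernel (v @ w) a"
          using long[of "v @ w"] \<mu>_nonneg[of "v @ w"]
          by (cases "\<mu> (v @ w) = 0") (auto intro!: mult_left_mono)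
      qed
      also have "\<dots> = \<mu> w * kernel w a"
        using sum_\<mu>_prefix[where n = j and u = "w @ [a]"] by (simp add: \<mu>_mult_kernel)
      finally show ?thesis using w by simp
    qed
    moreover have "(\<lambda>j. ?\<theta> a - \<beta> j) \<longlonglongrightarrow> ?\<theta> a - 0"
      by (intro tendsto_intros summable_LIMSEQ_zero \<beta>_summable)
    ultimately show ?thesis by (intro LIMSEQ_le_const2[where X = "\<lambda>j. ?\<theta> a - \<beta> j"]) auto
  qed
  moreover have "?\<theta> a \<le> 1"
  proof -
    obtain y where "y \<in> past_support M X"
      using past_support_extension[of "[]"] by (auto simp: \<mu>_Nil)
    then show ?thesis using \<theta>_le[of y] p_le_1[of y a] by linarith
  qed
  ultimately show ?thesis using that \<theta> by blast
qed

text \<open>One infinite past \<open>y\<close> extends both \<open>u @ w\<close> and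
  \<open>w\<close>, so both kernels are compared with the same \<open>p y\<close> and the triangle
  inequality gives both bounds.\<close>

lemma kernel_suffix_dist:
  assumes "\<mu> (u @ w) > 0"
  shows "(\<Sum>a\<in>UNIV. \<bar>kernel (u @ w) a - kernel w a\<bar>) \<le> 2 * \<beta> (length w)"
    and "\<alpha> (length w) - \<beta> (length (u @ w)) \<le> (\<Sum>a\<in>UNIV. \<bar>kernel (u @ w) a - kernel w a\<bar>)"
proof -
  obtain y where y: "y \<in> past_support M X" "rev (map y [0..<length (u @ w)]) = u @ w"
    using past_support_extension[OF assms] .
  have y': "rev (map y [0..<length w]) = w" using past_suffix[OF y(2)] .
  have 1: "(\<Sum>a\<in>UNIV. \<bar>kernel (u @ w) a - p y a\<bar>) \<le> \<beta> (length (u @ w))"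
    using deviation_le_\<beta>[OF y(1), of "length (u @ w)"] unfolding y(2) .
  have 2: "(\<Sum>a\<in>UNIV. \<bar>kernel w a - p y a\<bar>) \<le> \<beta> (length w)"
    using deviation_le_\<beta>[OF y(1), of "length w"] unfolding y' .
  have 3: "\<alpha> (length w) \<le> (\<Sum>a\<in>UNIV. \<bar>kernel w a - p y a\<bar>)"
    using deviation_ge_\<alpha>[OF y(1), of "length w"] unfolding y' .
  have "(\<Sum>a\<in>UNIV. \<bar>kernel (u @ w) a - kernel w a\<bar>) \<le>
      (\<Sum>a\<in>UNIV. \<bar>kernel (u @ w) a - p y a\<bar> + \<bar>kernel w a - p y a\<bar>)"
    by (rule sum_mono) linarith
  moreover have "\<beta> (length (u @ w)) \<le> \<beta> (length w)" by (rule \<beta>_antimono') simp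
  ultimately show "(\<Sum>a\<in>UNIV. \<bar>kernel (u @ w) a - kernel w a\<bar>) \<le> 2 * \<beta> (length w)"
    using 1 2 by (simp add: sum.distrib)
  have "(\<Sum>a\<in>UNIV. \<bar>kernel w a - p y a\<bar>) \<le>
      (\<Sum>a\<in>UNIV. \<bar>kernel (u @ w) a - kernel w a\<bar> + \<bar>kernel (u @ w) a - p y a\<bar>)"
    by (rule sum_mono) linarith
  then show "\<alpha> (length w) - \<beta> (length (u @ w)) \<le> (\<Sum>a\<in>UNIV. \<bar>kernel (u @ w) a - kernel w a\<bar>)"
    using 1 3 by (simp add: sum.distrib)
qed

lemma mixing: obtains \<eta> where "mixing_block_measure \<mu> \<eta>"
proof -
  obtain a0 \<theta> where \<theta>: "\<theta> > 0" "\<theta> \<le> 1" "\<And>w. \<mu> w > 0 \<Longrightarrow> \<theta> \<le> kernel w a0"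
    using non_null_letter by metis
  \<comment> \<open>The letter \<open>a0\<close> alone gives overlap \<open>\<theta>\<close>, which
    keeps \<open>\<eta>\<close> below 1. The second term is half the l1 distance of the two kernels,
    each being within \<open>2 * \<beta> j\<close> of the kernel of the common suffix.\<close>
  define \<eta> where "\<eta> j = min (1 - \<theta>) (2 * \<beta> j)" for j
  have "mixing_block_measure \<mu> \<eta>"
  proof
    fix j
    show "0 \<le> \<eta> j" using \<theta> \<beta>_nonneg by (simp add: \<eta>_def)
    show "\<eta> j < 1" using \<theta> by (simp add: \<eta>_def)
    show "\<eta> (Suc j) \<le> \<eta> j" using \<beta>_antimono[of j] by (auto simp: \<eta>_def)
    have "summable (\<lambda>j. 2 * \<beta> j)" by (intro summable_mult \<beta>_summable)
    then show "summable \<eta>"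
      by (rule summable_comparison_test'[where N = 0]) (use \<theta> \<beta>_nonneg in \<open>auto simp: \<eta>_def\<close>)
  next
    fix u w v assume pos: "\<mu> (u @ w) > 0" "\<mu> (v @ w) > 0"
    let ?q = "kernel (u @ w)" and ?r = "kernel (v @ w)"
    have "\<theta> \<le> min (?q a0) (?r a0)" using \<theta>(3) pos by simp
    also have "\<dots> \<le> (\<Sum>a\<in>UNIV. min (?q a) (?r a))"
      by (rule member_le_sum) (auto simp: kernel_nonneg)
    finally have "\<theta> \<le> (\<Sum>a\<in>UNIV. min (?q a) (?r a))" .
    moreover have "1 - 2 * \<beta> (length w) \<le> (\<Sum>a\<in>UNIV. min (?q a) (?r a))"
    proof -
      have "(\<Sum>a\<in>UNIV. \<bar>?q a - ?r a\<bar>) \<le> (\<Sum>a\<in>UNIV. \<bar>?q a - kernel w a\<bar> + \<bar>?r a - kernel w a\<bar>)"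
        by (rule sum_mono) linarith
      also have "\<dots> \<le> 4 * \<beta> (length w)"
        using kernel_suffix_dist(1)[OF pos(1)] kernel_suffix_dist(1)[OF pos(2)] by (simp add: sum.distrib)
      finally have "(\<Sum>a\<in>UNIV. \<bar>?q a - ?r a\<bar>) \<le> 4 * \<beta> (length w)" .
      moreover have "(\<Sum>a\<in>UNIV. min (?q a) (?r a)) = (\<Sum>a\<in>UNIV. (?q a + ?r a - \<bar>?q a - ?r a\<bar>) / 2)"
        by (rule sum.cong) (auto simp: min_def abs_if)
      moreover have "\<dots> = 1 - (\<Sum>a\<in>UNIV. \<bar>?q a - ?r a\<bar>) / 2"
        using pos by (simp add: sum_divide_distrib[symmetric] sum_subtractf sum.distrib kernel_sum diff_divide_distrib)
      ultimately show ?thesis by linarith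
    qed
    ultimately show "1 - \<eta> (length w) \<le> (\<Sum>a\<in>UNIV. min (?q a) (?r a))"
      by (auto simp: \<eta>_def min_def)
  qed
  then show ?thesis by (rule that)
qed

end

section \<open>Underestimation\<close>

text \<open>A union bound over at most \<open>m * |A| ^ m\<close> words; length \<open>m\<close> has
  the weakest exponent.\<close>

lemma (in mixing_block_measure) cnt_concentration_uniform:
  obtains K where "K > 0"
    "\<And>m n e. n > 0 \<Longrightarrow> e \<ge> 0 \<Longrightarrow>
      (\<Sum>x\<in>{x\<in>words n. \<exists>z. z \<noteq> [] \<and> length z \<le> m \<and> e + real (length z) \<le> \<bar>real (cnt x z) - real n * \<mu> z\<bar>}. \<mu> x)
        \<le> 2 * real m * real CARD('a) ^ m * exp (- e\<^sup>2 / (real n * (K * real m)\<^sup>2))"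
proof -
  obtain K where K: "K > 0" "\<And>w n e. w \<noteq> [] \<Longrightarrow> n > 0 \<Longrightarrow> e \<ge> 0 \<Longrightarrow>
      (\<Sum>x\<in>{x\<in>words n. \<bar>real (cnt x w) - real n * \<mu> w\<bar> \<ge> e + real (length w)}. \<mu> x)
        \<le> 2 * exp (- e\<^sup>2 / (real n * (K * real (length w))\<^sup>2))"
    using cnt_concentration by blast
  show ?thesis
  proof (rule that[OF K(1)])
    fix m n :: nat and e :: real assume n: "n > 0" and e: "e \<ge> 0"
    let ?Z = "\<Union>l\<in>{1..m}. words l :: 'a list set"
    let ?bad = "\<lambda>z x. e + real (length z) \<le> \<bar>real (cnt x z) - real n * \<mu> z\<bar>"
    let ?E = "exp (- e\<^sup>2 / (real n * (K * real m)\<^sup>2))"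
    have Z: "z \<in> ?Z \<longleftrightarrow> z \<noteq> [] \<and> length z \<le> m" for z
      by (auto simp: words_def Suc_le_eq)
    have finZ: "finite ?Z" by simp
    have "card ?Z \<le> (\<Sum>l\<in>{1..m}. card (words l :: 'a list set))" by (rule card_UN_le) simp
    also have "\<dots> \<le> (\<Sum>l\<in>{1..m}. CARD('a) ^ m)"
      by (rule sum_mono) (auto simp: card_words Suc_leI intro: power_increasing)
    finally have cardZ: "card ?Z \<le> m * CARD('a) ^ m" by simp
    have "(\<Sum>x\<in>{x\<in>words n. \<exists>z. z \<noteq> [] \<and> length z \<le> m \<and> ?bad z x}. \<mu> x) \<le>
        (\<Sum>x\<in>{x\<in>words n. \<exists>z. z \<noteq> [] \<and> length z \<le> m \<and> ?bad z x}. \<Sum>z\<in>?Z. if ?bad z x then \<mu> x else 0)"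
    proof (rule sum_mono)
      fix x assume "x \<in> {x\<in>words n. \<exists>z. z \<noteq> [] \<and> length z \<le> m \<and> ?bad z x}"
      then obtain z where z: "z \<in> ?Z" "?bad z x" using Z by blast
      have "(if ?bad z x then \<mu> x else 0) \<le> (\<Sum>z\<in>?Z. if ?bad z x then \<mu> x else 0)"
        by (rule member_le_sum[where f = "\<lambda>z. if ?bad z x then \<mu> x else 0", OF z(1) _ finZ]) (simp add: \<mu>_nonneg)
      then show "\<mu> x \<le> (\<Sum>z\<in>?Z. if ?bad z x then \<mu> x else 0)" using z(2) by simp
    qed
    also have "\<dots> \<le> (\<Sum>x\<in>words n. \<Sum>z\<in>?Z. if ?bad z x then \<mu> x else 0)"
      by (rule sum_mono2) (auto intro!: sum_nonneg simp: \<mu>_nonneg)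
    also have "\<dots> = (\<Sum>z\<in>?Z. \<Sum>x\<in>words n. if ?bad z x then \<mu> x else 0)" by (rule sum.swap)
    also have "\<dots> = (\<Sum>z\<in>?Z. \<Sum>x\<in>{x\<in>words n. ?bad z x}. \<mu> x)"
      by (rule sum.cong[OF refl], rule sum.inter_filter[symmetric]) simp
    also have "\<dots> \<le> (\<Sum>z\<in>?Z. 2 * ?E)"
    proof (rule sum_mono)
      fix z assume "z \<in> ?Z"
      then have z: "z \<noteq> []" "length z \<le> m" using Z by auto
      have "(\<Sum>x\<in>{x\<in>words n. ?bad z x}. \<mu> x) \<le> 2 * exp (- e\<^sup>2 / (real n * (K * real (length z))\<^sup>2))"
        by (rule K(2)) fact+
      also have "\<dots> \<le> 2 * ?E"
      proof -
        have "real n * (K * real (length z))\<^sup>2 \<le> real n * (K * real m)\<^sup>2"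
          using z K(1) by (intro mult_left_mono power_mono) auto
        moreover have "real n * (K * real (length z))\<^sup>2 > 0" using z n K(1) by simp
        ultimately show ?thesis by (simp add: frac_le)
      qed
      finally show "(\<Sum>x\<in>{x\<in>words n. ?bad z x}. \<mu> x) \<le> 2 * ?E" .
    qed
    also have "\<dots> = real (card ?Z) * (2 * ?E)" by simp
    also have "\<dots> \<le> real (m * CARD('a) ^ m) * (2 * ?E)"
      using cardZ by (intro mult_right_mono of_nat_mono) auto
    finally show "(\<Sum>x\<in>{x\<in>words n. \<exists>z. z \<noteq> [] \<and> length z \<le> m \<and> ?bad z x}. \<mu> x)
        \<le> 2 * real m * real CARD('a) ^ m * ?E" by (simp add: mult_ac)
  qed
qed

lemma khat_minimal:
  assumes "xs \<noteq> []"
  shows "khat IC xs < length xs" "j < length xs \<Longrightarrow> IC (khat IC xs) xs \<le> IC j xs"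
proof -
  have "\<exists>k. k < length xs \<and> (\<forall>j<length xs. IC k xs \<le> IC j xs)"
    using assms ex_is_arg_min_if_finite[of "{..<length xs}" "\<lambda>k. IC k xs"]
    by (auto simp: is_arg_min_linorder)
  from LeastI_ex[OF this] show "khat IC xs < length xs" "j < length xs \<Longrightarrow> IC (khat IC xs) xs \<le> IC j xs"
    by (auto simp: khat_def)
qed

text \<open>The exponent grows like \<open>n\<close> to the power
  \<open>2 * 7/10 - 1 - 2/48 = 43/120\<close>, which exceeds 1/4 and also outweighs the polynomial
  prefactor.\<close>

lemma tail_negligible:
  fixes A D K :: real
  assumes "A > 0" "D > 0" "K > 0"
  shows "\<forall>\<^sub>F n::nat in sequentially. 2 * (D * real n powr (1/48)) * (A * (D * real n powr (1/48))) *
    exp (- (real n powr (7/10))\<^sup>2 / (real n * (K * (D * real n powr (1/48)))\<^sup>2)) \<le> exp (- (real n powr (1/4)))"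
  using assms by real_asymp

text \<open>Here \<open>1/48 + 7/10 = 173/240\<close> is below \<open>3/4\<close>.\<close>

lemma error_negligible:
  fixes A D d :: real
  assumes "A > 0" "D > 0" "d > 0"
  shows "\<forall>\<^sub>F n::nat in sequentially. 4 * (A * (D * real n powr (1/48))) * (real n powr (7/10) + D * real n powr (1/48))
    \<le> d / 4 * real n powr (3/4)"
  using assms by real_asymp

lemma penalty_negligible:
  fixes B c e :: real
  assumes "B > 0" "c > 0" "e > 0"
  shows "\<forall>\<^sub>F n::nat in sequentially. B * real n powr (e / 24) < c * real n powr e"
  using assms by real_asymp

lemma order_negligible:
  fixes D :: real
  assumes "D > 0"
  shows "\<forall>\<^sub>F n::nat in sequentially. D * real n powr (1/48) < real n"
  using assms by real_asymp

theorem theorem4p7: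
  fixes M :: "'m measure" and X :: "int \<Rightarrow> 'm \<Rightarrow> 'a::finite"
    and p :: "(nat \<Rightarrow> 'a) \<Rightarrow> 'a \<Rightarrow> real"
    and IC :: "nat \<Rightarrow> 'a list \<Rightarrow> real" and pen :: "nat \<Rightarrow> real"
    and \<zeta>1 \<zeta>2 \<delta>1 \<delta>2 :: real
  assumes "prob_space M"
    and "CARD('a) \<ge> 2"
    and "process M X" and "stationary M X" and "ergodic M X"
    and "cond_prob_past M X p"
    and "weakly_non_null M X p"
    and "\<zeta>1 > 0" and "\<zeta>2 > 0" and "\<delta>1 > 0" and "\<delta>2 > 0" and "\<zeta>2 \<ge> \<zeta>1"
    and "\<forall>k. gamma_up M X p k \<le> \<delta>1 * 2 powr (- \<zeta>1 * real k)"
    and "\<forall>k. gamma_low M X p k \<ge> \<delta>2 * 2 powr (- \<zeta>2 * real k)"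
    and "(IC = PML pen \<and> mono pen \<and> pen \<in> O(\<lambda>n. sqrt (real n))) \<or> IC = NML \<or> IC = KT"
  shows "\<exists>c2 > 0. \<exists>c3::real. \<exists>n0::nat. n0 > 0 \<and>
           (\<forall>\<epsilon>::real. \<forall>n::nat.
              6 * log 2 (real CARD('a)) / \<zeta>1 \<le> \<epsilon> \<and> \<epsilon> < 1/2 \<and> n \<ge> n0 \<longrightarrow>
              measure M {\<omega>\<in>space M. real (khat IC (sample X n \<omega>))
                    \<le> 1 / (2 * \<zeta>2) * (1/2 - \<epsilon>) * log 2 (real n) - c3}
                \<le> exp (- (c2 * \<epsilon> ^ 3 / log 2 (real n)) * real n powr (\<epsilon> / 2)))"
proof -
  let ?A = "real CARD('a)"
  define r where "r = log 2 ?A"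
  define \<epsilon>0 where "\<epsilon>0 = 6 * r / \<zeta>1"
  have A2: "?A \<ge> 2" using assms(2) by simp
  have r: "r > 0" using A2 by (simp add: r_def)
  have \<epsilon>0: "\<epsilon>0 > 0" using r assms(8) by (simp add: \<epsilon>0_def)
  show ?thesis
  proof (cases "\<epsilon>0 < 1/2")
    \<comment> \<open>No \<open>\<epsilon>\<close> satisfies both bounds, so any constants
      do.\<close>
    case False
    then show ?thesis by (intro exI[of _ 1] exI[of _ 0] conjI) (auto simp: \<epsilon>0_def r_def)
  next
    case True
    define \<alpha> where "\<alpha> k = \<delta>2 * 2 powr (- \<zeta>2 * real k)" for k
    define \<beta> where "\<beta> k = \<delta>1 * 2 powr (- \<zeta>1 * real k)" for k
    interpret stationary_process M X
      using assms(1,3,4) by (simp add: stationary_process_def stationary_process_axioms_def)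
    interpret continuous_process M X p \<beta> \<alpha>
    proof
      fix y a k
      show "0 \<le> p y a" "(\<Sum>a\<in>UNIV. p y a) = 1"
        using assms(6) by (auto simp: cond_prob_past_def)
      show "weakly_non_null M X p" by fact
      show "gamma_up M X p k \<le> \<beta> k" "\<alpha> k \<le> gamma_low M X p k"
        using assms(13,14) by (simp_all add: \<beta>_def \<alpha>_def)
      show "\<beta> (Suc k) \<le> \<beta> k" "0 \<le> \<beta> k" using assms(8,10) by (simp_all add: \<beta>_def)
      have "\<beta> = (\<lambda>k. \<delta>1 * (2 powr (- \<zeta>1)) ^ k)"
        by (rule ext) (simp add: \<beta>_def powr_realpow[symmetric] powr_powr)
      moreover have "2 powr (- \<zeta>1) < 1" using powr_less_mono[of "- \<zeta>1" 0 2] assms(8) by simp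
      ultimately show "summable \<beta>" by (simp only:) (intro summable_mult summable_geometric, simp)
    qed
    obtain \<eta> where "mixing_block_measure \<mu> \<eta>" using mixing .
    then interpret mixing_block_measure \<mu> \<eta> .
    obtain K where K: "K > 0" "\<And>m n e. n > 0 \<Longrightarrow> e \<ge> 0 \<Longrightarrow>
      (\<Sum>x\<in>{x\<in>words n. \<exists>z. z \<noteq> [] \<and> length z \<le> m \<and> e + real (length z) \<le> \<bar>real (cnt x z) - real n * \<mu> z\<bar>}. \<mu> x)
        \<le> 2 * real m * ?A ^ m * exp (- e\<^sup>2 / (real n * (K * real m)\<^sup>2))"
      using cnt_concentration_uniform by blast
    have IC: "(IC = PML pen \<and> pen \<in> O(\<lambda>n. sqrt (real n))) \<or> IC = NML \<or> IC = KT"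
      using assms(15) by blast
    obtain B n1 where B: "B > 0" "\<And>k xs. length xs \<ge> n1 \<Longrightarrow> xs \<noteq> [] \<Longrightarrow>
        \<bar>ln 2 * IC k xs + ln (MLk k xs)\<bar> \<le> B * ?A ^ k * sqrt (real (length xs))"
      using criterion_penalty[OF assms(2) IC] by blast
    \<comment> \<open>The offset that turns \<open>\<zeta>1 * m \<ge> \<zeta>2 * k + b\<close> into
      \<open>\<beta> m \<le> \<alpha> k / 2\<close>.\<close>
    define b where "b = max 0 (log 2 (2 * \<delta>1 / \<delta>2))"
    \<comment> \<open>The final \<open>+ 1\<close> makes \<open>k < m n\<close> strict. Together
      with the rounding it accounts for the 2 in the exponent of \<open>D\<close>.\<close>
    define m where "m n = nat \<lceil>(log 2 (real n) / 4 + b) / \<zeta>1\<rceil> + 1" for n :: nat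
    define D where "D = ?A powr (b / \<zeta>1 + 2)"
    define x where "x n = D * real n powr (1/48)" for n :: nat
    have D: "D > 0" using A2 by (simp add: D_def)
    \<comment> \<open>All requirements on \<open>n\<close> involve \<open>\<epsilon>0\<close> at
      most, never \<open>\<epsilon>\<close>, so that one \<open>n0\<close> serves every admissible
      \<open>\<epsilon>\<close>.\<close>
    define P where "P n \<longleftrightarrow> n \<ge> 2 \<and> n \<ge> n1 \<and>
      2 * x n * (?A * x n) * exp (- (real n powr (7/10))\<^sup>2 / (real n * (K * x n)\<^sup>2)) \<le> exp (- (real n powr (1/4))) \<and>
      4 * (?A * x n) * (real n powr (7/10) + x n) \<le> \<delta>2 / 4 * real n powr (3/4) \<and>
      (2 * B * D) * real n powr (\<epsilon>0 / 24) < (\<delta>2\<^sup>2 / 64) * real n powr \<epsilon>0 \<and> x n < real n" for n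
    have "eventually P sequentially"
      unfolding P_def x_def
      by (intro eventually_conj eventually_ge_at_top tail_negligible error_negligible penalty_negligible
          order_negligible) (use A2 D K(1) B(1) \<epsilon>0 assms(11) in simp_all)
    then obtain n0 where n0: "\<And>n. n \<ge> n0 \<Longrightarrow> P n" by (auto simp: eventually_sequentially)
    \<comment> \<open>The constants are \<open>c2 = 1\<close> and \<open>c3 = 0\<close>.\<close>
    have "measure M {\<omega>\<in>space M. real (khat IC (sample X n \<omega>)) \<le> 1 / (2 * \<zeta>2) * (1/2 - \<epsilon>) * log 2 (real n)}
        \<le> exp (- (\<epsilon> ^ 3 / log 2 (real n)) * real n powr (\<epsilon> / 2))"
      if \<epsilon>: "\<epsilon>0 \<le> \<epsilon>" "\<epsilon> < 1/2" and "n \<ge> n0" for n \<epsilon>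
    proof -
      have "P n" using n0 that by simp
      then have n: "n \<ge> 2" "n \<ge> n1"
        and tail: "2 * x n * (?A * x n) * exp (- (real n powr (7/10))\<^sup>2 / (real n * (K * x n)\<^sup>2)) \<le> exp (- (real n powr (1/4)))"
        and err: "4 * (?A * x n) * (real n powr (7/10) + x n) \<le> \<delta>2 / 4 * real n powr (3/4)"
        and pnl: "(2 * B * D) * real n powr (\<epsilon>0 / 24) < (\<delta>2\<^sup>2 / 64) * real n powr \<epsilon>0"
        and xn: "x n < real n"
        by (simp_all add: P_def)
      define L where "L = log 2 (real n)"
      have L: "L \<ge> 1" using n(1) by (simp add: L_def le_log_iff)
      have n_powr: "real n powr t = 2 powr (L * t)" for t
        using n(1) by (simp add: L_def powr_powr[symmetric])
      have m_lower: "(L / 4 + b) / \<zeta>1 \<le> real (m n) - 1"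
        by (simp add: m_def L_def) linarith
      have b0: "b \<ge> 0" by (simp add: b_def)
      have m_upper: "real (m n) \<le> (L / 4 + b) / \<zeta>1 + 2"
      proof -
        have "(L / 4 + b) / \<zeta>1 \<ge> 0" using L b0 assms(8) by simp
        then show ?thesis unfolding m_def L_def by linarith
      qed
      have Am: "?A ^ m n \<le> D * real n powr (\<epsilon>0 / 24)"
      proof -
        have "?A ^ m n = ?A powr real (m n)" using A2 by (simp add: powr_realpow)
        also have "\<dots> \<le> ?A powr ((L / 4 + b) / \<zeta>1 + 2)" using A2 m_upper by (intro powr_mono) auto
        also have "(L / 4 + b) / \<zeta>1 + 2 = (b / \<zeta>1 + 2) + L / (4 * \<zeta>1)"
          by (simp add: add_divide_distrib)
        also have "?A powr \<dots> = D * ?A powr (L / (4 * \<zeta>1))" by (simp add: D_def powr_add)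
        also have "?A powr (L / (4 * \<zeta>1)) = real n powr (\<epsilon>0 / 24)"
        proof -
          have "?A = 2 powr r" using A2 by (simp add: r_def)
          then have "?A powr (L / (4 * \<zeta>1)) = 2 powr (r * (L / (4 * \<zeta>1)))" by (simp only: powr_powr)
          also have "r * (L / (4 * \<zeta>1)) = L * (\<epsilon>0 / 24)" by (simp add: \<epsilon>0_def)
          finally show ?thesis by (simp only: n_powr)
        qed
        finally show ?thesis .
      qed
      also have "\<dots> \<le> x n"
        using n True D unfolding x_def by (intro mult_left_mono powr_mono) auto
      finally have Amx: "?A ^ m n \<le> x n" .
      \<comment> \<open>By \<open>m + 1 \<le> 2 ^ m \<le> |A| ^ m\<close> the quantity
        \<open>x n\<close> bounds block lengths as well as the number of contexts.\<close>
      have mx: "real (m n + 1) \<le> x n"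
      proof -
        have "real (m n + 1) \<le> 2 ^ m n"
          using of_nat_mono[of "m n + 1" "2 ^ m n", where 'a = real] less_exp[of "m n"] by simp
        also have "\<dots> \<le> ?A ^ m n" using A2 by (intro power_mono) auto
        finally show ?thesis using Amx by linarith
      qed
      have mn: "m n < n" using mx xn by linarith
      let ?e = "real n powr (7/10)"
      let ?Bad = "{xs\<in>words n. \<exists>z. z \<noteq> [] \<and> length z \<le> m n + 1 \<and> ?e + real (length z) \<le> \<bar>real (cnt xs z) - real n * \<mu> z\<bar>}"
      have "sample X n \<omega> \<in> ?Bad"
        if small: "real (khat IC (sample X n \<omega>)) \<le> 1 / (2 * \<zeta>2) * (1/2 - \<epsilon>) * L" for \<omega>
      proof (rule ccontr)
        define xs where "xs = sample X n \<omega>"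
        define k where "k = khat IC xs"
        assume "sample X n \<omega> \<notin> ?Bad"
        then have not_bad: "xs \<notin> ?Bad" unfolding xs_def .
        have len: "length xs = n" by (simp add: xs_def length_sample)
        then have "xs \<in> words n" by (simp add: words_def)
        then have good: "\<bar>real (cnt xs z) - real n * \<mu> z\<bar> \<le> ?e + real (length z)"
          if "z \<noteq> []" "length z \<le> m n + 1" for z
          using not_bad that less_imp_le[OF not_le_imp_less] by blast
        have ne: "xs \<noteq> []" using len n by auto
        have k\<zeta>: "\<zeta>2 * real k \<le> (1/4 - \<epsilon> / 2) * L"
          using small assms(9) by (simp add: k_def xs_def field_simps)
        also have "\<dots> \<le> 1/4 * L" using L \<epsilon> \<epsilon>0 by (intro mult_right_mono) auto
        finally have "\<zeta>2 * real k \<le> L / 4" by simp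
        have "real k < real (m n)"
        proof -
          have "\<zeta>1 * real k \<le> \<zeta>2 * real k" using assms(12) by (intro mult_right_mono) auto
          then have "real k \<le> (L / 4 + b) / \<zeta>1"
            using \<open>\<zeta>2 * real k \<le> L / 4\<close> b0 assms(8) by (simp add: field_simps)
          then show ?thesis using m_lower by linarith
        qed
        then have km: "k < m n" by simp
        define j where "j = m n - k"
        have jk: "j + k = m n" using km by (simp add: j_def)
        have \<beta>m: "\<beta> (m n) \<le> \<alpha> k / 2"
        proof -
          have "L / 4 + b \<le> \<zeta>1 * real (m n)"
            using m_lower assms(8) by (simp add: field_simps)
          moreover have "log 2 (2 * \<delta>1 / \<delta>2) \<le> b" by (simp add: b_def)
          ultimately have "- \<zeta>1 * real (m n) \<le> - \<zeta>2 * real k - log 2 (2 * \<delta>1 / \<delta>2)"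
            using \<open>\<zeta>2 * real k \<le> L / 4\<close> by linarith
          then have "2 powr (- \<zeta>1 * real (m n)) \<le> 2 powr (- \<zeta>2 * real k - log 2 (2 * \<delta>1 / \<delta>2))"
            by simp
          also have "\<dots> = 2 powr (- \<zeta>2 * real k) / (2 * \<delta>1 / \<delta>2)"
            using assms(10,11) by (simp add: powr_diff)
          finally show ?thesis using assms(10,11) by (simp add: \<alpha>_def \<beta>_def field_simps)
        qed
        \<comment> \<open>Half of the lower bound for \<open>n * \<alpha> k / 2\<close>; the other
          half absorbs the count errors. Then \<open>S\<^sup>2 / (4 * n)\<close> equals
          \<open>(\<delta>2\<^sup>2 / 64) * n powr (\<epsilon> + 1/2)\<close>.\<close>
        define S where "S = \<delta>2 / 4 * real n powr (3/4 + \<epsilon> / 2)"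
        have "S\<^sup>2 / (4 * real n) \<le> ln (MLk (j + k) xs) - ln (MLk k xs)"
        proof (rule ln_MLk_gap[where e = "?e + x n" and G = "\<alpha> k / 2"])
          fix z :: "'a list" assume z: "z \<noteq> []" "length z \<le> j + k + 1"
          then have "real (length z) \<le> x n" using mx by (simp add: jk)
          then show "\<bar>real (cnt xs z) - real n * \<mu> z\<bar> \<le> ?e + x n"
            using good[of z] z by (simp add: jk)
        next
          fix w :: "'a list" assume w: "length w = j + k" "\<mu> w > 0"
          have "\<alpha> k - \<beta> (m n) \<le> (\<Sum>a\<in>UNIV. \<bar>kernel w a - kernel (drop j w) a\<bar>)"
            using kernel_suffix_dist(2)[of "take j w" "drop j w"] w jk[symmetric] by simp
          then show "\<alpha> k / 2 \<le> (\<Sum>a\<in>UNIV. \<bar>kernel w a - kernel (drop j w) a\<bar>)"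
            using \<beta>m by linarith
        next
          show "S \<ge> 0" using assms(11) by (simp add: S_def)
          have "2 powr (- ((1/4 - \<epsilon> / 2) * L)) \<le> 2 powr (- \<zeta>2 * real k)"
            using k\<zeta> by simp
          then have "real n powr (- 1/4 + \<epsilon> / 2) \<le> 2 powr (- \<zeta>2 * real k)"
            by (simp add: n_powr algebra_simps)
          then have "real n powr 1 * real n powr (- 1/4 + \<epsilon> / 2) \<le> real n * 2 powr (- \<zeta>2 * real k)"
            using n by (simp add: mult_left_mono)
          also have "real n powr 1 * real n powr (- 1/4 + \<epsilon> / 2) = real n powr (3/4 + \<epsilon> / 2)"
            by (subst powr_add[symmetric]) (simp add: add.commute)
          finally have "real n powr (3/4 + \<epsilon> / 2) \<le> real n * 2 powr (- \<zeta>2 * real k)" .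
          then have "2 * S \<le> real n * (\<alpha> k / 2)"
            using assms(11) by (simp add: S_def \<alpha>_def)
          moreover have "4 * ?A ^ (j + k + 1) * (?e + x n) \<le> S"
          proof -
            have "4 * ?A ^ (j + k + 1) * (?e + x n) = 4 * (?A * ?A ^ m n) * (?e + x n)"
              by (simp add: jk[symmetric])
            also have "\<dots> \<le> 4 * (?A * x n) * (?e + x n)"
              using Amx mx by (intro mult_right_mono mult_left_mono) auto
            also have "\<dots> \<le> \<delta>2 / 4 * real n powr (3/4)" by (rule err)
            also have "\<dots> \<le> S"
              unfolding S_def using assms(11) n \<epsilon> \<epsilon>0 by (intro mult_left_mono powr_mono) auto
            finally show ?thesis .
          qed
          ultimately show "S \<le> real n * (\<alpha> k / 2) - 4 * ?A ^ (j + k + 1) * (?e + x n)" by linarith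
          show "0 \<le> ?e + x n" using mx by (simp add: add_nonneg_nonneg)
        qed (use ne len in auto)
        then have gap: "S\<^sup>2 / (4 * real n) \<le> ln (MLk (m n) xs) - ln (MLk k xs)" by (simp only: jk)
        have "IC k xs \<le> IC (m n) xs"
          unfolding k_def using mn len by (intro khat_minimal ne) simp
        then have "ln 2 * IC k xs \<le> ln 2 * IC (m n) xs" by simp
        moreover have "\<bar>ln 2 * IC (m n) xs + ln (MLk (m n) xs)\<bar> \<le> B * ?A ^ m n * sqrt (real n)"
          using B(2)[of xs "m n"] len n ne by simp
        moreover have "\<bar>ln 2 * IC k xs + ln (MLk k xs)\<bar> \<le> B * ?A ^ k * sqrt (real n)"
          using B(2)[of xs k] len n ne by simp
        \<comment> \<open>Since \<open>k < m n\<close>, the penalty at \<open>k\<close> is bounded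
          by the one at \<open>m n\<close>, giving the factor 2 in the comparison.\<close>
        moreover have "B * ?A ^ k * sqrt (real n) \<le> B * ?A ^ m n * sqrt (real n)"
          using B(1) A2 km by (intro mult_right_mono mult_left_mono power_increasing) auto
        ultimately have "S\<^sup>2 / (4 * real n) \<le> 2 * B * ?A ^ m n * sqrt (real n)"
          using gap by linarith
        also have "\<dots> \<le> 2 * B * (D * real n powr (\<epsilon>0 / 24)) * sqrt (real n)"
          using Am B(1) by (intro mult_right_mono mult_left_mono) auto
        also have "\<dots> = (2 * B * D) * real n powr (\<epsilon>0 / 24) * sqrt (real n)" by simp
        also have "\<dots> < (\<delta>2\<^sup>2 / 64) * real n powr \<epsilon>0 * sqrt (real n)"
          using pnl n by (intro mult_strict_right_mono) auto
        \<comment> \<open>The penalty was compared at \<open>\<epsilon>0\<close>, which fixes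
          \<open>|A| ^ m\<close>; the gap only improves when \<open>\<epsilon>0\<close> is raised to
          \<open>\<epsilon>\<close>.\<close>
        also have "\<dots> \<le> (\<delta>2\<^sup>2 / 64) * real n powr \<epsilon> * sqrt (real n)"
          using \<epsilon> n by (intro mult_right_mono mult_left_mono powr_mono) auto
        also have "\<dots> = S\<^sup>2 / (4 * real n)"
        proof -
          have "(real n powr (3/4 + \<epsilon> / 2))\<^sup>2 = real n powr ((3/4 + \<epsilon> / 2) * 2)"
            using powr_powr[of "real n" "3/4 + \<epsilon> / 2" 2] n by (simp add: powr_realpow)
          also have "(3/4 + \<epsilon> / 2) * 2 = \<epsilon> + 1/2 + 1" by simp
          also have "real n powr (\<epsilon> + 1/2 + 1) = real n powr \<epsilon> * sqrt (real n) * real n"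
            using n by (simp only: powr_add powr_half_sqrt[of "real n"]) simp
          finally show ?thesis using n by (simp add: S_def power_mult_distrib power_divide)
        qed
        finally show False by simp
      qed
      then have "{\<omega>\<in>space M. real (khat IC (sample X n \<omega>)) \<le> 1 / (2 * \<zeta>2) * (1/2 - \<epsilon>) * log 2 (real n)} \<subseteq>
          {\<omega>\<in>space M. sample X n \<omega> \<in> ?Bad}" by (auto simp: L_def)
      then have "measure M {\<omega>\<in>space M. real (khat IC (sample X n \<omega>)) \<le> 1 / (2 * \<zeta>2) * (1/2 - \<epsilon>) * log 2 (real n)} \<le>
          measure M {\<omega>\<in>space M. sample X n \<omega> \<in> ?Bad}"
        by (intro finite_measure_mono sample_in(1)) auto
      also have "\<dots> = (\<Sum>xs\<in>?Bad. \<mu> xs)" by (rule sample_in(2)) auto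
      also have "\<dots> \<le> 2 * real (m n + 1) * ?A ^ (m n + 1) * exp (- ?e\<^sup>2 / (real n * (K * real (m n + 1))\<^sup>2))"
        using n by (intro K(2)) auto
      also have "\<dots> \<le> 2 * x n * (?A * x n) * exp (- ?e\<^sup>2 / (real n * (K * x n)\<^sup>2))"
      proof (intro mult_mono)
        have "real n * (K * real (m n + 1))\<^sup>2 \<le> real n * (K * x n)\<^sup>2"
          using mx K(1) by (intro mult_left_mono power_mono) auto
        moreover have "real n * (K * real (m n + 1))\<^sup>2 > 0" using n K(1) by simp
        ultimately show "exp (- ?e\<^sup>2 / (real n * (K * real (m n + 1))\<^sup>2)) \<le> exp (- ?e\<^sup>2 / (real n * (K * x n)\<^sup>2))"
          by (simp add: frac_le)
        show "?A ^ (m n + 1) \<le> ?A * x n" using Amx A2 by simp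
      qed (use mx in auto)
      also have "\<dots> \<le> exp (- (real n powr (1/4)))" by (rule tail)
      also have "\<dots> \<le> exp (- (\<epsilon> ^ 3 / log 2 (real n)) * real n powr (\<epsilon> / 2))"
      proof -
        \<comment> \<open>As \<open>\<epsilon> < 1/2\<close> and \<open>L \<ge> 1\<close>, the
          required exponent is at most \<open>n powr (1/4)\<close>, so the concentration bound is
          already strong enough.\<close>
        have "\<epsilon> ^ 3 / L \<le> 1 / 1" using \<epsilon> \<epsilon>0 L by (intro frac_le power_le_one) auto
        then have "\<epsilon> ^ 3 / L * real n powr (\<epsilon> / 2) \<le> 1 * real n powr (1/4)"
          using \<epsilon> n by (intro mult_mono powr_mono) auto
        then show ?thesis by (simp add: L_def)
      qed
      finally show ?thesis .
    qed
    then show ?thesis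
      by (intro exI[of _ 1] exI[of _ 0] conjI exI[of _ "max n0 1"]) (auto simp: \<epsilon>0_def r_def)
  qed
qed

end
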